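(* Suppose the ABC assumption (with constants $C,D\ge 0$) and the smoothness assumption (with constant $L$) hold, let $\{x_t\}$ be generated by SCAFFOLD run for $T\ge1$ rounds, and let the effective stepsize $\tilde\eta:=\eta_a\eta_sQ$ satisfy $$\tilde\eta\le\min\left\{\frac{\eta_s}{\sqrt{84L(L+C)}},\ \frac{1}{12(L+C)},\ \sqrt{\frac{2nQ}{(L^2+C^2)T}},\ \left(\frac{\eta_s^2Q}{560LC(L+C)T}\right)^{1/3}\right\}.$$ Then $$\min_{t=0,1,\ldots,T-1}\mathbb{E}\left[\|\nabla f(x_t)\|^2\right]\le\frac{36(f(x_0)-f^* )}{\tilde\eta T}+\frac{192\tilde\eta^2L^2(\Delta_1+\Delta_2)}{\eta_s^2T}+\frac{2\tilde\eta L(2C\sigma_f^*+D)}{nQ}+\frac{\left(3L/T+14(L+C)\right)64\tilde\eta^2L(2C\sigma_f^*+D)}{\eta_s^2Q},$$ where $\Delta_1:=\frac1n\sum_{i=1}^n\|c_{i,0}-c_0\|^2$ and $\Delta_2:=\frac1n\sum_{i=1}^n\|\nabla f_i(x_0)\|^2$. In addition, if $$\tilde\eta=\frac{1}{\sqrt{\frac{(L^2+C^2)T}{2nQ}}+12(L+C)+\gamma_s},\qquad \gamma_s:=\frac{\sqrt{84L(L+C)}}{\eta_s}+\left(\frac{560LC(L+C)T}{\eta_sQ}\right)^{1/3},$$ then $$\min_{t=0,1,\ldots,T-1}\mathbb{E}\left[\|\nabla f(x_t)\|^2\right]=\mathcal{O}\left(\frac{D+C\left(f^*-\frac1n\sum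_{i=1}^nf_i^*\right)}{\sqrt{nQT}}+\frac{C}{(\eta_sQ)^{1/3}T^{2/3}}+\frac{nD+nC\left(f^*-\frac1n\sum_{i=1}^nf_i^*\right)}{\eta_s^2T}\right).$$
   Context: Setting: $n,p,Q\ge 1$ are integers, $[n]=\{1,\ldots,n\}$, $f_i:\mathbb{R}^p\to\mathbb{R}$ for $i\in[n]$, and $f=\frac1n\sum_{i=1}^n f_i$. Notation: $f_i^*:=\inf_x f_i(x)$, $f^*:=\inf_x f(x)$, $\sigma_f^*:=f^*-\frac1n\sum_{i=1}^n f_i^*$; $\|\cdot\|$ is the Euclidean norm. SCAFFOLD (full participation): inputs are $x_0\in\mathbb{R}^p$, $c_{i,0}\in\mathbb{R}^p$ for $i\in[n]$, number of local updates $Q$, server stepsize $\eta_s>0$, agent stepsize $\eta_a>0$; set $c_0=\frac1n\sum_i c_{i,0}$. In round $t=0,1,\ldots$ each agent $i$ sets $x_{i,t}^0=x_t$ and performs, for $\ell=0,\ldots,Q-1$, $x_{i,t}^{\ell+1}=x_{i,t}^\ell-\eta_a\left(g_i(x_{i,t}^\ell;\xi_{i,t}^\ell)-c_{i,t}+c_t\right)$, where $g_i(x_{i,t}^\ell;\xi_{i,t}^\ell)$ is a stochastic gradient; then $c_{i,t+1}=c_{i,t}-c_t+\frac{1}{\eta_aQ}(x_t-x_{i,t}^Q)$. The server sets $x_{t+1}=x_t+\frac{\eta_s}{n}\sum_i(x_{i,t}^Q-x_t)$ and $c_{t+1}=c_t+\frac1n\sum_i(c_{i,t+1}-c_{i,t})$.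 Smoothness assumption: each $f_i$ is $L$-smooth, i.e. $\|\nabla f_i(x)-\nabla f_i(x')\|\le L\|x-x'\|$ for all $x,x'\in\mathbb{R}^p$, and bounded from below, $f_i(x)\ge f_i^*>-\infty$. ABC assumption: there is a filtration $\mathcal{F}_0^0\subset\mathcal{F}_0^1\subset\cdots\subset\mathcal{F}_0^{Q-1}\subset\mathcal{F}_1^0\subset\mathcal{F}_1^1\subset\cdots$ (write $\mathcal{F}_k:=\mathcal{F}_k^0$) to which the process $\{x_{i,k}^\ell: i\in[n],\ 0\le\ell\le Q-1\}$ is adapted, and each $g_i(x_{i,k}^\ell;\xi_{i,k}^\ell)$ is $\mathcal{F}_{k+1}^\ell$-measurable. There are constants $C,D\ge0$ such that for all $k\in\mathbb{N}$, $i\in[n]$, $\ell\in\{0,\ldots,Q-1\}$, almost surely $\mathbb{E}[g_i(x;\xi_{i,k}^\ell)\mid\mathcal{F}_k^\ell]=\nabla f_i(x)$ and $\mathbb{E}[\|g_i(x;\xi_{i,k}^\ell)-\nabla f_i(x)\|^2\mid\mathcal{F}_k^\ell]\le C[f_i(x)-f_i^*]+D$ (applied in particular at $x=x_{i,k}^\ell$). In addition, the stochastic gradients are independent across different agents at each $k\ge0$. Conventions: fractions with $C$ in the denominator are read as $+\infty$ when $C=0$. $\mathcal{O}(\cdot)$ denotes the order in $T$ as $T\to\infty$; the suppressed factors do not depend on $T$ and may involve undisplayed quantities such as $L$ and $f(x_0)-f^*$.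
   Formalization: The second claim (the O-rate) is proved only when D + C(f* − (1/n)Σ f_i* ) > 0; otherwise it fails: with C = D = 0, exact gradients and f(x) = x²/2, the right side is 0 while the gradients are nonzero. *)

theory Defs
  imports "HOL-Probability.Probability" "HOL-Library.Landau_Symbols"
begin

section \<open>Smooth finite sums\<close>

definition gradient :: "('v::real_inner \<Rightarrow> real) \<Rightarrow> 'v \<Rightarrow> 'v" where
  "gradient h x = (THE d. GDERIV h x :> d)"

lemma gradient_eq:
  assumes "GDERIV h x :> d"
  shows "gradient h x = d"
  unfolding gradient_def
proof (intro the_equality)
  show "GDERIV h x :> d" by fact
next
  fix e assume "GDERIV h x :> e"
  with assms have "(\<lambda>u. u \<bullet> d) = (\<lambda>u. u \<bullet> e)"
    unfolding gderiv_def by (rule has_derivative_unique)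
  then have "(e - d) \<bullet> d = (e - d) \<bullet> e" by meson
  then have "(e - d) \<bullet> (e - d) = 0" by (simp add: inner_diff_right)
  then show "e = d" by simp
qed

definition smooth_with :: "real \<Rightarrow> ('v::real_inner \<Rightarrow> real) \<Rightarrow> bool" where
  "smooth_with L h \<longleftrightarrow>
     (\<forall>x. GDERIV h x :> gradient h x) \<and> L-lipschitz_on UNIV (gradient h)"

definition mean_fun :: "nat \<Rightarrow> (nat \<Rightarrow> 'v \<Rightarrow> real) \<Rightarrow> 'v \<Rightarrow> real" where
  "mean_fun n f x = (1 / real n) * (\<Sum>i=1..n. f i x)"

definition sigma_star :: "nat \<Rightarrow> (nat \<Rightarrow> 'v \<Rightarrow> real) \<Rightarrow> real" where
  "sigma_star n f = (INF x. mean_fun n f x) - (1 / real n) * (\<Sum>i=1..n. (INF x. f i x))"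


section \<open>SCAFFOLD with full participation\<close>

text \<open>The algorithm is defined along one realisation of the randomness: \<open>G i t l x\<close> is the value
  that agent \<open>i\<close> receives when it queries its stochastic gradient at \<open>x\<close> in local step \<open>l\<close> of
  round \<open>t\<close>.\<close>

primrec local_step ::
  "(nat \<Rightarrow> 'v \<Rightarrow> 'v) \<Rightarrow> real \<Rightarrow> 'v \<Rightarrow> 'v \<Rightarrow> 'v \<Rightarrow> nat \<Rightarrow> 'v::real_vector" where
  "local_step G \<eta>\<^sub>a ci c x 0 = x"
| "local_step G \<eta>\<^sub>a ci c x (Suc l) =
     local_step G \<eta>\<^sub>a ci c x l - \<eta>\<^sub>a *\<^sub>R (G l (local_step G \<eta>\<^sub>a ci c x l) - ci + c)"

definition mean_vec :: "nat \<Rightarrow> (nat \<Rightarrow> 'v::real_vector) \<Rightarrow> 'v" where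
  "mean_vec n v = (1 / real n) *\<^sub>R (\<Sum>i=1..n. v i)"

text \<open>The state after \<open>t\<close> rounds is the triple of \<open>x\<^sub>t\<close>, the family \<open>c\<^sub>i\<^sub>,\<^sub>t\<close> and \<open>c\<^sub>t\<close>.\<close>

primrec scaffold_state ::
  "nat \<Rightarrow> nat \<Rightarrow> real \<Rightarrow> real \<Rightarrow> 'v \<Rightarrow> (nat \<Rightarrow> 'v) \<Rightarrow> (nat \<Rightarrow> nat \<Rightarrow> nat \<Rightarrow> 'v \<Rightarrow> 'v) \<Rightarrow> nat
     \<Rightarrow> 'v \<times> (nat \<Rightarrow> 'v) \<times> 'v::real_vector" where
  "scaffold_state n Q \<eta>\<^sub>s \<eta>\<^sub>a x0 c0 G 0 = (x0, c0, mean_vec n c0)"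
| "scaffold_state n Q \<eta>\<^sub>s \<eta>\<^sub>a x0 c0 G (Suc t) =
     (let (x, ci, c) = scaffold_state n Q \<eta>\<^sub>s \<eta>\<^sub>a x0 c0 G t;
          xQ = (\<lambda>i. local_step (G i t) \<eta>\<^sub>a (ci i) c x Q);
          ci' = (\<lambda>i. ci i - c + (1 / (\<eta>\<^sub>a * real Q)) *\<^sub>R (x - xQ i))
      in (x + \<eta>\<^sub>s *\<^sub>R mean_vec n (\<lambda>i. xQ i - x), ci', c + mean_vec n (\<lambda>i. ci' i - ci i)))"

definition scaffold_x ::
  "nat \<Rightarrow> nat \<Rightarrow> real \<Rightarrow> real \<Rightarrow> 'v \<Rightarrow> (nat \<Rightarrow> 'v) \<Rightarrow> (nat \<Rightarrow> 'v \<Rightarrow> 's \<Rightarrow> 'v)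
     \<Rightarrow> (nat \<Rightarrow> nat \<Rightarrow> nat \<Rightarrow> 'w \<Rightarrow> 's) \<Rightarrow> nat \<Rightarrow> 'w \<Rightarrow> 'v::real_vector" where
  "scaffold_x n Q \<eta>\<^sub>s \<eta>\<^sub>a x0 c0 g \<xi> t \<omega> =
     fst (scaffold_state n Q \<eta>\<^sub>s \<eta>\<^sub>a x0 c0 (\<lambda>i k l x. g i x (\<xi> i k l \<omega>)) t)"

definition scaffold_local ::
  "nat \<Rightarrow> nat \<Rightarrow> real \<Rightarrow> real \<Rightarrow> 'v \<Rightarrow> (nat \<Rightarrow> 'v) \<Rightarrow> (nat \<Rightarrow> 'v \<Rightarrow> 's \<Rightarrow> 'v)
     \<Rightarrow> (nat \<Rightarrow> nat \<Rightarrow> nat \<Rightarrow> 'w \<Rightarrow> 's) \<Rightarrow> nat \<Rightarrow> nat \<Rightarrow> nat \<Rightarrow> 'w \<Rightarrow> 'v::real_vector" where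
  "scaffold_local n Q \<eta>\<^sub>s \<eta>\<^sub>a x0 c0 g \<xi> i t l \<omega> =
     (let (x, ci, c) = scaffold_state n Q \<eta>\<^sub>s \<eta>\<^sub>a x0 c0 (\<lambda>i k l x. g i x (\<xi> i k l \<omega>)) t
      in local_step (\<lambda>l x. g i x (\<xi> i t l \<omega>)) \<eta>\<^sub>a (ci i) c x l)"


section \<open>Stochastic gradients under the ABC condition\<close>

definition vec_cond_exp ::
  "'w measure \<Rightarrow> 'w measure \<Rightarrow> ('w \<Rightarrow> real ^ 'p) \<Rightarrow> 'w \<Rightarrow> real ^ 'p::finite" where
  "vec_cond_exp M F X \<omega> = (\<chi> j. real_cond_exp M F (\<lambda>\<omega>. X \<omega> $ j) \<omega>)"

text \<open>Mutual conditional independence, given the sub-sigma-algebra \<open>F\<close>, of a finite family of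
  random vectors. Product events over subfamilies are covered by choosing \<open>A i = UNIV\<close>.\<close>

definition cond_indep_vars ::
  "'w measure \<Rightarrow> 'w measure \<Rightarrow> ('i \<Rightarrow> 'w \<Rightarrow> 'b::topological_space) \<Rightarrow> 'i set \<Rightarrow> bool" where
  "cond_indep_vars M F X I \<longleftrightarrow>
     (\<forall>A. (\<forall>i\<in>I. A i \<in> sets borel) \<longrightarrow>
        (AE \<omega> in M. real_cond_exp M F (\<lambda>\<omega>. \<Prod>i\<in>I. indicator (A i) (X i \<omega>)) \<omega>
                  = (\<Prod>i\<in>I. real_cond_exp M F (\<lambda>\<omega>. indicator (A i) (X i \<omega>)) \<omega>)))"

text \<open>\<open>X\<close> is the query point (possibly random) and \<open>Y\<close> the stochastic gradient returned there.
  The conditional variance is taken with values in \<open>ennreal\<close>, so that the bound includes its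
  almost sure finiteness; in particular the conditional mean is then meaningful without a
  separate integrability requirement.\<close>

definition abc_at ::
  "'w measure \<Rightarrow> 'w measure \<Rightarrow> (real ^ 'p \<Rightarrow> real) \<Rightarrow> real \<Rightarrow> real
     \<Rightarrow> ('w \<Rightarrow> real ^ 'p::finite) \<Rightarrow> ('w \<Rightarrow> real ^ 'p) \<Rightarrow> bool" where
  "abc_at M F h C D X Y \<longleftrightarrow>
     Y \<in> borel_measurable M \<and>
     (AE \<omega> in M. vec_cond_exp M F Y \<omega> = gradient h (X \<omega>)) \<and>
     (AE \<omega> in M. nn_cond_exp M F (\<lambda>\<omega>. ennreal ((norm (Y \<omega> - gradient h (X \<omega>)))\<^sup>2)) \<omega>
                  \<le> ennreal (C * (h (X \<omega>) - (INF x. h x)) + D))"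

text \<open>\<open>y i k l\<close> is the iterate of agent \<open>i\<close> in local step \<open>l\<close> of round \<open>k\<close>. The map
  \<open>m \<mapsto> (m div Q, m mod Q)\<close> enumerates the pairs \<open>(k, l)\<close> with \<open>l < Q\<close> lexicographically.
  The conditions on mean and variance are imposed at all fixed points and at the iterates.
  Independence across agents is conditional on the past \<open>F k l\<close>: in a given round all
  gradients depend on the common random iterate.\<close>

definition abc_condition ::
  "nat \<Rightarrow> nat \<Rightarrow> (nat \<Rightarrow> real ^ 'p \<Rightarrow> real) \<Rightarrow> real \<Rightarrow> real \<Rightarrow> 'w measure
     \<Rightarrow> (nat \<Rightarrow> nat \<Rightarrow> 'w measure) \<Rightarrow> (nat \<Rightarrow> real ^ 'p \<Rightarrow> 's \<Rightarrow> real ^ 'p)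
     \<Rightarrow> (nat \<Rightarrow> nat \<Rightarrow> nat \<Rightarrow> 'w \<Rightarrow> 's) \<Rightarrow> (nat \<Rightarrow> nat \<Rightarrow> nat \<Rightarrow> 'w \<Rightarrow> real ^ 'p::finite) \<Rightarrow> bool"
where
  "abc_condition n Q f C D M F g \<xi> y \<longleftrightarrow>
     prob_space M \<and>
     filtration (space M) (\<lambda>m::nat. F (m div Q) (m mod Q)) \<and>
     (\<forall>k. \<forall>l<Q. subalgebra M (F k l)) \<and>
     (\<forall>k. \<forall>l<Q. \<forall>i\<in>{1..n}.
        y i k l \<in> borel_measurable (F k l) \<and>
        (\<lambda>\<omega>. g i (y i k l \<omega>) (\<xi> i k l \<omega>)) \<in> borel_measurable (F (Suc k) l) \<and>
        abc_at M (F k l) (f i) C D (y i k l) (\<lambda>\<omega>. g i (y i k l \<omega>) (\<xi> i k l \<omega>)) \<and>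
        (\<forall>x. abc_at M (F k l) (f i) C D (\<lambda>_. x) (\<lambda>\<omega>. g i x (\<xi> i k l \<omega>)))) \<and>
     (\<forall>k. \<forall>l<Q. cond_indep_vars M (F k l) (\<lambda>i \<omega>. g i (y i k l \<omega>) (\<xi> i k l \<omega>)) {1..n})"


section \<open>Stepsize threshold\<close>

text \<open>The last entry has \<open>C\<close> as a factor of its denominator and is infinite for \<open>C = 0\<close>.\<close>

definition stepsize_cap :: "nat \<Rightarrow> nat \<Rightarrow> real \<Rightarrow> real \<Rightarrow> real \<Rightarrow> nat \<Rightarrow> ereal" where
  "stepsize_cap n Q L C \<eta>\<^sub>s T = Min
     {ereal (\<eta>\<^sub>s / sqrt (84 * L * (L + C))),
      ereal (1 / (12 * (L + C))),
      ereal (sqrt (2 * real n * real Q / ((L\<^sup>2 + C\<^sup>2) * real T))),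
      (if C = 0 then \<infinity>
       else ereal ((\<eta>\<^sub>s\<^sup>2 * real Q / (560 * L * C * (L + C) * real T)) powr (1/3)))}"

end

theory Submission
  imports Defs
begin

text \<open>Since the control variates of the agents are centred, one round moves the server by a gradient step
  of length \<open>\<eta> = \<eta>\<^sub>a \<eta>\<^sub>s Q\<close> on the average \<open>f\<close> in which the gradient is replaced by the mean of the
  sampled local gradients. Two errors enter: the averaged sampling noise, and the drift of the local iterates
  away from \<open>x\<^sub>t\<close>. Let \<open>\<delta> = (\<eta> / \<eta>\<^sub>s)\<^sup>2 = (\<eta>\<^sub>a Q)\<^sup>2\<close>, the squared total length
  of the local steps of a round. The drift is at most of order \<open>\<delta>\<close> times the sum of the squared gradient of \<open>f\<close>, the control
  error (the mean squared distance of the control variates to the local gradients, after centring), and the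
  noise level divided by \<open>Q\<close> (\<open>drift_le\<close>); the next control error is bounded by the step length, the
  drift and the noise (\<open>control_error_Suc\<close>). By the ABC condition and smoothness the noise level is itself at
  most \<open>2C\<sigma>\<^sup>* + D\<close> plus multiples of the suboptimality gap and the drift (\<open>avg_noise_le\<close>).

  Everything is absorbed by one potential: the gap, plus \<open>p = 6 \<eta> L\<^sup>2 \<delta>\<close> times the control error, plus
  \<open>4p / Q\<close> times the noise level of the preceding round. By \<open>lyapunov_step\<close> it grows in each round by a
  factor at most \<open>1 + \<rho>\<close>, loses \<open>3\<eta>/7\<close> times the expected squared gradient, and gains a multiple of
  \<open>2C\<sigma>\<^sup>* + D\<close>. The third and fourth caps on the stepsize give \<open>\<rho> T \<le> 3/2\<close>, so that
  \<open>(1 + \<rho>) ^ T \<le> 11/2\<close> (\<open>exp_three_halves_le\<close>), and solving the recursion (\<open>min_le_of_recursion\<close>) yields the explicit bound.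

  The factor \<open>1/Q\<close> in front of the noise rests on orthogonality, which is delicate because a gradient
  sampled in local step \<open>l\<close> becomes measurable only in step \<open>l\<close> of the following round. Adaptedness of
  the iterates makes the sampled gradients known earlier, but only up to the control variate, whose
  last summand may still be unknown. Averaged over the agents the control variates cancel, and the averaged noise
  is a martingale difference sequence (\<open>sum_noise_meas\<close>, \<open>mean_noise_le\<close>). For a single agent the noise minus \<open>1/Q\<close> times
  the last noise of the preceding round is known one step later (\<open>noise_minus_last_noise_meas\<close>), and the resulting
  correlations only cost a constant factor and a dependence on the preceding round
  (\<open>local_noise_sum_le\<close>); this is why the potential remembers that noise level.

  For the prescribed stepsize, \<open>1/\<eta>\<close> is of exact order \<open>\<surd>T\<close>. The second and third caps alone
  then bound \<open>\<rho> T\<close> independently of \<open>T\<close>, so all terms of the bound are of order \<open>1 / \<surd>T\<close>, the order of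
  the first term of the claimed rate.\<close>

section \<open>Smooth functions and their averages\<close>

lemma smooth_with_GDERIV: "smooth_with L h \<Longrightarrow> GDERIV h x :> gradient h x"
  by (simp add: smooth_with_def)

lemma smooth_with_lipschitz:
  "smooth_with L h \<Longrightarrow> norm (gradient h x - gradient h y) \<le> L * norm (x - y)"
  by (auto simp: smooth_with_def lipschitz_on_def dist_norm)

lemma smooth_with_nonneg: "smooth_with L h \<Longrightarrow> 0 \<le> L"
  by (auto simp: smooth_with_def lipschitz_on_def)

lemma smooth_with_continuous: "smooth_with L h \<Longrightarrow> continuous_on UNIV h"
  unfolding smooth_with_def gderiv_def
  by (meson continuous_at_imp_continuous_on has_derivative_continuous)

lemma smooth_with_continuous_gradient: "smooth_with L h \<Longrightarrow> continuous_on UNIV (gradient h)"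
  unfolding smooth_with_def by (meson lipschitz_on_continuous_on)

text \<open>The difference of the two sides along the segment from \<open>x\<close> to \<open>y\<close> has a nonpositive derivative
  by the Lipschitz condition.\<close>

lemma smooth_with_upper_bound:
  fixes h :: "'v::real_inner \<Rightarrow> real"
  assumes h: "smooth_with L h"
  shows "h y \<le> h x + gradient h x \<bullet> (y - x) + L / 2 * (norm (y - x))\<^sup>2"
proof -
  define d where "d = y - x"
  define \<psi> where "\<psi> s = h (x + s *\<^sub>R d) - s * (gradient h x \<bullet> d) - L / 2 * s\<^sup>2 * (norm d)\<^sup>2" for s :: real
  have deriv: "(\<psi> has_real_derivative
      (gradient h (x + s *\<^sub>R d) \<bullet> d - gradient h x \<bullet> d - L * s * (norm d)\<^sup>2)) (at s)" for s
  proof -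
    have "(h has_derivative (\<lambda>u. u \<bullet> gradient h (x + s *\<^sub>R d))) (at (x + s *\<^sub>R d))"
      using smooth_with_GDERIV[OF h] by (simp add: gderiv_def)
    moreover have "((\<lambda>s. x + s *\<^sub>R d) has_derivative (\<lambda>u. u *\<^sub>R d)) (at s)"
      by (auto intro!: derivative_eq_intros)
    ultimately have "((\<lambda>s. h (x + s *\<^sub>R d)) has_derivative
        (\<lambda>u. (u *\<^sub>R d) \<bullet> gradient h (x + s *\<^sub>R d))) (at s)"
      by (rule has_derivative_compose[rotated])
    then have "((\<lambda>s. h (x + s *\<^sub>R d)) has_real_derivative gradient h (x + s *\<^sub>R d) \<bullet> d) (at s)"
      by (simp add: has_field_derivative_def inner_commute mult.commute[of _ "_ \<bullet> _"])
    then show ?thesis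
      unfolding \<psi>_def by (auto intro!: derivative_eq_intros)
  qed
  have "gradient h (x + s *\<^sub>R d) \<bullet> d - gradient h x \<bullet> d - L * s * (norm d)\<^sup>2 \<le> 0" if "0 \<le> s" for s
  proof -
    have "(gradient h (x + s *\<^sub>R d) - gradient h x) \<bullet> d
        \<le> norm (gradient h (x + s *\<^sub>R d) - gradient h x) * norm d"
      by (rule norm_cauchy_schwarz)
    also have "\<dots> \<le> (L * norm (s *\<^sub>R d)) * norm d"
      using smooth_with_lipschitz[OF h, of "x + s *\<^sub>R d" x] by (intro mult_right_mono) auto
    finally show ?thesis
      using that by (simp add: inner_diff_left power2_eq_square mult_ac)
  qed
  then have "\<psi> 1 \<le> \<psi> 0"
    using deriv by (intro DERIV_nonpos_imp_nonincreasing[of 0 1 \<psi>]) force+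
  then show ?thesis
    by (simp add: \<psi>_def d_def)
qed

text \<open>A gradient step of length \<open>1/L\<close> decreases \<open>h\<close> by \<open>\<parallel>\<nabla>h\<parallel>\<^sup>2 / (2L)\<close> but cannot pass below the infimum.\<close>

lemma smooth_with_norm_gradient_le:
  fixes h :: "'v::real_inner \<Rightarrow> real"
  assumes h: "smooth_with L h" and L: "L > 0" and bdd: "bdd_below (range h)"
  shows "(norm (gradient h x))\<^sup>2 \<le> 2 * L * (h x - (INF x. h x))"
proof -
  define y where "y = x - (1 / L) *\<^sub>R gradient h x"
  have "(INF x. h x) \<le> h y"
    using bdd by (intro cINF_lower) auto
  also have "h y \<le> h x + gradient h x \<bullet> (y - x) + L / 2 * (norm (y - x))\<^sup>2"
    by (rule smooth_with_upper_bound[OF h])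
  also have "\<dots> = h x - (norm (gradient h x))\<^sup>2 / (2 * L)"
    using L by (simp add: y_def power_divide dot_square_norm field_simps power2_eq_square)
  finally show ?thesis
    using L by (simp add: field_simps)
qed

text \<open>Transfers the suboptimality at a local iterate \<open>y\<close>, which controls the variance there, to the round's
  starting point \<open>x\<close>.\<close>

lemma smooth_with_gap_le:
  fixes h :: "'v::real_inner \<Rightarrow> real"
  assumes h: "smooth_with L h" and L: "L > 0" and bdd: "bdd_below (range h)"
  shows "h y - (INF x. h x) \<le> 2 * (h x - (INF x. h x)) + L * (norm (y - x))\<^sup>2"
proof -
  have "gradient h x \<bullet> (y - x) \<le> norm (gradient h x) * norm (y - x)"
    by (rule norm_cauchy_schwarz)
  also have "\<dots> \<le> (norm (gradient h x))\<^sup>2 / (2 * L) + L / 2 * (norm (y - x))\<^sup>2"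
  proof -
    have "0 \<le> (norm (gradient h x) - L * norm (y - x))\<^sup>2 / (2 * L)"
      using L by simp
    also have "\<dots> = (norm (gradient h x))\<^sup>2 / (2 * L) + L / 2 * (norm (y - x))\<^sup>2
        - norm (gradient h x) * norm (y - x)"
      using L by (simp add: field_simps power2_eq_square)
    finally show ?thesis by simp
  qed
  also have "(norm (gradient h x))\<^sup>2 / (2 * L) \<le> h x - (INF x. h x)"
    using smooth_with_norm_gradient_le[OF assms, of x] L by (simp add: field_simps)
  finally show ?thesis
    using smooth_with_upper_bound[OF h, of y x] by simp
qed

lemma GDERIV_mean_fun:
  assumes "\<And>i. i \<in> {1..n} \<Longrightarrow> GDERIV (f i) x :> d i"
  shows "GDERIV (mean_fun n f) x :> mean_vec n d"
proof -
  have "((\<lambda>x. (1 / real n) * (\<Sum>i=1..n. f i x)) has_derivative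
      (\<lambda>u. (1 / real n) * (\<Sum>i=1..n. u \<bullet> d i))) (at x)"
    using assms unfolding gderiv_def by (intro has_derivative_mult_right has_derivative_sum) auto
  then show ?thesis
    by (simp add: gderiv_def mean_fun_def[abs_def] mean_vec_def inner_sum_right)
qed

lemma norm_mean_vec_le: "norm (mean_vec n v) \<le> (1 / real n) * (\<Sum>i=1..n. norm (v i))"
  unfolding mean_vec_def norm_scaleR by (simp add: divide_right_mono norm_sum)

lemma mean_vec_diff: "mean_vec n u - mean_vec n v = mean_vec n (\<lambda>i. u i - v i)"
  by (simp add: mean_vec_def sum_subtractf scaleR_diff_right)

lemma
  assumes n: "n \<ge> 1" and f: "\<And>i. i \<in> {1..n} \<Longrightarrow> smooth_with L (f i)"
  shows gradient_mean_fun: "gradient (mean_fun n f) x = mean_vec n (\<lambda>i. gradient (f i) x)"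
    and smooth_with_mean_fun: "smooth_with L (mean_fun n f)"
proof -
  have D: "GDERIV (mean_fun n f) x :> mean_vec n (\<lambda>i. gradient (f i) x)" for x
    using f smooth_with_GDERIV by (intro GDERIV_mean_fun) blast
  then show G: "gradient (mean_fun n f) x = mean_vec n (\<lambda>i. gradient (f i) x)" for x
    by (rule gradient_eq)
  have "norm (gradient (mean_fun n f) x - gradient (mean_fun n f) y) \<le> L * norm (x - y)" for x y
  proof -
    have "norm (gradient (mean_fun n f) x - gradient (mean_fun n f) y)
        \<le> (1 / real n) * (\<Sum>i=1..n. norm (gradient (f i) x - gradient (f i) y))"
      unfolding G mean_vec_diff by (rule norm_mean_vec_le)
    also have "\<dots> \<le> (1 / real n) * (\<Sum>i=1..n. L * norm (x - y))"
      using f smooth_with_lipschitz by (intro mult_left_mono sum_mono) (blast, simp)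
    finally show ?thesis using n by simp
  qed
  moreover have "0 \<le> L"
    using f[of 1] n smooth_with_nonneg by auto
  ultimately show "smooth_with L (mean_fun n f)"
    using D G by (simp add: smooth_with_def lipschitz_on_def dist_norm)
qed

lemma mean_Inf_le_mean_fun:
  assumes "\<And>i. i \<in> {1..n} \<Longrightarrow> bdd_below (range (f i))"
  shows "(1 / real n) * (\<Sum>i=1..n. (INF x. f i x)) \<le> mean_fun n f x"
  unfolding mean_fun_def using assms
  by (intro mult_left_mono sum_mono cINF_lower) auto

lemma bdd_below_mean_fun:
  assumes "\<And>i. i \<in> {1..n} \<Longrightarrow> bdd_below (range (f i))"
  shows "bdd_below (range (mean_fun n f))"
  using mean_Inf_le_mean_fun[of n f] assms by (intro bdd_belowI2) blast

lemma sigma_star_nonneg: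
  assumes "\<And>i. i \<in> {1..n} \<Longrightarrow> bdd_below (range (f i))"
  shows "0 \<le> sigma_star n f"
  unfolding sigma_star_def using mean_Inf_le_mean_fun[of n f] assms
  by (simp add: cINF_greatest)

text \<open>The agents' minimisers differ from those of the mean, and \<open>sigma_star\<close> is exactly the price of
  measuring each \<open>f i\<close> against its own infimum.\<close>

lemma mean_gap_eq:
  "(1 / real n) * (\<Sum>i=1..n. f i x - (INF x. f i x))
     = (mean_fun n f x - (INF x. mean_fun n f x)) + sigma_star n f"
  by (simp add: mean_fun_def sigma_star_def sum_subtractf diff_divide_distrib)

section \<open>Square norms and averages over agents\<close>

lemma norm_add_square_le:
  fixes x y :: "'a::real_inner"
  shows "(norm (x + y))\<^sup>2 \<le> 2 * (norm x)\<^sup>2 + 2 * (norm y)\<^sup>2"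
proof -
  have "2 * (norm x)\<^sup>2 + 2 * (norm y)\<^sup>2 - (norm (x + y))\<^sup>2 = (norm (x - y))\<^sup>2"
    by (simp add: power2_norm_eq_inner algebra_simps inner_commute)
  then show ?thesis
    by (metis diff_ge_0_iff_ge zero_le_power2)
qed

lemma norm_sum_square_le:
  fixes x :: "'i \<Rightarrow> 'a::real_normed_vector"
  shows "(norm (\<Sum>j\<in>J. x j))\<^sup>2 \<le> real (card J) * (\<Sum>j\<in>J. (norm (x j))\<^sup>2)"
proof -
  have "(norm (\<Sum>j\<in>J. x j))\<^sup>2 \<le> (\<Sum>j\<in>J. 1 * norm (x j))\<^sup>2"
    by (intro power_mono) (simp_all add: norm_sum)
  also have "\<dots> \<le> (\<Sum>j\<in>J. 1\<^sup>2) * (\<Sum>j\<in>J. (norm (x j))\<^sup>2)"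
    by (rule Cauchy_Schwarz_ineq_sum)
  finally show ?thesis by simp
qed

lemma norm_add3_square_le:
  fixes x y z :: "'a::real_normed_vector"
  shows "(norm (x + y + z))\<^sup>2 \<le> 3 * ((norm x)\<^sup>2 + (norm y)\<^sup>2 + (norm z)\<^sup>2)"
  using norm_sum_square_le[of "\<lambda>i::nat. if i = 0 then x else if i = 1 then y else z" "{..<3}"]
  by (simp add: eval_nat_numeral add.assoc)

lemma norm_add_square_weighted_le:
  fixes x y :: "'a::real_inner"
  assumes "\<beta> > 0"
  shows "(norm (x + y))\<^sup>2 \<le> (1 + 1 / \<beta>) * (norm x)\<^sup>2 + (1 + \<beta>) * (norm y)\<^sup>2"
proof -
  have "0 \<le> \<beta> * (norm ((1 / \<beta>) *\<^sub>R x - y))\<^sup>2"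
    using assms by simp
  also have "\<dots> = (1 + 1 / \<beta>) * (norm x)\<^sup>2 + (1 + \<beta>) * (norm y)\<^sup>2 - (norm (x + y))\<^sup>2"
    using assms
    by (simp add: power2_norm_eq_inner inner_add_left inner_add_right inner_diff_left inner_diff_right
        inner_commute field_simps)
  finally show ?thesis by simp
qed

definition avg :: "nat \<Rightarrow> (nat \<Rightarrow> real) \<Rightarrow> real" where
  "avg n a = (1 / real n) * (\<Sum>i=1..n. a i)"

lemma avg_mono: "(\<And>i. i \<in> {1..n} \<Longrightarrow> a i \<le> b i) \<Longrightarrow> avg n a \<le> avg n b"
  unfolding avg_def by (intro mult_left_mono sum_mono) auto

lemma avg_nonneg: "(\<And>i. i \<in> {1..n} \<Longrightarrow> 0 \<le> a i) \<Longrightarrow> 0 \<le> avg n a"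
  unfolding avg_def by (intro mult_nonneg_nonneg sum_nonneg) auto

lemma avg_add: "avg n (\<lambda>i. a i + b i) = avg n a + avg n b"
  by (simp add: avg_def sum.distrib distrib_left)

lemma avg_cmult: "avg n (\<lambda>i. k * a i) = k * avg n a"
  by (simp add: avg_def sum_distrib_left mult_ac)

lemma avg_const: "n \<ge> 1 \<Longrightarrow> avg n (\<lambda>_. k) = k"
  by (simp add: avg_def)

lemma avg_sum: "avg n (\<lambda>i. \<Sum>j\<in>J. a i j) = (\<Sum>j\<in>J. avg n (\<lambda>i. a i j))"
  unfolding avg_def by (subst sum.swap) (simp add: sum_distrib_left)

lemma norm_mean_vec_square_le: "(norm (mean_vec n u))\<^sup>2 \<le> avg n (\<lambda>i. (norm (u i))\<^sup>2)"
proof -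
  have "(norm (mean_vec n u))\<^sup>2 = (norm (\<Sum>i=1..n. u i))\<^sup>2 / (real n)\<^sup>2"
    by (simp add: mean_vec_def power_divide)
  also have "\<dots> \<le> (real n * (\<Sum>i=1..n. (norm (u i))\<^sup>2)) / (real n)\<^sup>2"
    using norm_sum_square_le[of u "{1..n}"] by (intro divide_right_mono) auto
  also have "\<dots> = avg n (\<lambda>i. (norm (u i))\<^sup>2)"
    by (simp add: avg_def power2_eq_square)
  finally show ?thesis .
qed

text \<open>The deviations from the mean sum to zero, so the cross term vanishes.\<close>

lemma avg_norm_deviation_add:
  fixes u :: "nat \<Rightarrow> 'a::real_inner"
  assumes n: "n \<ge> 1"
  shows "avg n (\<lambda>i. (norm (u i - mean_vec n u + w))\<^sup>2)
    = avg n (\<lambda>i. (norm (u i - mean_vec n u))\<^sup>2) + (norm w)\<^sup>2"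
proof -
  have 0: "(\<Sum>i=1..n. u i - mean_vec n u) = 0"
    using n by (simp add: sum_subtractf mean_vec_def sum_constant_scaleR del: sum_constant)
  have "(norm (v + w))\<^sup>2 = (norm v)\<^sup>2 + 2 * (w \<bullet> v) + (norm w)\<^sup>2" for v
    by (simp add: power2_norm_eq_inner inner_add_left inner_add_right inner_commute)
  then have "avg n (\<lambda>i. (norm (u i - mean_vec n u + w))\<^sup>2)
    = avg n (\<lambda>i. (norm (u i - mean_vec n u))\<^sup>2) + 2 * avg n (\<lambda>i. w \<bullet> (u i - mean_vec n u)) + avg n (\<lambda>i. (norm w)\<^sup>2)"
    by (simp only: avg_add avg_cmult)
  also have "avg n (\<lambda>i. w \<bullet> (u i - mean_vec n u)) = 0"
    unfolding avg_def inner_sum_right[symmetric] 0 by simp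
  finally show ?thesis using n by (simp add: avg_const)
qed

lemma avg_norm_deviation_le:
  fixes u :: "nat \<Rightarrow> 'a::real_inner"
  assumes n: "n \<ge> 1"
  shows "avg n (\<lambda>i. (norm (u i - mean_vec n u))\<^sup>2) \<le> avg n (\<lambda>i. (norm (u i))\<^sup>2)"
  using avg_norm_deviation_add[OF n, of u "mean_vec n u"] by simp

section \<open>Square-integrable random vectors\<close>

text \<open>Measurability is included because integrability of the squared norm does not give it back.\<close>

definition square_integrable :: "'w measure \<Rightarrow> ('w \<Rightarrow> 'v::euclidean_space) \<Rightarrow> bool" where
  "square_integrable M X \<longleftrightarrow> X \<in> borel_measurable M \<and> integrable M (\<lambda>\<omega>. (norm (X \<omega>))\<^sup>2)"

lemma square_integrable_measurable [measurable_dest]: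
  "square_integrable M X \<Longrightarrow> X \<in> borel_measurable M"
  by (simp add: square_integrable_def)

lemma square_integrable_integrable_norm:
  "square_integrable M X \<Longrightarrow> integrable M (\<lambda>\<omega>. (norm (X \<omega>))\<^sup>2)"
  by (simp add: square_integrable_def)

lemma square_integrable_bound:
  assumes "X \<in> borel_measurable M" and "integrable M h" and "\<And>\<omega>. (norm (X \<omega>))\<^sup>2 \<le> h \<omega>"
  shows "square_integrable M X"
  unfolding square_integrable_def
proof
  note [measurable] = assms(1)
  show "integrable M (\<lambda>\<omega>. (norm (X \<omega>))\<^sup>2)"
    by (rule Bochner_Integration.integrable_bound[OF assms(2)])
       (use assms(3) in \<open>auto intro: order_trans[OF _ abs_ge_self]\<close>)
qed (rule assms(1))

lemma square_integrable_scaleR [intro]: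
  "square_integrable M X \<Longrightarrow> square_integrable M (\<lambda>\<omega>. c *\<^sub>R X \<omega>)"
  by (auto simp: square_integrable_def power_mult_distrib)

lemma square_integrable_add [intro]:
  assumes "square_integrable M X" "square_integrable M Y"
  shows "square_integrable M (\<lambda>\<omega>. X \<omega> + Y \<omega>)"
proof (rule square_integrable_bound)
  show "integrable M (\<lambda>\<omega>. 2 * (norm (X \<omega>))\<^sup>2 + 2 * (norm (Y \<omega>))\<^sup>2)"
    using assms by (simp add: square_integrable_def)
qed (use assms norm_add_square_le in \<open>auto simp: square_integrable_def\<close>)

lemma square_integrable_diff [intro]:
  assumes "square_integrable M X" "square_integrable M Y"
  shows "square_integrable M (\<lambda>\<omega>. X \<omega> - Y \<omega>)"
  using square_integrable_add[OF assms(1) square_integrable_scaleR[OF assms(2), of "-1"]] by simp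

lemma square_integrable_0 [intro, simp]: "square_integrable M (\<lambda>_. 0)"
  by (simp add: square_integrable_def)

lemma square_integrable_sum [intro]:
  "(\<And>i. i \<in> I \<Longrightarrow> square_integrable M (X i)) \<Longrightarrow> square_integrable M (\<lambda>\<omega>. \<Sum>i\<in>I. X i \<omega>)"
  by (induction I rule: infinite_finite_induct) auto

lemma square_integrable_mean_vec [intro]:
  "(\<And>i. i \<in> {1..n} \<Longrightarrow> square_integrable M (X i)) \<Longrightarrow> square_integrable M (\<lambda>\<omega>. mean_vec n (\<lambda>i. X i \<omega>))"
  unfolding mean_vec_def by (rule square_integrable_scaleR, rule square_integrable_sum)

lemma (in finite_measure) square_integrable_const [intro, simp]: "square_integrable M (\<lambda>_. c)"
  by (simp add: square_integrable_def)

lemma (in finite_measure) square_integrable_lipschitz: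
  fixes G :: "'v::euclidean_space \<Rightarrow> 'u::euclidean_space"
  assumes X: "square_integrable M X" and G: "\<And>x y. norm (G x - G y) \<le> L * norm (x - y)"
    and cont: "continuous_on UNIV G"
  shows "square_integrable M (\<lambda>\<omega>. G (X \<omega>))"
proof (rule square_integrable_bound)
  show "(\<lambda>\<omega>. G (X \<omega>)) \<in> borel_measurable M"
    using X cont by (auto simp: square_integrable_def intro: borel_measurable_continuous_on)
  show "integrable M (\<lambda>\<omega>. 2 * (L\<^sup>2 * (norm (X \<omega> - 0))\<^sup>2) + 2 * (norm (G 0))\<^sup>2)"
    using X by (simp add: square_integrable_def)
  show "(norm (G (X \<omega>)))\<^sup>2 \<le> 2 * (L\<^sup>2 * (norm (X \<omega> - 0))\<^sup>2) + 2 * (norm (G 0))\<^sup>2" for \<omega>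
  proof -
    have "(norm (G (X \<omega>)))\<^sup>2 \<le> 2 * (norm (G (X \<omega>) - G 0))\<^sup>2 + 2 * (norm (G 0))\<^sup>2"
      using norm_add_square_le[of "G (X \<omega>) - G 0" "G 0"] by simp
    also have "(norm (G (X \<omega>) - G 0))\<^sup>2 \<le> (L * norm (X \<omega> - 0))\<^sup>2"
      by (intro power_mono G) simp
    finally show ?thesis by (simp add: power_mult_distrib)
  qed
qed

lemma square_integrable_inner_integrable [intro]:
  assumes "square_integrable M X" "square_integrable M Y"
  shows "integrable M (\<lambda>\<omega>. X \<omega> \<bullet> Y \<omega>)"
proof (rule Bochner_Integration.integrable_bound)
  show "integrable M (\<lambda>\<omega>. (norm (X \<omega>))\<^sup>2 + (norm (Y \<omega>))\<^sup>2)"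
    using assms by (simp add: square_integrable_def)
  show "(\<lambda>\<omega>. X \<omega> \<bullet> Y \<omega>) \<in> borel_measurable M"
    using assms by (auto simp: square_integrable_def)
  have "\<bar>x \<bullet> y\<bar> \<le> (norm x)\<^sup>2 + (norm y)\<^sup>2" for x y :: 'b
  proof -
    have "\<bar>x \<bullet> y\<bar> \<le> norm x * norm y" by (rule Cauchy_Schwarz_ineq2)
    also have "\<dots> \<le> (norm x)\<^sup>2 + (norm y)\<^sup>2"
      using sum_squares_bound[of "norm x" "norm y"] mult_nonneg_nonneg[OF norm_ge_zero[of x] norm_ge_zero[of y]]
      by linarith
    finally show ?thesis .
  qed
  then show "AE \<omega> in M. norm (X \<omega> \<bullet> Y \<omega>) \<le> norm ((norm (X \<omega>))\<^sup>2 + (norm (Y \<omega>))\<^sup>2)"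
    by simp
qed

lemma borel_measurable_nth:
  fixes X :: "'w \<Rightarrow> real ^ 'p::finite"
  assumes "X \<in> borel_measurable F"
  shows "(\<lambda>\<omega>. X \<omega> $ k) \<in> borel_measurable F"
  by (rule borel_measurable_continuous_on[where f = "\<lambda>x::real ^ 'p. x $ k"])
    (use assms in \<open>auto intro!: continuous_intros\<close>)

lemma square_integrable_nth:
  fixes X :: "'w \<Rightarrow> real ^ 'p::finite"
  assumes "square_integrable M X"
  shows "square_integrable M (\<lambda>\<omega>. X \<omega> $ k)"
proof (rule square_integrable_bound)
  show "(\<lambda>\<omega>. X \<omega> $ k) \<in> borel_measurable M"
    using assms by (auto simp: square_integrable_def intro: borel_measurable_nth)
  show "(norm (X \<omega> $ k))\<^sup>2 \<le> (norm (X \<omega>))\<^sup>2" for \<omega>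
    using component_le_norm_cart[of "X \<omega>" k] by (intro power_mono) auto
qed (use assms in \<open>simp add: square_integrable_def\<close>)

lemma square_integrable_mult:
  fixes u v :: "'w \<Rightarrow> real"
  assumes "square_integrable M u" "square_integrable M v"
  shows "integrable M (\<lambda>\<omega>. u \<omega> * v \<omega>)"
  using square_integrable_inner_integrable[OF assms] by simp

lemma (in finite_measure) square_integrable_integrable_real:
  fixes u :: "'a \<Rightarrow> real"
  assumes "square_integrable M u"
  shows "integrable M u"
  using square_integrable_mult[OF assms square_integrable_const[of 1]] by simp

lemma integral_norm_add_square_orthogonal:
  assumes X: "square_integrable M X" and Y: "square_integrable M Y"
  shows "(\<integral>\<omega>. (norm (X \<omega> + Y \<omega>))\<^sup>2 \<partial>M)
    = (\<integral>\<omega>. (norm (X \<omega>))\<^sup>2 \<partial>M) + 2 * (\<integral>\<omega>. X \<omega> \<bullet> Y \<omega> \<partial>M) + (\<integral>\<omega>. (norm (Y \<omega>))\<^sup>2 \<partial>M)"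
proof -
  have "(\<lambda>\<omega>. (norm (X \<omega> + Y \<omega>))\<^sup>2) = (\<lambda>\<omega>. (norm (X \<omega>))\<^sup>2 + 2 * (X \<omega> \<bullet> Y \<omega>) + (norm (Y \<omega>))\<^sup>2)"
    by (auto simp: power2_norm_eq_inner inner_add_left inner_add_right inner_commute)
  then show ?thesis
    using assms by (simp add: square_integrable_integrable_norm square_integrable_inner_integrable)
qed

lemma integral_avg:
  assumes "\<And>i. i \<in> {1..n} \<Longrightarrow> integrable M (a i)"
  shows "(\<integral>\<omega>. avg n (\<lambda>i. a i \<omega>) \<partial>M) = avg n (\<lambda>i. \<integral>\<omega>. a i \<omega> \<partial>M)"
  unfolding avg_def using assms by (simp add: Bochner_Integration.integral_sum)

lemma integrable_avg:
  assumes "\<And>i. i \<in> {1..n} \<Longrightarrow> integrable M (a i)"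
  shows "integrable M (\<lambda>\<omega>. avg n (\<lambda>i. a i \<omega>))"
  unfolding avg_def by (intro Bochner_Integration.integrable_mult_right Bochner_Integration.integrable_sum assms)

lemma integral_norm_square_sum_orthogonal:
  assumes J: "finite J" and U: "\<And>j. j \<in> J \<Longrightarrow> square_integrable M (U j)"
    and orth: "\<And>j k. j \<in> J \<Longrightarrow> k \<in> J \<Longrightarrow> j \<noteq> k \<Longrightarrow> (\<integral>\<omega>. U j \<omega> \<bullet> U k \<omega> \<partial>M) = 0"
  shows "(\<integral>\<omega>. (norm (\<Sum>j\<in>J. U j \<omega>))\<^sup>2 \<partial>M) = (\<Sum>j\<in>J. \<integral>\<omega>. (norm (U j \<omega>))\<^sup>2 \<partial>M)"
  using assms
proof (induction J)
  case (insert k J)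
  have "(\<integral>\<omega>. U k \<omega> \<bullet> (\<Sum>j\<in>J. U j \<omega>) \<partial>M) = (\<Sum>j\<in>J. \<integral>\<omega>. U k \<omega> \<bullet> U j \<omega> \<partial>M)"
    unfolding inner_sum_right using insert.prems
    by (intro Bochner_Integration.integral_sum square_integrable_inner_integrable) auto
  also have "\<dots> = 0"
    using insert.prems insert.hyps by (intro sum.neutral) auto
  finally have "(\<integral>\<omega>. (norm (U k \<omega> + (\<Sum>j\<in>J. U j \<omega>)))\<^sup>2 \<partial>M)
      = (\<integral>\<omega>. (norm (U k \<omega>))\<^sup>2 \<partial>M) + (\<integral>\<omega>. (norm (\<Sum>j\<in>J. U j \<omega>))\<^sup>2 \<partial>M)"
    using insert.prems by (subst integral_norm_add_square_orthogonal) auto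
  then show ?case
    using insert by simp
qed simp

lemma integral_inner_le:
  assumes "square_integrable M U" "square_integrable M V"
  shows "2 * (\<integral>\<omega>. U \<omega> \<bullet> V \<omega> \<partial>M) \<le> (\<integral>\<omega>. (norm (U \<omega>))\<^sup>2 \<partial>M) + (\<integral>\<omega>. (norm (V \<omega>))\<^sup>2 \<partial>M)"
proof -
  have "0 \<le> (\<integral>\<omega>. (norm (U \<omega> + (-1) *\<^sub>R V \<omega>))\<^sup>2 \<partial>M)"
    by simp
  also have "\<dots> = (\<integral>\<omega>. (norm (U \<omega>))\<^sup>2 \<partial>M) + 2 * (\<integral>\<omega>. U \<omega> \<bullet> ((-1) *\<^sub>R V \<omega>) \<partial>M)
      + (\<integral>\<omega>. (norm ((-1) *\<^sub>R V \<omega>))\<^sup>2 \<partial>M)"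
    by (rule integral_norm_add_square_orthogonal[OF assms(1) square_integrable_scaleR[OF assms(2)]])
  finally show ?thesis by simp
qed

section \<open>Orthogonality from conditional expectations\<close>

lemma sigma_finite_subalgebra_prob:
  assumes "prob_space M" and "subalgebra M F"
  shows "sigma_finite_subalgebra M F"
proof -
  interpret prob_space M by fact
  have "finite_measure_subalgebra M F"
    by standard fact
  then show ?thesis
    by (rule finite_measure_subalgebra_is_sigma_finite)
qed

lemma expectation_mult_cond_exp:
  fixes u v m :: "'w \<Rightarrow> real"
  assumes P: "prob_space M" and F: "subalgebra M F"
    and w: "w \<in> borel_measurable F" "square_integrable M w" and s: "square_integrable M s"
    and m: "m \<in> borel_measurable M" "AE \<omega> in M. real_cond_exp M F s \<omega> = m \<omega>"
  shows "(\<integral>\<omega>. w \<omega> * s \<omega> \<partial>M) = (\<integral>\<omega>. w \<omega> * m \<omega> \<partial>M)"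
proof -
  interpret sigma_finite_subalgebra M F
    using P F by (rule sigma_finite_subalgebra_prob)
  have [measurable]: "w \<in> borel_measurable M" "s \<in> borel_measurable M" "m \<in> borel_measurable M"
    using w s m by (auto simp: square_integrable_def)
  have "(\<integral>\<omega>. w \<omega> * s \<omega> \<partial>M) = (\<integral>\<omega>. w \<omega> * real_cond_exp M F s \<omega> \<partial>M)"
    using square_integrable_mult[OF w(2) s] w(1) by (intro real_cond_exp_intg(2)[symmetric]) auto
  also have "\<dots> = (\<integral>\<omega>. w \<omega> * m \<omega> \<partial>M)"
    using m by (intro integral_cong_AE) auto
  finally show ?thesis .
qed

lemma inner_integral_eq_sum:
  fixes X Y :: "'w \<Rightarrow> real ^ 'p::finite"
  assumes "square_integrable M X" "square_integrable M Y"
  shows "(\<integral>\<omega>. X \<omega> \<bullet> Y \<omega> \<partial>M) = (\<Sum>k\<in>UNIV. \<integral>\<omega>. X \<omega> $ k * Y \<omega> $ k \<partial>M)"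
  using assms unfolding inner_vec_def
  by (simp add: Bochner_Integration.integral_sum square_integrable_mult square_integrable_nth)

text \<open>A sample minus its conditional mean is orthogonal to everything known at the time of sampling.\<close>

lemma expectation_inner_noise:
  fixes W S m :: "'w \<Rightarrow> real ^ 'p::finite"
  assumes P: "prob_space M" and F: "subalgebra M F"
    and W: "W \<in> borel_measurable F" "square_integrable M W"
    and S: "square_integrable M S" and m: "square_integrable M m"
    and mean: "AE \<omega> in M. vec_cond_exp M F S \<omega> = m \<omega>"
  shows "(\<integral>\<omega>. W \<omega> \<bullet> (S \<omega> - m \<omega>) \<partial>M) = 0"
proof -
  have "(\<integral>\<omega>. W \<omega> $ k * (S \<omega> - m \<omega>) $ k \<partial>M) = 0" for k
  proof -
    have "(\<lambda>\<omega>. W \<omega> $ k) \<in> borel_measurable F"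
      using W(1) by (rule borel_measurable_nth)
    moreover have "AE \<omega> in M. real_cond_exp M F (\<lambda>\<omega>. S \<omega> $ k) \<omega> = m \<omega> $ k"
      using mean by eventually_elim (auto simp: vec_cond_exp_def vec_eq_iff)
    ultimately have "(\<integral>\<omega>. W \<omega> $ k * S \<omega> $ k \<partial>M) = (\<integral>\<omega>. W \<omega> $ k * m \<omega> $ k \<partial>M)"
      by (intro expectation_mult_cond_exp[OF P F] square_integrable_nth W S
            square_integrable_measurable[OF square_integrable_nth[OF m]])
    then show ?thesis
      using W S m by (simp add: right_diff_distrib square_integrable_mult square_integrable_nth)
  qed
  then show ?thesis
    using W S m by (simp add: inner_integral_eq_sum square_integrable_diff)
qed

text \<open>As functions of \<open>A\<close> both sides of the hypothesis are measures, and the conclusion compares the integrals of \<open>\<phi>\<close>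
  against them.\<close>

lemma nn_integral_weight_eqI:
  fixes Y :: "'w \<Rightarrow> 'b::topological_space" and \<phi> :: "'b \<Rightarrow> ennreal"
  assumes [measurable]: "Y \<in> borel_measurable M" "U \<in> borel_measurable M" "V \<in> borel_measurable M"
    and \<phi>: "\<phi> \<in> borel_measurable borel"
    and eq: "\<And>A. A \<in> sets borel \<Longrightarrow>
      (\<integral>\<^sup>+ \<omega>. indicator A (Y \<omega>) * U \<omega> \<partial>M) = (\<integral>\<^sup>+ \<omega>. indicator A (Y \<omega>) * V \<omega> \<partial>M)"
  shows "(\<integral>\<^sup>+ \<omega>. \<phi> (Y \<omega>) * U \<omega> \<partial>M) = (\<integral>\<^sup>+ \<omega>. \<phi> (Y \<omega>) * V \<omega> \<partial>M)"
  using \<phi>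
proof (induction rule: borel_measurable_induct)
  case (cong f g)
  then have "f = g" by (auto simp: fun_eq_iff)
  with cong show ?case by simp
next
  case (set A)
  then show ?case by (rule eq)
next
  case (mult u c)
  note [measurable] = mult(2)
  show ?case
    using mult by (simp add: mult.assoc nn_integral_cmult)
next
  case (add u v)
  note [measurable] = add(1,4)
  show ?case
    using add by (simp add: distrib_right nn_integral_add)
next
  case (seq W)
  note [measurable] = seq.hyps(1)
  have mono: "incseq (\<lambda>i \<omega>. W i (Y \<omega>) * Z \<omega>)" for Z :: "'w \<Rightarrow> ennreal"
    using \<open>incseq W\<close> by (auto simp: incseq_def le_fun_def intro!: mult_right_mono)
  have "(\<integral>\<^sup>+ \<omega>. (SUP i. W i) (Y \<omega>) * Z \<omega> \<partial>M) = (SUP i. \<integral>\<^sup>+ \<omega>. W i (Y \<omega>) * Z \<omega> \<partial>M)"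
    if [measurable]: "Z \<in> borel_measurable M" for Z
    using mono
    by (simp add: SUP_apply SUP_mult_right_ennreal nn_integral_monotone_convergence_SUP image_comp)
  then show ?case
    using seq.IH \<open>U \<in> borel_measurable M\<close> \<open>V \<in> borel_measurable M\<close> by presburger
qed

text \<open>Converts between the two conditional expectations: \<open>cond_indep_vars\<close> speaks of the real one, while the
  monotone class argument below needs the nonnegative one.\<close>

lemma nn_cond_exp_indicator:
  assumes P: "prob_space M" and F: "subalgebra M F" and B: "{\<omega>\<in>space M. b \<omega>} \<in> sets M"
  shows "AE \<omega> in M. nn_cond_exp M F (\<lambda>\<omega>. indicator {\<omega>. b \<omega>} \<omega>) \<omega>
      = ennreal (real_cond_exp M F (\<lambda>\<omega>. indicator {\<omega>. b \<omega>} \<omega>) \<omega>)"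
proof -
  interpret prob_space M by fact
  interpret sigma_finite_subalgebra M F
    using P F by (rule sigma_finite_subalgebra_prob)
  have meas [measurable]: "(\<lambda>\<omega>. indicator {\<omega>. b \<omega>} \<omega> :: ennreal) \<in> borel_measurable M"
    using B by (subst borel_measurable_indicator_iff) (simp add: Int_def conj_commute)
  let ?h = "nn_cond_exp M F (\<lambda>\<omega>. indicator {\<omega>. b \<omega>} \<omega>)"
  have "(\<integral>\<^sup>+ \<omega>. ?h \<omega> \<partial>M) = (\<integral>\<^sup>+ \<omega>. indicator {\<omega>. b \<omega>} \<omega> \<partial>M)"
    using nn_cond_exp_intg[of "\<lambda>_. 1", OF _ meas] by simp
  also have "\<dots> \<le> (\<integral>\<^sup>+ \<omega>. 1 \<partial>M)"
    by (intro nn_integral_mono) (auto simp: indicator_def)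
  finally have "(\<integral>\<^sup>+ \<omega>. ?h \<omega> \<partial>M) \<noteq> \<infinity>"
    by (auto simp: emeasure_space_1 top_unique)
  then have 1: "AE \<omega> in M. ?h \<omega> \<noteq> \<infinity>"
    by (intro nn_integral_PInf_AE) auto
  have 2: "AE \<omega> in M. nn_cond_exp M F (\<lambda>_. 0) \<omega> = 0"
    using nn_cond_exp_F_meas[of "\<lambda>_. 0"] by auto
  have 3: "(\<lambda>\<omega>. ennreal (indicator {\<omega>. b \<omega>} \<omega>)) = indicator {\<omega>. b \<omega>}"
    by (auto simp: indicator_def)
  have 4: "(\<lambda>\<omega>. ennreal (- indicator {\<omega>. b \<omega>} \<omega>)) = (\<lambda>_. 0)"
    by (auto simp: indicator_def ennreal_neg)
  from 1 2 show ?thesis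
    unfolding real_cond_exp_def 3 4 by eventually_elim (simp add: less_top)
qed

text \<open>The definition of conditional independence is the case of two indicators. The extension is made in one
  variable at a time, with the conditional expectation moved onto the other factor in between, so that only integrals,
  never conditional expectations, have to be taken through limits.\<close>

lemma cond_indep_nn_integral:
  fixes Y :: "'i \<Rightarrow> 'w \<Rightarrow> 'b::topological_space" and \<phi> \<psi> :: "'b \<Rightarrow> ennreal"
  assumes P: "prob_space M" and F: "subalgebra M F"
    and indep: "cond_indep_vars M F Y I" and I: "finite I" "i \<in> I" "j \<in> I" "i \<noteq> j"
    and Y [measurable]: "Y i \<in> borel_measurable M" "Y j \<in> borel_measurable M"
    and \<phi>: "\<phi> \<in> borel_measurable borel" and \<psi>: "\<psi> \<in> borel_measurable borel"
  shows "(\<integral>\<^sup>+ \<omega>. \<phi> (Y i \<omega>) * \<psi> (Y j \<omega>) \<partial>M)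
    = (\<integral>\<^sup>+ \<omega>. nn_cond_exp M F (\<lambda>\<omega>. \<phi> (Y i \<omega>)) \<omega> * \<psi> (Y j \<omega>) \<partial>M)"
proof -
  interpret prob_space M by fact
  interpret sigma_finite_subalgebra M F
    using P F by (rule sigma_finite_subalgebra_prob)
  have [measurable]: "(\<lambda>\<omega>. \<phi> (Y i \<omega>)) \<in> borel_measurable M"
    using \<phi> by measurable
  let ?e = "\<lambda>B. nn_cond_exp M F (\<lambda>\<omega>. indicator B (Y j \<omega>))"
  have base: "(\<integral>\<^sup>+ \<omega>. indicator A (Y i \<omega>) * indicator B (Y j \<omega>) \<partial>M)
      = (\<integral>\<^sup>+ \<omega>. indicator A (Y i \<omega>) * ?e B \<omega> \<partial>M)"
    if A [measurable]: "A \<in> sets borel" and B [measurable]: "B \<in> sets borel" for A B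
  proof -
    define r where "r A k = real_cond_exp M F (\<lambda>\<omega>. indicator A (Y k \<omega>))" for A k
    have [measurable]: "r A k \<in> borel_measurable F" "r A k \<in> borel_measurable M" for A k
      by (auto simp: r_def)
    have int: "integrable M (\<lambda>\<omega>. indicator A (Y i \<omega>) :: real)"
      "integrable M (\<lambda>\<omega>. indicator B (Y j \<omega>) :: real)"
      "integrable M (\<lambda>\<omega>. indicator A (Y i \<omega>) * indicator B (Y j \<omega>) :: real)"
      by (intro integrable_const_bound[where B = 1]; auto simp: indicator_def)+
    \<comment> \<open>the definition of conditional independence speaks of events for all indices in \<open>I\<close>; the trivial ones drop out\<close>
    define E where "E k = (if k = i then A else if k = j then B else UNIV)" for k
    have prod2: "(\<Prod>k\<in>I. q k) = q i * q j" if "\<And>k. k \<noteq> i \<Longrightarrow> k \<noteq> j \<Longrightarrow> q k = 1" for q :: "'i \<Rightarrow> real"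
    proof -
      have "(\<Prod>k\<in>I. q k) = (\<Prod>k\<in>{i, j}. q k)"
        using I that by (intro prod.mono_neutral_right) auto
      then show ?thesis using I by simp
    qed
    have one: "AE \<omega> in M. \<forall>k\<in>I. k \<noteq> i \<longrightarrow> k \<noteq> j \<longrightarrow> r (E k) k \<omega> = 1"
      using I by (intro AE_finite_allI) (auto simp: E_def r_def intro!: real_cond_exp_F_meas)
    have factors: "AE \<omega> in M. real_cond_exp M F (\<lambda>\<omega>. \<Prod>k\<in>I. indicator (E k) (Y k \<omega>)) \<omega>
        = (\<Prod>k\<in>I. r (E k) k \<omega>)"
      using indep by (auto simp: cond_indep_vars_def E_def r_def)
    have prod_E: "(\<lambda>\<omega>. \<Prod>k\<in>I. indicator (E k) (Y k \<omega>) :: real)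
        = (\<lambda>\<omega>. indicator A (Y i \<omega>) * indicator B (Y j \<omega>))"
      using I by (subst prod2) (auto simp: E_def)
    have fact: "AE \<omega> in M. real_cond_exp M F (\<lambda>\<omega>. indicator A (Y i \<omega>) * indicator B (Y j \<omega>)) \<omega>
        = r A i \<omega> * r B j \<omega>"
      using factors[unfolded prod_E] one
    proof eventually_elim
      case (elim \<omega>)
      have "(\<Prod>k\<in>I. r (E k) k \<omega>) = (\<Prod>k\<in>{i, j}. r (E k) k \<omega>)"
        using I elim(2) by (intro prod.mono_neutral_right) auto
      then show ?case using I elim(1) by (simp add: E_def)
    qed
    have rB: "AE \<omega> in M. 0 \<le> r B j \<omega>" "AE \<omega> in M. r B j \<omega> \<le> 1"
      using int by (auto intro!: real_cond_exp_pos real_cond_exp_le_c simp: r_def indicator_def)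
    have intB: "integrable M (\<lambda>\<omega>. r B j \<omega> * indicator A (Y i \<omega>))"
      using rB by (intro integrable_const_bound[where B = 1]) (auto simp: indicator_def elim: eventually_elim2)
    have "(\<integral>\<omega>. indicator A (Y i \<omega>) * indicator B (Y j \<omega>) \<partial>M) = (\<integral>\<omega>. r A i \<omega> * r B j \<omega> \<partial>M)"
      using fact by (subst real_cond_exp_int(2)[OF int(3), symmetric]) (intro integral_cong_AE, auto)
    also have "\<dots> = (\<integral>\<omega>. r B j \<omega> * indicator A (Y i \<omega>) \<partial>M)"
      using real_cond_exp_intg(2)[OF intB] by (simp add: r_def mult.commute)
    finally have real_eq: "(\<integral>\<omega>. indicator A (Y i \<omega>) * indicator B (Y j \<omega>) \<partial>M)
      = (\<integral>\<omega>. r B j \<omega> * indicator A (Y i \<omega>) \<partial>M)" .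
    have "(\<integral>\<^sup>+ \<omega>. indicator A (Y i \<omega>) * indicator B (Y j \<omega>) \<partial>M)
        = (\<integral>\<^sup>+ \<omega>. ennreal (indicator A (Y i \<omega>) * indicator B (Y j \<omega>)) \<partial>M)"
      by (intro nn_integral_cong) (auto simp: indicator_def)
    also have "\<dots> = ennreal (\<integral>\<omega>. indicator A (Y i \<omega>) * indicator B (Y j \<omega>) \<partial>M)"
      using int by (intro nn_integral_eq_integral) (auto simp: indicator_def)
    also have "\<dots> = (\<integral>\<^sup>+ \<omega>. ennreal (r B j \<omega> * indicator A (Y i \<omega>)) \<partial>M)"
      unfolding real_eq using intB rB
      by (intro nn_integral_eq_integral[symmetric]) (auto simp: indicator_def)
    also have "\<dots> = (\<integral>\<^sup>+ \<omega>. indicator A (Y i \<omega>) * ?e B \<omega> \<partial>M)"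
    proof (intro nn_integral_cong_AE)
      have eq: "indicator B (Y j \<omega>) = indicator {\<omega>. Y j \<omega> \<in> B} \<omega>" for \<omega>
        by (simp add: indicator_def)
      show "AE \<omega> in M. ennreal (r B j \<omega> * indicator A (Y i \<omega>)) = indicator A (Y i \<omega>) * ?e B \<omega>"
        using nn_cond_exp_indicator[OF P F, of "\<lambda>\<omega>. Y j \<omega> \<in> B"]
        unfolding eq r_def by (auto simp: indicator_def elim!: eventually_mono)
    qed
    finally show ?thesis .
  qed
  have step1: "(\<integral>\<^sup>+ \<omega>. \<phi> (Y i \<omega>) * indicator B (Y j \<omega>) \<partial>M) = (\<integral>\<^sup>+ \<omega>. \<phi> (Y i \<omega>) * ?e B \<omega> \<partial>M)"
    if [measurable]: "B \<in> sets borel" for B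
    by (rule nn_integral_weight_eqI[OF _ _ _ \<phi>]) (auto intro!: base that)
  have "(\<integral>\<^sup>+ \<omega>. \<psi> (Y j \<omega>) * \<phi> (Y i \<omega>) \<partial>M)
      = (\<integral>\<^sup>+ \<omega>. \<psi> (Y j \<omega>) * nn_cond_exp M F (\<lambda>\<omega>. \<phi> (Y i \<omega>)) \<omega> \<partial>M)"
  proof (rule nn_integral_weight_eqI[OF _ _ _ \<psi>])
    fix B :: "'b set" assume [measurable]: "B \<in> sets borel"
    have "(\<integral>\<^sup>+ \<omega>. indicator B (Y j \<omega>) * \<phi> (Y i \<omega>) \<partial>M) = (\<integral>\<^sup>+ \<omega>. ?e B \<omega> * \<phi> (Y i \<omega>) \<partial>M)"
      using step1[of B] by (simp add: mult.commute)
    also have "\<dots> = (\<integral>\<^sup>+ \<omega>. nn_cond_exp M F (\<lambda>\<omega>. \<phi> (Y i \<omega>)) \<omega> * ?e B \<omega> \<partial>M)"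
      using nn_cond_exp_intg[of "?e B" "\<lambda>\<omega>. \<phi> (Y i \<omega>)"] by (simp add: mult.commute)
    also have "\<dots> = (\<integral>\<^sup>+ \<omega>. nn_cond_exp M F (\<lambda>\<omega>. \<phi> (Y i \<omega>)) \<omega> * indicator B (Y j \<omega>) \<partial>M)"
      by (intro nn_cond_exp_intg) auto
    finally show "(\<integral>\<^sup>+ \<omega>. indicator B (Y j \<omega>) * \<phi> (Y i \<omega>) \<partial>M)
        = (\<integral>\<^sup>+ \<omega>. indicator B (Y j \<omega>) * nn_cond_exp M F (\<lambda>\<omega>. \<phi> (Y i \<omega>)) \<omega> \<partial>M)"
      by (simp add: mult.commute)
  qed auto
  then show ?thesis by (simp add: mult.commute)
qed


text \<open>Follows from the nonnegative case applied to the four products of positive and negative parts.\<close>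

lemma cond_indep_expectation_mult:
  fixes Y :: "'i \<Rightarrow> 'w \<Rightarrow> 'b::topological_space" and u v :: "'b \<Rightarrow> real"
  assumes P: "prob_space M" and F: "subalgebra M F"
    and indep: "cond_indep_vars M F Y I" and I: "finite I" "i \<in> I" "j \<in> I" "i \<noteq> j"
    and Y [measurable]: "Y i \<in> borel_measurable M" "Y j \<in> borel_measurable M"
    and u [measurable]: "u \<in> borel_measurable borel" "v \<in> borel_measurable borel"
    and sq: "square_integrable M (\<lambda>\<omega>. u (Y i \<omega>))" "square_integrable M (\<lambda>\<omega>. v (Y j \<omega>))"
  shows "(\<integral>\<omega>. u (Y i \<omega>) * v (Y j \<omega>) \<partial>M)
    = (\<integral>\<omega>. real_cond_exp M F (\<lambda>\<omega>. u (Y i \<omega>)) \<omega> * v (Y j \<omega>) \<partial>M)"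
proof -
  interpret prob_space M by fact
  interpret sigma_finite_subalgebra M F
    using P F by (rule sigma_finite_subalgebra_prob)
  define c where "c a \<omega> = nn_cond_exp M F (\<lambda>\<omega>. ennreal (a * u (Y i \<omega>))) \<omega>" for a \<omega>
  have [measurable]: "c a \<in> borel_measurable M" for a
    by (simp add: c_def[abs_def])
  have int: "integrable M (\<lambda>\<omega>. max 0 (a * u (Y i \<omega>)) * max 0 (b * v (Y j \<omega>)))" for a b
  proof (rule Bochner_Integration.integrable_bound)
    show "integrable M (\<lambda>\<omega>. (a * b) * (u (Y i \<omega>) * v (Y j \<omega>)))"
      using square_integrable_mult[OF sq] by simp
    show "AE \<omega> in M. norm (max 0 (a * u (Y i \<omega>)) * max 0 (b * v (Y j \<omega>)))
        \<le> norm ((a * b) * (u (Y i \<omega>) * v (Y j \<omega>)))"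
    proof (rule AE_I2)
      have "norm (max 0 x * max 0 y) \<le> norm (x * y)" for x y :: real
        unfolding norm_mult by (intro mult_mono) auto
      then show "norm (max 0 (a * u (Y i \<omega>)) * max 0 (b * v (Y j \<omega>)))
          \<le> norm ((a * b) * (u (Y i \<omega>) * v (Y j \<omega>)))" for \<omega>
        by (metis mult.assoc mult.left_commute)
    qed
  qed measurable
  have c_fin: "AE \<omega> in M. c a \<omega> < \<top>" for a
  proof -
    have "(\<integral>\<^sup>+ \<omega>. c a \<omega> \<partial>M) = (\<integral>\<^sup>+ \<omega>. ennreal (a * u (Y i \<omega>)) \<partial>M)"
      using nn_cond_exp_intg[of "\<lambda>_. 1" "\<lambda>\<omega>. ennreal (a * u (Y i \<omega>))"] by (simp add: c_def)
    also have "\<dots> \<le> (\<integral>\<^sup>+ \<omega>. ennreal (norm (a * u (Y i \<omega>))) \<partial>M)"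
      by (intro nn_integral_mono ennreal_leI) simp
    also have "\<dots> < \<infinity>"
    proof -
      have "integrable M (\<lambda>\<omega>. a * u (Y i \<omega>))"
        using square_integrable_integrable_real[OF sq(1)] by simp
      then show ?thesis by (rule integrable_iff_bounded[THEN iffD1, THEN conjunct2])
    qed
    finally have "(\<integral>\<^sup>+ \<omega>. c a \<omega> \<partial>M) \<noteq> \<infinity>" by simp
    then have "AE \<omega> in M. c a \<omega> \<noteq> \<infinity>"
      by (intro nn_integral_PInf_AE) auto
    then show ?thesis by (simp add: less_top)
  qed
  have part: "integrable M (\<lambda>\<omega>. enn2real (c a \<omega>) * max 0 (b * v (Y j \<omega>)))
      \<and> (\<integral>\<omega>. enn2real (c a \<omega>) * max 0 (b * v (Y j \<omega>)) \<partial>M)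
        = (\<integral>\<omega>. max 0 (a * u (Y i \<omega>)) * max 0 (b * v (Y j \<omega>)) \<partial>M)" for a b
  proof -
    have "(\<integral>\<^sup>+ \<omega>. ennreal (enn2real (c a \<omega>) * max 0 (b * v (Y j \<omega>))) \<partial>M)
        = (\<integral>\<^sup>+ \<omega>. c a \<omega> * ennreal (b * v (Y j \<omega>)) \<partial>M)"
      using c_fin[of a]
      by (intro nn_integral_cong_AE) (auto simp: ennreal_mult max_def ennreal_neg elim!: eventually_mono)
    also have "\<dots> = (\<integral>\<^sup>+ \<omega>. ennreal (a * u (Y i \<omega>)) * ennreal (b * v (Y j \<omega>)) \<partial>M)"
      unfolding c_def
      by (rule cond_indep_nn_integral[OF P F indep I Y, symmetric,
            of "\<lambda>y. ennreal (a * u y)" "\<lambda>y. ennreal (b * v y)"]) auto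
    also have "\<dots> = (\<integral>\<^sup>+ \<omega>. ennreal (max 0 (a * u (Y i \<omega>)) * max 0 (b * v (Y j \<omega>))) \<partial>M)"
      by (intro nn_integral_cong) (auto simp: ennreal_mult max_def ennreal_neg)
    also have "\<dots> = ennreal (\<integral>\<omega>. max 0 (a * u (Y i \<omega>)) * max 0 (b * v (Y j \<omega>)) \<partial>M)"
      by (intro nn_integral_eq_integral int) auto
    finally have eq: "(\<integral>\<^sup>+ \<omega>. ennreal (enn2real (c a \<omega>) * max 0 (b * v (Y j \<omega>))) \<partial>M)
        = ennreal (\<integral>\<omega>. max 0 (a * u (Y i \<omega>)) * max 0 (b * v (Y j \<omega>)) \<partial>M)" .
    have intc: "integrable M (\<lambda>\<omega>. enn2real (c a \<omega>) * max 0 (b * v (Y j \<omega>)))"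
      by (rule integrableI_nn_integral_finite[OF _ _ eq]) auto
    then show ?thesis
      using eq by (subst (asm) nn_integral_eq_integral) (auto intro!: integral_nonneg_AE)
  qed
  have split_u: "u y = max 0 (1 * u y) - max 0 ((-1) * u y)"
    and split_v: "v y = max 0 (1 * v y) - max 0 ((-1) * v y)" for y
    by (auto simp: max_def)
  have cond: "real_cond_exp M F (\<lambda>\<omega>. u (Y i \<omega>)) \<omega> = enn2real (c 1 \<omega>) - enn2real (c (-1) \<omega>)" for \<omega>
    by (simp add: real_cond_exp_def c_def)
  show ?thesis
    unfolding cond
    apply (subst split_u)
    apply (subst (1 2) split_v)
    unfolding left_diff_distrib right_diff_distrib
    using part[of 1 1] part[of 1 "-1"] part[of "-1" 1] part[of "-1" "-1"]
      int[of 1 1] int[of 1 "-1"] int[of "-1" 1] int[of "-1" "-1"]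
    by (simp only: Bochner_Integration.integral_diff Bochner_Integration.integrable_diff)
qed

text \<open>Conditional independence makes \<open>Y i \<bullet> Y j\<close> and \<open>m i \<bullet> Y j\<close> equal in expectation, and \<open>m j\<close> is known when
  \<open>Y i\<close> is sampled.\<close>

lemma cond_indep_noise_orthogonal:
  fixes Y m :: "'i \<Rightarrow> 'w \<Rightarrow> real ^ 'p::finite"
  assumes P: "prob_space M" and F: "subalgebra M F"
    and indep: "cond_indep_vars M F Y I" and I: "finite I" "i \<in> I" "j \<in> I" "i \<noteq> j"
    and Y: "square_integrable M (Y i)" "square_integrable M (Y j)"
    and m: "square_integrable M (m i)" "square_integrable M (m j)"
    and m_F: "m i \<in> borel_measurable F" "m j \<in> borel_measurable F"
    and mean_i: "AE \<omega> in M. vec_cond_exp M F (Y i) \<omega> = m i \<omega>"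
    and mean_j: "AE \<omega> in M. vec_cond_exp M F (Y j) \<omega> = m j \<omega>"
  shows "(\<integral>\<omega>. (Y i \<omega> - m i \<omega>) \<bullet> (Y j \<omega> - m j \<omega>) \<partial>M) = 0"
proof -
  note Ym [measurable] = square_integrable_measurable[OF Y(1)] square_integrable_measurable[OF Y(2)]
    square_integrable_measurable[OF m(1)]
  have "(\<integral>\<omega>. Y i \<omega> $ k * Y j \<omega> $ k \<partial>M) = (\<integral>\<omega>. m i \<omega> $ k * Y j \<omega> $ k \<partial>M)" for k
  proof -
    have "(\<integral>\<omega>. Y i \<omega> $ k * Y j \<omega> $ k \<partial>M)
        = (\<integral>\<omega>. real_cond_exp M F (\<lambda>\<omega>. Y i \<omega> $ k) \<omega> * Y j \<omega> $ k \<partial>M)"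
      by (rule cond_indep_expectation_mult[OF P F indep I Ym(1,2), of "\<lambda>y. y $ k" "\<lambda>y. y $ k"])
        (auto intro: borel_measurable_nth square_integrable_nth Y)
    also have "\<dots> = (\<integral>\<omega>. m i \<omega> $ k * Y j \<omega> $ k \<partial>M)"
    proof (rule integral_cong_AE)
      show "AE \<omega> in M. real_cond_exp M F (\<lambda>\<omega>. Y i \<omega> $ k) \<omega> * Y j \<omega> $ k = m i \<omega> $ k * Y j \<omega> $ k"
        using mean_i by eventually_elim (auto simp: vec_cond_exp_def vec_eq_iff)
    qed (auto intro!: borel_measurable_times borel_measurable_nth Ym)
    finally show ?thesis .
  qed
  then have YY: "(\<integral>\<omega>. Y i \<omega> \<bullet> Y j \<omega> \<partial>M) = (\<integral>\<omega>. m i \<omega> \<bullet> Y j \<omega> \<partial>M)"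
    using Y m by (simp add: inner_integral_eq_sum)
  have mY: "(\<integral>\<omega>. m j \<omega> \<bullet> (Y i \<omega> - m i \<omega>) \<partial>M) = 0"
    by (rule expectation_inner_noise[OF P F m_F(2) m(2) Y(1) m(1) mean_i])
  have "(\<integral>\<omega>. (Y i \<omega> - m i \<omega>) \<bullet> (Y j \<omega> - m j \<omega>) \<partial>M)
      = (\<integral>\<omega>. Y i \<omega> \<bullet> Y j \<omega> - m i \<omega> \<bullet> Y j \<omega> - m j \<omega> \<bullet> (Y i \<omega> - m i \<omega>) \<partial>M)"
    by (rule Bochner_Integration.integral_cong) (auto simp: inner_diff_left inner_diff_right inner_commute)
  also have "\<dots> = 0"
    using Y m YY mY by (simp add: square_integrable_inner_integrable square_integrable_diff)
  finally show ?thesis .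
qed

lemma (in finite_measure) integrable_smooth_with:
  fixes X :: "'a \<Rightarrow> 'v::euclidean_space"
  assumes h: "smooth_with L h" "L > 0" "bdd_below (range h)" and X: "square_integrable M X"
  shows "integrable M (\<lambda>\<omega>. h (X \<omega>))"
proof -
  have [measurable]: "(\<lambda>\<omega>. h (X \<omega>)) \<in> borel_measurable M"
    using smooth_with_continuous[OF h(1)] square_integrable_measurable[OF X]
    by (rule borel_measurable_continuous_on)
  have gap0: "0 \<le> h x - (INF x. h x)" for x
    using h(3) by (simp add: cINF_lower)
  have "integrable M (\<lambda>\<omega>. h (X \<omega>) - (INF x. h x))"
  proof (rule Bochner_Integration.integrable_bound)
    show "integrable M (\<lambda>\<omega>. 2 * (h 0 - (INF x. h x)) + L * (norm (X \<omega> - 0))\<^sup>2)"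
      using X by (simp add: square_integrable_def)
    have "norm (h x - (INF x. h x)) \<le> norm (2 * (h 0 - (INF x. h x)) + L * (norm (x - 0))\<^sup>2)" for x
      using smooth_with_gap_le[OF h, of x 0] gap0[of x] unfolding real_norm_def by linarith
    then show "AE \<omega> in M. norm (h (X \<omega>) - (INF x. h x))
        \<le> norm (2 * (h 0 - (INF x. h x)) + L * (norm (X \<omega> - 0))\<^sup>2)"
      by simp
  qed measurable
  then have "integrable M (\<lambda>\<omega>. (h (X \<omega>) - (INF x. h x)) + (INF x. h x))"
    by (intro Bochner_Integration.integrable_add) auto
  then show ?thesis by simp
qed

text \<open>The variance bound is what makes \<open>Y\<close> square-integrable: \<open>abc_at\<close> assumes no integrability, and the
  conditional variance is a nonnegative conditional expectation that can be integrated unconditionally.\<close>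

lemma abc_at_noise_bound:
  fixes X Y :: "'w \<Rightarrow> real ^ 'p::finite"
  assumes P: "prob_space M" and F: "subalgebra M F"
    and h: "smooth_with L h" "L > 0" "bdd_below (range h)" and C: "C \<ge> 0" "D \<ge> 0"
    and abc: "abc_at M F h C D X Y" and X: "square_integrable M X"
  shows "square_integrable M Y"
    and "(\<integral>\<omega>. (norm (Y \<omega> - gradient h (X \<omega>)))\<^sup>2 \<partial>M)
      \<le> C * (\<integral>\<omega>. h (X \<omega>) - (INF x. h x) \<partial>M) + D"
proof -
  interpret prob_space M by fact
  interpret sigma_finite_subalgebra M F
    using P F by (rule sigma_finite_subalgebra_prob)
  have [measurable]: "X \<in> borel_measurable M" "Y \<in> borel_measurable M"
    using X abc by (auto simp: abc_at_def square_integrable_def)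
  have gap0: "0 \<le> h x - (INF x. h x)" for x
    using h(3) by (simp add: cINF_lower)
  have int_h: "integrable M (\<lambda>\<omega>. h (X \<omega>))"
    by (rule integrable_smooth_with[OF h X])
  have sq_g: "square_integrable M (\<lambda>\<omega>. gradient h (X \<omega>))"
    by (rule square_integrable_lipschitz[OF X smooth_with_lipschitz[OF h(1)]
          smooth_with_continuous_gradient[OF h(1)]])
  note [measurable] = square_integrable_measurable[OF sq_g]
  define B where "B = C * (\<integral>\<omega>. h (X \<omega>) - (INF x. h x) \<partial>M) + D"
  have B0: "0 \<le> B"
    unfolding B_def using C gap0 by (intro add_nonneg_nonneg mult_nonneg_nonneg integral_nonneg_AE) auto
  have "(\<integral>\<^sup>+ \<omega>. ennreal ((norm (Y \<omega> - gradient h (X \<omega>)))\<^sup>2) \<partial>M)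
      = (\<integral>\<^sup>+ \<omega>. nn_cond_exp M F (\<lambda>\<omega>. ennreal ((norm (Y \<omega> - gradient h (X \<omega>)))\<^sup>2)) \<omega> \<partial>M)"
    using nn_cond_exp_intg[of "\<lambda>_. 1" "\<lambda>\<omega>. ennreal ((norm (Y \<omega> - gradient h (X \<omega>)))\<^sup>2)"] by simp
  also have "\<dots> \<le> (\<integral>\<^sup>+ \<omega>. ennreal (C * (h (X \<omega>) - (INF x. h x)) + D) \<partial>M)"
    using abc by (intro nn_integral_mono_AE) (simp add: abc_at_def)
  also have "\<dots> = ennreal (\<integral>\<omega>. C * (h (X \<omega>) - (INF x. h x)) + D \<partial>M)"
    using int_h C gap0 by (intro nn_integral_eq_integral) auto
  also have "(\<integral>\<omega>. C * (h (X \<omega>) - (INF x. h x)) + D \<partial>M) = B"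
    using int_h by (simp add: B_def prob_space)
  finally have bound: "(\<integral>\<^sup>+ \<omega>. ennreal ((norm (Y \<omega> - gradient h (X \<omega>)))\<^sup>2) \<partial>M) \<le> ennreal B" .
  have int_N: "integrable M (\<lambda>\<omega>. (norm (Y \<omega> - gradient h (X \<omega>)))\<^sup>2)"
  proof (rule integrableI_bounded)
    show "(\<integral>\<^sup>+ \<omega>. ennreal (norm ((norm (Y \<omega> - gradient h (X \<omega>)))\<^sup>2)) \<partial>M) < \<infinity>"
      using le_less_trans[OF bound] by simp
  qed measurable
  then have "square_integrable M (\<lambda>\<omega>. Y \<omega> - gradient h (X \<omega>))"
    by (simp add: square_integrable_def)
  from square_integrable_add[OF this sq_g] show "square_integrable M Y"
    by simp
  have "ennreal (\<integral>\<omega>. (norm (Y \<omega> - gradient h (X \<omega>)))\<^sup>2 \<partial>M) \<le> ennreal B"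
    using bound by (subst (asm) nn_integral_eq_integral[OF int_N]) auto
  then show "(\<integral>\<omega>. (norm (Y \<omega> - gradient h (X \<omega>)))\<^sup>2 \<partial>M)
      \<le> C * (\<integral>\<omega>. h (X \<omega>) - (INF x. h x) \<partial>M) + D"
    using B0 by (simp add: B_def)
qed

section \<open>The SCAFFOLD process\<close>

locale scaffold_run =
  fixes n Q :: nat and f :: "nat \<Rightarrow> real ^ 'p::finite \<Rightarrow> real" and L C D \<eta>\<^sub>s \<eta>\<^sub>a :: real
    and x0 :: "real ^ 'p" and c0 :: "nat \<Rightarrow> real ^ 'p" and g :: "nat \<Rightarrow> real ^ 'p \<Rightarrow> 's \<Rightarrow> real ^ 'p"
    and M :: "'w measure" and F :: "nat \<Rightarrow> nat \<Rightarrow> 'w measure" and \<xi> :: "nat \<Rightarrow> nat \<Rightarrow> nat \<Rightarrow> 'w \<Rightarrow> 's"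
  assumes n: "n \<ge> 1" and Q: "Q \<ge> 1" and L: "L > 0"
    and smooth: "\<And>i. i \<in> {1..n} \<Longrightarrow> smooth_with L (f i)"
    and bdd: "\<And>i. i \<in> {1..n} \<Longrightarrow> bdd_below (range (f i))"
    and C: "C \<ge> 0" and D: "D \<ge> 0" and \<eta>\<^sub>s: "\<eta>\<^sub>s > 0" and \<eta>\<^sub>a: "\<eta>\<^sub>a > 0"
    and abc: "abc_condition n Q f C D M F g \<xi> (scaffold_local n Q \<eta>\<^sub>s \<eta>\<^sub>a x0 c0 g \<xi>)"
begin

definition state where
  "state t \<omega> = scaffold_state n Q \<eta>\<^sub>s \<eta>\<^sub>a x0 c0 (\<lambda>i k l x. g i x (\<xi> i k l \<omega>)) t"

definition X where "X t \<omega> = scaffold_x n Q \<eta>\<^sub>s \<eta>\<^sub>a x0 c0 g \<xi> t \<omega>"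
definition Y where "Y i t l \<omega> = scaffold_local n Q \<eta>\<^sub>s \<eta>\<^sub>a x0 c0 g \<xi> i t l \<omega>"
definition control where "control i t \<omega> = fst (snd (state t \<omega>)) i"
definition sample where "sample i t l \<omega> = g i (Y i t l \<omega>) (\<xi> i t l \<omega>)"
definition local_grad where "local_grad i t l \<omega> = gradient (f i) (Y i t l \<omega>)"
text \<open>Relative to the true gradient at the random query point, so that it is centred given the past.\<close>

definition noise where "noise i t l \<omega> = sample i t l \<omega> - local_grad i t l \<omega>"
definition \<eta> where "\<eta> = \<eta>\<^sub>a * \<eta>\<^sub>s * real Q"

lemma \<eta>_pos: "\<eta> > 0"
  using \<eta>\<^sub>s \<eta>\<^sub>a Q by (simp add: \<eta>_def)

text \<open>Both sides change in a round by the mean of the increments of the agents' control variates.\<close>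

lemma server_control: "snd (snd (state t \<omega>)) = mean_vec n (\<lambda>i. control i t \<omega>)"
proof (induction t)
  case (Suc t)
  then show ?case
    by (simp add: state_def control_def Let_def case_prod_beta flip: mean_vec_diff)
qed (simp add: state_def control_def)

lemma X_0: "X 0 \<omega> = x0"
  by (simp add: X_def scaffold_x_def)

lemma control_0: "control i 0 \<omega> = c0 i"
  by (simp add: control_def state_def)

lemma Y_0: "Y i t 0 \<omega> = X t \<omega>"
  by (simp add: Y_def scaffold_local_def X_def scaffold_x_def case_prod_beta Let_def)

lemma Y_Suc:
  "Y i t (Suc l) \<omega> = Y i t l \<omega> - \<eta>\<^sub>a *\<^sub>R (sample i t l \<omega> - control i t \<omega> + mean_vec n (\<lambda>i. control i t \<omega>))"
  unfolding server_control[symmetric]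
  by (simp add: Y_def sample_def control_def state_def scaffold_local_def case_prod_beta Let_def)

lemma Y_eq:
  "Y i t l \<omega> = X t \<omega> - \<eta>\<^sub>a *\<^sub>R (\<Sum>j<l. sample i t j \<omega> - control i t \<omega> + mean_vec n (\<lambda>i. control i t \<omega>))"
  by (induction l) (simp_all add: Y_0 Y_Suc scaleR_add_right algebra_simps)

text \<open>The update of the control variate telescopes to the mean of the gradients sampled in the round.\<close>

lemma control_Suc: "control i (Suc t) \<omega> = (1 / real Q) *\<^sub>R (\<Sum>l<Q. sample i t l \<omega>)"
proof -
  have "control i (Suc t) \<omega> = control i t \<omega> - mean_vec n (\<lambda>i. control i t \<omega>)
      + (1 / (\<eta>\<^sub>a * real Q)) *\<^sub>R (X t \<omega> - Y i t Q \<omega>)"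
    unfolding server_control[symmetric]
    by (simp add: control_def state_def X_def scaffold_x_def Y_def scaffold_local_def case_prod_beta Let_def)
  also have "\<dots> = (1 / real Q) *\<^sub>R (\<Sum>l<Q. sample i t l \<omega>)"
    using \<eta>\<^sub>a Q by (simp add: Y_eq sum.distrib sum_subtractf sum_constant_scaleR scaleR_add_right
        scaleR_diff_right del: sum_constant)
  finally show ?thesis .
qed

lemma sum_control_centered: "(\<Sum>i=1..n. control i t \<omega> - mean_vec n (\<lambda>i. control i t \<omega>)) = 0"
  using n by (simp add: sum_subtractf mean_vec_def sum_constant_scaleR del: sum_constant)

lemma X_Suc: "X (Suc t) \<omega> = X t \<omega> - \<eta> *\<^sub>R mean_vec n (\<lambda>i. control i (Suc t) \<omega>)"
proof -
  have "X (Suc t) \<omega> = X t \<omega> + \<eta>\<^sub>s *\<^sub>R mean_vec n (\<lambda>i. Y i t Q \<omega> - X t \<omega>)"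
    by (simp add: X_def scaffold_x_def Y_def scaffold_local_def case_prod_beta Let_def)
  also have "mean_vec n (\<lambda>i. Y i t Q \<omega> - X t \<omega>)
      = - ((\<eta>\<^sub>a * real Q) *\<^sub>R mean_vec n (\<lambda>i. control i (Suc t) \<omega> - (control i t \<omega> - mean_vec n (\<lambda>i. control i t \<omega>))))"
  proof -
    have "Y i t Q \<omega> - X t \<omega>
        = - ((\<eta>\<^sub>a * real Q) *\<^sub>R (control i (Suc t) \<omega> - (control i t \<omega> - mean_vec n (\<lambda>i. control i t \<omega>))))" for i
      using Q by (simp add: Y_eq control_Suc sum.distrib sum_subtractf sum_constant_scaleR scaleR_add_right
        scaleR_diff_right del: sum_constant)
    then show ?thesis
      by (simp add: mean_vec_def sum_negf scaleR_sum_right[symmetric] scaleR_left_commute)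
  qed
  also have "mean_vec n (\<lambda>i. control i (Suc t) \<omega> - (control i t \<omega> - mean_vec n (\<lambda>i. control i t \<omega>)))
      = mean_vec n (\<lambda>i. control i (Suc t) \<omega>)"
  proof -
    have "mean_vec n (\<lambda>i. control i t \<omega> - mean_vec n (\<lambda>i. control i t \<omega>)) = 0"
      by (subst mean_vec_def) (simp only: sum_control_centered scaleR_zero_right)
    then show ?thesis
      using mean_vec_diff[of n "\<lambda>i. control i (Suc t) \<omega>" "\<lambda>i. control i t \<omega> - mean_vec n (\<lambda>i. control i t \<omega>)"]
      by simp
  qed
  finally show ?thesis
    by (simp add: \<eta>_def mult_ac)
qed

sublocale prob_space M
  using abc by (simp add: abc_condition_def)

lemma subalgebra_F: "l < Q \<Longrightarrow> subalgebra M (F k l)"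
  using abc by (simp add: abc_condition_def)

lemma F_mono:
  assumes "l < Q" "l' < Q" and le: "k < k' \<or> k = k' \<and> l \<le> l'"
  shows "sets (F k l) \<subseteq> sets (F k' l')"
proof -
  have "k * Q + l \<le> k' * Q + l'"
  proof (cases "k < k'")
    case True
    then have "Suc k * Q \<le> k' * Q" by (intro mult_le_mono1) simp
    then show ?thesis using \<open>l < Q\<close> by simp
  qed (use le in simp)
  moreover have "filtration (space M) (\<lambda>m. F (m div Q) (m mod Q))"
    using abc by (simp add: abc_condition_def)
  ultimately have "sets (F ((k * Q + l) div Q) ((k * Q + l) mod Q))
      \<subseteq> sets (F ((k' * Q + l') div Q) ((k' * Q + l') mod Q))"
    by (intro filtration.sets_F_mono) auto
  then show ?thesis using assms by simp
qed

lemma measurable_F_mono: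
  assumes "l < Q" "l' < Q" "k < k' \<or> k = k' \<and> l \<le> l'" and "u \<in> borel_measurable (F k l)"
  shows "u \<in> borel_measurable (F k' l')"
proof -
  have "subalgebra (F k' l') (F k l)"
    using F_mono[OF assms(1-3)] subalgebra_F[OF assms(1)] subalgebra_F[OF assms(2)]
    by (auto simp: subalgebra_def)
  then show ?thesis
    using assms(4) by (rule measurable_from_subalg)
qed

lemma
  assumes "i \<in> {1..n}" "l < Q"
  shows Y_meas_F: "Y i t l \<in> borel_measurable (F t l)"
    and sample_meas_F: "sample i t l \<in> borel_measurable (F (Suc t) l)"
    and abc_at_Y: "abc_at M (F t l) (f i) C D (Y i t l) (sample i t l)"
    and indep_sample: "cond_indep_vars M (F t l) (\<lambda>i. sample i t l) {1..n}"
  using abc assms by (auto simp: abc_condition_def Y_def[abs_def] sample_def[abs_def])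

lemma cond_mean_sample:
  "i \<in> {1..n} \<Longrightarrow> l < Q \<Longrightarrow> AE \<omega> in M. vec_cond_exp M (F t l) (sample i t l) \<omega> = local_grad i t l \<omega>"
  using abc_at_Y by (simp add: abc_at_def local_grad_def)

lemma local_grad_meas_F: "i \<in> {1..n} \<Longrightarrow> l < Q \<Longrightarrow> local_grad i t l \<in> borel_measurable (F t l)"
  unfolding local_grad_def[abs_def]
  by (intro borel_measurable_continuous_on[OF smooth_with_continuous_gradient[OF smooth] Y_meas_F])

text \<open>Within a round, square-integrability passes from the iterate to the sample by the variance bound and
  from the sample to the next iterate by the update rule.\<close>

lemma square_integrable_round:
  assumes X: "square_integrable M (X t)"
    and c: "\<And>i. i \<in> {1..n} \<Longrightarrow> square_integrable M (control i t)" and i: "i \<in> {1..n}"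
  shows "l \<le> Q \<Longrightarrow> square_integrable M (Y i t l)"
    and "l < Q \<Longrightarrow> square_integrable M (sample i t l)"
proof -
  have S: "square_integrable M (sample i t l)" if "l < Q" "square_integrable M (Y i t l)" for l
    by (rule abc_at_noise_bound(1)[OF prob_space_axioms subalgebra_F smooth L bdd C D abc_at_Y])
      (use that i in auto)
  show Y: "square_integrable M (Y i t l)" if "l \<le> Q" for l
    using that
  proof (induction l)
    case 0
    then show ?case using X by (simp add: Y_0[abs_def])
  next
    case (Suc l)
    then show ?case
      using S[of l] i c unfolding Y_Suc[abs_def]
      by (intro square_integrable_diff square_integrable_scaleR square_integrable_add
          square_integrable_mean_vec) auto
  qed
  show "square_integrable M (sample i t l)" if "l < Q"
    using S Y that by simp
qed

lemma square_integrable_state: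
  "square_integrable M (X t) \<and> (\<forall>i\<in>{1..n}. square_integrable M (control i t))"
proof (induction t)
  case 0
  then show ?case by (simp add: X_0[abs_def] control_0[abs_def])
next
  case (Suc t)
  have c: "square_integrable M (control i (Suc t))" if "i \<in> {1..n}" for i
    unfolding control_Suc[abs_def] using square_integrable_round[of t i] Suc that
    by (intro square_integrable_scaleR square_integrable_sum) auto
  moreover have "square_integrable M (X (Suc t))"
    unfolding X_Suc[abs_def] using Suc c
    by (intro square_integrable_diff square_integrable_scaleR square_integrable_mean_vec) auto
  ultimately show ?case by blast
qed

lemma sq_X [intro, simp]: "square_integrable M (X t)"
  and sq_control [intro, simp]: "i \<in> {1..n} \<Longrightarrow> square_integrable M (control i t)"
  and sq_Y [intro, simp]: "i \<in> {1..n} \<Longrightarrow> l \<le> Q \<Longrightarrow> square_integrable M (Y i t l)"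
  and sq_sample [intro, simp]: "i \<in> {1..n} \<Longrightarrow> l < Q \<Longrightarrow> square_integrable M (sample i t l)"
  using square_integrable_state square_integrable_round by blast+

lemma sq_local_grad [intro, simp]: "i \<in> {1..n} \<Longrightarrow> l < Q \<Longrightarrow> square_integrable M (local_grad i t l)"
  unfolding local_grad_def[abs_def]
  by (rule square_integrable_lipschitz[OF _ smooth_with_lipschitz smooth_with_continuous_gradient])
    (auto intro: smooth)

lemma sq_noise [intro, simp]: "i \<in> {1..n} \<Longrightarrow> l < Q \<Longrightarrow> square_integrable M (noise i t l)"
  unfolding noise_def[abs_def] by auto

lemma sq_grad_X [intro, simp]: "i \<in> {1..n} \<Longrightarrow> square_integrable M (\<lambda>\<omega>. gradient (f i) (X t \<omega>))"
  by (rule square_integrable_lipschitz[OF _ smooth_with_lipschitz smooth_with_continuous_gradient])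
    (auto intro: smooth)

lemma noise_orthogonal_past:
  assumes "i \<in> {1..n}" "l < Q" "W \<in> borel_measurable (F t l)" "square_integrable M W"
  shows "expectation (\<lambda>\<omega>. W \<omega> \<bullet> noise i t l \<omega>) = 0"
  unfolding noise_def using assms
  by (intro expectation_inner_noise[OF prob_space_axioms subalgebra_F _ _ _ _ cond_mean_sample]) auto

lemma noise_orthogonal_agents:
  assumes "i \<in> {1..n}" "j \<in> {1..n}" "i \<noteq> j" "l < Q"
  shows "expectation (\<lambda>\<omega>. noise i t l \<omega> \<bullet> noise j t l \<omega>) = 0"
  unfolding noise_def
  by (rule cond_indep_noise_orthogonal[OF prob_space_axioms subalgebra_F indep_sample,
        where m = "\<lambda>i. local_grad i t l"])
    (use assms in \<open>auto intro: local_grad_meas_F cond_mean_sample\<close>)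

text \<open>The noise of the last local step of the preceding round is the only part of the current control variate that need not be
  known at the start of the round. In round \<open>0\<close> the control variate is deterministic.\<close>

definition last_noise where
  "last_noise i t \<omega> = (case t of 0 \<Rightarrow> 0 | Suc s \<Rightarrow> noise i s (Q - 1) \<omega>)"

lemma sq_last_noise [intro, simp]: "i \<in> {1..n} \<Longrightarrow> square_integrable M (last_noise i t)"
  using Q by (cases t) (auto simp: last_noise_def[abs_def])

lemma X_meas_F: "X t \<in> borel_measurable (F t 0)"
  using Y_meas_F[of 1 0 t] n Q by (simp add: Y_0[abs_def])

text \<open>The server moves along the mean control variate, so the latter can be read off from two consecutive iterates.\<close>

lemma server_control_meas: "(\<lambda>\<omega>. mean_vec n (\<lambda>i. control i t \<omega>)) \<in> borel_measurable (F t 0)"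
proof (cases t)
  case (Suc s)
  have "(\<lambda>\<omega>. mean_vec n (\<lambda>i. control i t \<omega>)) = (\<lambda>\<omega>. (1 / \<eta>) *\<^sub>R (X s \<omega> - X t \<omega>))"
    using \<eta>_pos by (simp add: X_Suc Suc)
  moreover have "X s \<in> borel_measurable (F t 0)"
    by (rule measurable_F_mono[OF _ _ _ X_meas_F]) (use Q Suc in auto)
  ultimately show ?thesis
    using X_meas_F by (auto intro!: borel_measurable_scaleR borel_measurable_diff)
qed (simp add: control_0)

text \<open>The gradients sampled in the preceding round are measurable one full round later, that is, by the last local step.\<close>

lemma control_meas_F_last:
  assumes "i \<in> {1..n}"
  shows "control i t \<in> borel_measurable (F t (Q - 1))"
proof (cases t)
  case (Suc s)
  have "sample i s l \<in> borel_measurable (F t (Q - 1))" if "l < Q" for l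
    by (rule measurable_F_mono[OF _ _ _ sample_meas_F]) (use assms that Suc in auto)
  then show ?thesis
    unfolding Suc control_Suc[abs_def] using Suc by (intro borel_measurable_scaleR borel_measurable_sum) auto
qed (simp add: control_0[abs_def])

text \<open>Sampled gradients can be recovered from consecutive local iterates and the control variates; this is how adaptedness
  of the iterates gives measurability of the samples.\<close>

lemma sample_eq: "sample i t l \<omega> = (1 / \<eta>\<^sub>a) *\<^sub>R (Y i t l \<omega> - Y i t (Suc l) \<omega>) + control i t \<omega> - mean_vec n (\<lambda>i. control i t \<omega>)"
  using \<eta>\<^sub>a by (simp add: Y_Suc)

text \<open>All summands of the control variate except the last are visible in the local iterates of the preceding
  round, and the last is its noise plus a true gradient at a known point.\<close>

lemma control_minus_last_noise_meas:
  assumes i: "i \<in> {1..n}"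
  shows "(\<lambda>\<omega>. control i t \<omega> - (1 / real Q) *\<^sub>R last_noise i t \<omega>) \<in> borel_measurable (F t 0)"
proof (cases t)
  case (Suc s)
  have S: "sample i s l \<in> borel_measurable (F t 0)" if l: "Suc l < Q" for l
    unfolding sample_eq[abs_def]
  proof (intro borel_measurable_scaleR borel_measurable_diff borel_measurable_add borel_measurable_const)
    show "Y i s l \<in> borel_measurable (F t 0)"
      by (rule measurable_F_mono[OF _ _ _ Y_meas_F]) (use i l Suc in auto)
    show "Y i s (Suc l) \<in> borel_measurable (F t 0)"
      by (rule measurable_F_mono[OF _ _ _ Y_meas_F]) (use i l Suc in auto)
    show "control i s \<in> borel_measurable (F t 0)"
      by (rule measurable_F_mono[OF _ _ _ control_meas_F_last]) (use i l Suc in auto)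
    show "(\<lambda>\<omega>. mean_vec n (\<lambda>i. control i s \<omega>)) \<in> borel_measurable (F t 0)"
      by (rule measurable_F_mono[OF _ _ _ server_control_meas]) (use i l Suc in auto)
  qed
  define q where "q = Q - 1"
  have q: "{..<Q} = insert q {..<q}" "Q - Suc 0 = q" "q < Q"
    using Q by (auto simp: q_def)
  have "(\<lambda>\<omega>. control i t \<omega> - (1 / real Q) *\<^sub>R last_noise i t \<omega>)
      = (\<lambda>\<omega>. (1 / real Q) *\<^sub>R ((\<Sum>l<q. sample i s l \<omega>) + local_grad i s q \<omega>))"
    by (auto simp: Suc control_Suc last_noise_def q noise_def algebra_simps)
  moreover have "local_grad i s q \<in> borel_measurable (F t 0)"
    by (rule measurable_F_mono[OF _ _ _ local_grad_meas_F]) (use i q Suc in auto)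
  ultimately show ?thesis
    using S q_def by (auto intro!: borel_measurable_scaleR borel_measurable_add borel_measurable_sum)
qed (simp add: control_0[abs_def] last_noise_def)

lemma noise_minus_last_noise_meas:
  assumes i: "i \<in> {1..n}" and l: "Suc l < Q"
  shows "(\<lambda>\<omega>. noise i t l \<omega> - (1 / real Q) *\<^sub>R last_noise i t \<omega>) \<in> borel_measurable (F t (Suc l))"
proof -
  have "(\<lambda>\<omega>. noise i t l \<omega> - (1 / real Q) *\<^sub>R last_noise i t \<omega>)
      = (\<lambda>\<omega>. (1 / \<eta>\<^sub>a) *\<^sub>R (Y i t l \<omega> - Y i t (Suc l) \<omega>)
          + (control i t \<omega> - (1 / real Q) *\<^sub>R last_noise i t \<omega>) - mean_vec n (\<lambda>i. control i t \<omega>) - local_grad i t l \<omega>)"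
    by (auto simp: noise_def sample_eq)
  also have "\<dots> \<in> borel_measurable (F t (Suc l))"
  proof (intro borel_measurable_scaleR borel_measurable_diff[of _ _ "local_grad i t l"] borel_measurable_diff[of "Y i t l"]
      borel_measurable_diff[of _ _ "\<lambda>\<omega>. mean_vec n (\<lambda>i. control i t \<omega>)"] borel_measurable_add borel_measurable_const)
    show "Y i t l \<in> borel_measurable (F t (Suc l))"
      by (rule measurable_F_mono[OF _ _ _ Y_meas_F]) (use i l in auto)
    show "local_grad i t l \<in> borel_measurable (F t (Suc l))"
      by (rule measurable_F_mono[OF _ _ _ local_grad_meas_F]) (use i l in auto)
    show "Y i t (Suc l) \<in> borel_measurable (F t (Suc l))"
      by (rule Y_meas_F) (use i l in auto)
    show "(\<lambda>\<omega>. control i t \<omega> - (1 / real Q) *\<^sub>R last_noise i t \<omega>) \<in> borel_measurable (F t (Suc l))"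
      by (rule measurable_F_mono[OF _ _ _ control_minus_last_noise_meas]) (use i l in auto)
    show "(\<lambda>\<omega>. mean_vec n (\<lambda>i. control i t \<omega>)) \<in> borel_measurable (F t (Suc l))"
      by (rule measurable_F_mono[OF _ _ _ server_control_meas]) (use i l in auto)
  qed
  finally show ?thesis .
qed

text \<open>Summed over the agents, the unknown parts of the control variates cancel.\<close>

lemma sum_noise_meas:
  assumes l: "Suc l < Q"
  shows "(\<lambda>\<omega>. \<Sum>i=1..n. noise i t l \<omega>) \<in> borel_measurable (F t (Suc l))"
proof -
  have "(\<Sum>i=1..n. noise i t l \<omega>) = (\<Sum>i=1..n. (1 / \<eta>\<^sub>a) *\<^sub>R (Y i t l \<omega> - Y i t (Suc l) \<omega>) - local_grad i t l \<omega>)" for \<omega>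
  proof -
    have "noise i t l \<omega> = ((1 / \<eta>\<^sub>a) *\<^sub>R (Y i t l \<omega> - Y i t (Suc l) \<omega>) - local_grad i t l \<omega>)
        + (control i t \<omega> - mean_vec n (\<lambda>i. control i t \<omega>))" for i
      by (simp add: noise_def sample_eq)
    then show ?thesis
      using sum_control_centered[of t \<omega>] by (simp only: sum.distrib add_0_right)
  qed
  moreover have "(\<lambda>\<omega>. \<Sum>i=1..n. (1 / \<eta>\<^sub>a) *\<^sub>R (Y i t l \<omega> - Y i t (Suc l) \<omega>) - local_grad i t l \<omega>)
      \<in> borel_measurable (F t (Suc l))"
  proof (intro borel_measurable_sum borel_measurable_scaleR borel_measurable_diff borel_measurable_const)
    fix i assume i: "i \<in> {1..n}"
    show "Y i t l \<in> borel_measurable (F t (Suc l))"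
      by (rule measurable_F_mono[OF _ _ _ Y_meas_F]) (use i l in auto)
    show "local_grad i t l \<in> borel_measurable (F t (Suc l))"
      by (rule measurable_F_mono[OF _ _ _ local_grad_meas_F]) (use i l in auto)
    show "Y i t (Suc l) \<in> borel_measurable (F t (Suc l))"
      by (rule Y_meas_F) (use i l in auto)
  qed
  ultimately show ?thesis by simp
qed

end

section \<open>Second moments of noise, drift and control error\<close>

context scaffold_run
begin

abbreviation E2 :: "('w \<Rightarrow> 'v::real_normed_vector) \<Rightarrow> real" where
  "E2 U \<equiv> expectation (\<lambda>\<omega>. (norm (U \<omega>))\<^sup>2)"

abbreviation f_mean where "f_mean \<equiv> mean_fun n f"

lemmas int_norm [intro, simp] = square_integrable_integrable_norm

lemma gradient_f_mean: "gradient f_mean x = mean_vec n (\<lambda>i. gradient (f i) x)"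
  by (rule gradient_mean_fun[OF n smooth])

lemma smooth_f_mean: "smooth_with L f_mean"
  by (rule smooth_with_mean_fun[OF n smooth])

lemma bdd_f_mean: "bdd_below (range f_mean)"
  by (rule bdd_below_mean_fun[OF bdd])

lemma sq_grad_f_mean [intro, simp]: "square_integrable M (\<lambda>\<omega>. gradient f_mean (X t \<omega>))"
  unfolding gradient_f_mean by (rule square_integrable_mean_vec) simp

lemma integrable_f_mean [intro, simp]: "integrable M (\<lambda>\<omega>. f_mean (X t \<omega>))"
  by (rule integrable_smooth_with[OF smooth_f_mean L bdd_f_mean sq_X])

lemma integrable_f_X [intro, simp]: "i \<in> {1..n} \<Longrightarrow> integrable M (\<lambda>\<omega>. f i (X t \<omega>))"
  by (rule integrable_smooth_with[OF smooth L bdd sq_X])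

lemma integrable_f_Y [intro, simp]: "i \<in> {1..n} \<Longrightarrow> l \<le> Q \<Longrightarrow> integrable M (\<lambda>\<omega>. f i (Y i t l \<omega>))"
  by (rule integrable_smooth_with[OF smooth L bdd sq_Y])

lemma sq_Y_minus_X [intro, simp]:
  "i \<in> {1..n} \<Longrightarrow> l \<le> Q \<Longrightarrow> square_integrable M (\<lambda>\<omega>. Y i t l \<omega> - X t \<omega>)"
  by (intro square_integrable_diff) auto

text \<open>The maximum over the local steps, not their mean: the last local step of a round has to be bounded on its own,
  since its noise enters the next round.\<close>

definition drift where
  "drift t = Max ((\<lambda>l. avg n (\<lambda>i. E2 (\<lambda>\<omega>. Y i t l \<omega> - X t \<omega>))) ` {..<Q})"

lemma avg_drift_le: "l < Q \<Longrightarrow> avg n (\<lambda>i. E2 (\<lambda>\<omega>. Y i t l \<omega> - X t \<omega>)) \<le> drift t"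
  unfolding drift_def by (intro Max_ge) auto

lemma drift_leI:
  assumes "\<And>l. l < Q \<Longrightarrow> avg n (\<lambda>i. E2 (\<lambda>\<omega>. Y i t l \<omega> - X t \<omega>)) \<le> B"
  shows "drift t \<le> B"
  unfolding drift_def using assms Q by (intro Max.boundedI) (auto simp: lessThan_empty_iff)

lemma drift_nonneg: "0 \<le> drift t"
proof -
  have "0 \<le> avg n (\<lambda>i. E2 (\<lambda>\<omega>. Y i t 0 \<omega> - X t \<omega>))"
    by (intro avg_nonneg) simp
  also have "\<dots> \<le> drift t"
    using Q by (intro avg_drift_le) simp
  finally show ?thesis .
qed

definition gap where "gap t = expectation (\<lambda>\<omega>. f_mean (X t \<omega>)) - (INF x. f_mean x)"

lemma gap_nonneg: "0 \<le> gap t"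
proof -
  have "(INF x. f_mean x) = expectation (\<lambda>\<omega>. (INF x. f_mean x))"
    by (simp add: prob_space)
  also have "\<dots> \<le> expectation (\<lambda>\<omega>. f_mean (X t \<omega>))"
    using bdd_f_mean by (intro integral_mono) (auto intro: cINF_lower)
  finally show ?thesis by (simp add: gap_def)
qed

definition noise_floor where "noise_floor = 2 * C * sigma_star n f + D"

definition noise_level where "noise_level t = noise_floor + 2 * C * gap t + C * L * drift t"

lemma noise_floor_nonneg: "0 \<le> noise_floor"
  using sigma_star_nonneg[of n f] bdd C D by (simp add: noise_floor_def)

lemma noise_level_nonneg: "0 \<le> noise_level t"
  using noise_floor_nonneg gap_nonneg drift_nonneg C L by (simp add: noise_level_def)

text \<open>Combines the ABC condition at the local iterate with \<open>smooth_with_gap_le\<close>; averaging over the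
  agents turns the gaps of the \<open>f i\<close> into the gap of the mean plus \<open>sigma_star\<close>.\<close>

lemma avg_noise_le:
  assumes l: "l < Q"
  shows "avg n (\<lambda>i. E2 (noise i t l)) \<le> noise_level t"
proof -
  have "E2 (noise i t l) \<le> D + C * (2 * expectation (\<lambda>\<omega>. f i (X t \<omega>) - (INF x. f i x))
      + L * E2 (\<lambda>\<omega>. Y i t l \<omega> - X t \<omega>))" if i: "i \<in> {1..n}" for i
  proof -
    have "E2 (noise i t l) \<le> C * expectation (\<lambda>\<omega>. f i (Y i t l \<omega>) - (INF x. f i x)) + D"
      unfolding noise_def local_grad_def using i l
      by (intro abc_at_noise_bound(2)[OF prob_space_axioms subalgebra_F smooth L bdd C D abc_at_Y]) auto
    also have "expectation (\<lambda>\<omega>. f i (Y i t l \<omega>) - (INF x. f i x))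
        \<le> expectation (\<lambda>\<omega>. 2 * (f i (X t \<omega>) - (INF x. f i x)) + L * (norm (Y i t l \<omega> - X t \<omega>))\<^sup>2)"
      using i l by (intro integral_mono smooth_with_gap_le[OF smooth L bdd])
        (auto intro!: Bochner_Integration.integrable_add)
    also have "\<dots> = 2 * expectation (\<lambda>\<omega>. f i (X t \<omega>) - (INF x. f i x))
      + L * E2 (\<lambda>\<omega>. Y i t l \<omega> - X t \<omega>)"
      using i l by (subst Bochner_Integration.integral_add) auto
    finally show ?thesis
      using C by (simp add: mult_left_mono)
  qed
  then have "avg n (\<lambda>i. E2 (noise i t l)) \<le> avg n (\<lambda>i. D + C * (2 * expectation (\<lambda>\<omega>. f i (X t \<omega>) - (INF x. f i x))
      + L * E2 (\<lambda>\<omega>. Y i t l \<omega> - X t \<omega>)))"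
    by (rule avg_mono)
  also have "\<dots> = D + C * (2 * avg n (\<lambda>i. expectation (\<lambda>\<omega>. f i (X t \<omega>) - (INF x. f i x)))
      + L * avg n (\<lambda>i. E2 (\<lambda>\<omega>. Y i t l \<omega> - X t \<omega>)))"
    using n by (simp only: avg_add avg_cmult avg_const)
  also have "avg n (\<lambda>i. expectation (\<lambda>\<omega>. f i (X t \<omega>) - (INF x. f i x))) = gap t + sigma_star n f"
  proof -
    have "avg n (\<lambda>i. expectation (\<lambda>\<omega>. f i (X t \<omega>) - (INF x. f i x)))
        = expectation (\<lambda>\<omega>. avg n (\<lambda>i. f i (X t \<omega>) - (INF x. f i x)))"
      by (rule integral_avg[symmetric]) auto
    also have "\<dots> = expectation (\<lambda>\<omega>. f_mean (X t \<omega>) - (INF x. f_mean x) + sigma_star n f)"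
      unfolding avg_def mean_gap_eq ..
    also have "\<dots> = gap t + sigma_star n f"
      by (simp add: gap_def prob_space)
    finally show ?thesis .
  qed
  also have "D + C * (2 * (gap t + sigma_star n f) + L * avg n (\<lambda>i. E2 (\<lambda>\<omega>. Y i t l \<omega> - X t \<omega>)))
      \<le> D + C * (2 * (gap t + sigma_star n f) + L * drift t)"
    using avg_drift_le[OF l] C L by (intro add_left_mono mult_left_mono) auto
  also have "\<dots> = noise_level t"
    by (simp add: noise_level_def noise_floor_def algebra_simps)
  finally show ?thesis .
qed

text \<open>In round \<open>0\<close> there is no preceding noise, which is why the potential starts without this term.\<close>

definition prev_noise_level where
  "prev_noise_level t = (case t of 0 \<Rightarrow> 0 | Suc s \<Rightarrow> noise_level s)"

lemma prev_noise_level_nonneg: "0 \<le> prev_noise_level t"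
  using noise_level_nonneg by (cases t) (auto simp: prev_noise_level_def)

lemma avg_last_noise_le: "avg n (\<lambda>i. E2 (last_noise i t)) \<le> prev_noise_level t"
  using avg_noise_le[of "Q - 1"] Q
  by (cases t) (auto simp: prev_noise_level_def last_noise_def[abs_def] avg_def)

text \<open>For \<open>j < l\<close> the noises of one agent are correlated only through the last noise of the preceding round, with weight
  \<open>1/Q\<close>. Adding step \<open>m\<close> thus produces cross terms of total weight \<open>m/Q \<le> 1\<close>.\<close>

lemma local_noise_sum_le:
  assumes i: "i \<in> {1..n}"
  shows "m \<le> Q \<Longrightarrow> E2 (\<lambda>\<omega>. \<Sum>j<m. noise i t j \<omega>) \<le> 2 * (\<Sum>j<m. E2 (noise i t j)) + real m * E2 (last_noise i t)"
proof (induction m)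
  case (Suc m)
  let ?e = "last_noise i t"
  have cross: "expectation (\<lambda>\<omega>. noise i t j \<omega> \<bullet> noise i t m \<omega>) = (1 / real Q) * expectation (\<lambda>\<omega>. ?e \<omega> \<bullet> noise i t m \<omega>)"
    if j: "j < m" for j
  proof -
    let ?W = "\<lambda>\<omega>. noise i t j \<omega> - (1 / real Q) *\<^sub>R ?e \<omega>"
    have sq: "square_integrable M (noise i t j)" "square_integrable M (noise i t m)" "square_integrable M ?e"
      using i j Suc.prems by auto
    have "?W \<in> borel_measurable (F t m)"
      by (rule measurable_F_mono[OF _ _ _ noise_minus_last_noise_meas[OF i]]) (use j Suc.prems in auto)
    then have "expectation (\<lambda>\<omega>. ?W \<omega> \<bullet> noise i t m \<omega>) = 0"
      using Suc.prems
      by (intro noise_orthogonal_past[OF i] square_integrable_diff square_integrable_scaleR sq) auto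
    also have "expectation (\<lambda>\<omega>. ?W \<omega> \<bullet> noise i t m \<omega>)
        = expectation (\<lambda>\<omega>. noise i t j \<omega> \<bullet> noise i t m \<omega>) - (1 / real Q) * expectation (\<lambda>\<omega>. ?e \<omega> \<bullet> noise i t m \<omega>)"
      using sq by (simp add: inner_diff_left square_integrable_inner_integrable)
    finally show ?thesis by simp
  qed
  have "expectation (\<lambda>\<omega>. (\<Sum>j<m. noise i t j \<omega>) \<bullet> noise i t m \<omega>) = (\<Sum>j<m. expectation (\<lambda>\<omega>. noise i t j \<omega> \<bullet> noise i t m \<omega>))"
    unfolding inner_sum_left using i Suc.prems
    by (intro Bochner_Integration.integral_sum square_integrable_inner_integrable) auto
  also have "\<dots> = (real m / real Q) * expectation (\<lambda>\<omega>. ?e \<omega> \<bullet> noise i t m \<omega>)"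
    using cross by simp
  finally have "2 * expectation (\<lambda>\<omega>. (\<Sum>j<m. noise i t j \<omega>) \<bullet> noise i t m \<omega>)
      = (real m / real Q) * (2 * expectation (\<lambda>\<omega>. ?e \<omega> \<bullet> noise i t m \<omega>))"
    by simp
  also have "\<dots> \<le> (real m / real Q) * (E2 ?e + E2 (noise i t m))"
    using i Suc.prems by (intro mult_left_mono integral_inner_le) auto
  also have "\<dots> \<le> 1 * (E2 ?e + E2 (noise i t m))"
    using Suc.prems by (intro mult_right_mono) auto
  finally have "2 * expectation (\<lambda>\<omega>. (\<Sum>j<m. noise i t j \<omega>) \<bullet> noise i t m \<omega>) \<le> E2 ?e + E2 (noise i t m)"
    by simp
  moreover have "E2 (\<lambda>\<omega>. (\<Sum>j<m. noise i t j \<omega>) + noise i t m \<omega>) = E2 (\<lambda>\<omega>. \<Sum>j<m. noise i t j \<omega>)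
      + 2 * expectation (\<lambda>\<omega>. (\<Sum>j<m. noise i t j \<omega>) \<bullet> noise i t m \<omega>) + E2 (noise i t m)"
    using i Suc.prems by (intro integral_norm_add_square_orthogonal square_integrable_sum) auto
  ultimately show ?case
    using Suc by (simp add: algebra_simps)
qed simp

lemma avg_local_noise_sum_le:
  assumes "m \<le> Q"
  shows "avg n (\<lambda>i. E2 (\<lambda>\<omega>. \<Sum>j<m. noise i t j \<omega>)) \<le> real m * (2 * noise_level t + prev_noise_level t)"
proof -
  have "avg n (\<lambda>i. E2 (\<lambda>\<omega>. \<Sum>j<m. noise i t j \<omega>))
      \<le> avg n (\<lambda>i. 2 * (\<Sum>j<m. E2 (noise i t j)) + real m * E2 (last_noise i t))"
    by (intro avg_mono local_noise_sum_le assms)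
  also have "\<dots> = 2 * (\<Sum>j<m. avg n (\<lambda>i. E2 (noise i t j))) + real m * avg n (\<lambda>i. E2 (last_noise i t))"
    by (simp only: avg_add avg_cmult avg_sum)
  also have "\<dots> \<le> 2 * (\<Sum>j<m. noise_level t) + real m * prev_noise_level t"
    using assms by (intro add_mono mult_left_mono sum_mono avg_noise_le avg_last_noise_le) auto
  finally show ?thesis by (simp add: algebra_simps)
qed

definition mean_noise where
  "mean_noise t \<omega> = (1 / (real n * real Q)) *\<^sub>R (\<Sum>l<Q. \<Sum>i=1..n. noise i t l \<omega>)"

lemma sq_mean_noise [intro, simp]: "square_integrable M (mean_noise t)"
  unfolding mean_noise_def[abs_def] by (intro square_integrable_scaleR square_integrable_sum) auto

text \<open>Orthogonality holds in both directions: across local steps because the sums over the agents are martingale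
  differences, and across agents by conditional independence.\<close>

lemma mean_noise_le: "E2 (mean_noise t) \<le> noise_level t / (real n * real Q)"
proof -
  let ?U = "\<lambda>l \<omega>. \<Sum>i=1..n. noise i t l \<omega>"
  have sqU: "square_integrable M (?U l)" if "l < Q" for l
    using that by (intro square_integrable_sum) auto
  have zero: "expectation (\<lambda>\<omega>. ?U k \<omega> \<bullet> ?U l \<omega>) = 0" if kl: "k < l" "l < Q" for k l
  proof -
    have "?U k \<in> borel_measurable (F t l)"
      by (rule measurable_F_mono[OF _ _ _ sum_noise_meas]) (use kl in auto)
    then have "expectation (\<lambda>\<omega>. ?U k \<omega> \<bullet> noise i t l \<omega>) = 0" if "i \<in> {1..n}" for i
      using that kl sqU by (intro noise_orthogonal_past) auto
    moreover have "expectation (\<lambda>\<omega>. ?U k \<omega> \<bullet> ?U l \<omega>) = (\<Sum>i=1..n. expectation (\<lambda>\<omega>. ?U k \<omega> \<bullet> noise i t l \<omega>))"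
      unfolding inner_sum_right using kl sqU
      by (intro Bochner_Integration.integral_sum square_integrable_inner_integrable) auto
    ultimately show ?thesis by simp
  qed
  have "E2 (\<lambda>\<omega>. \<Sum>l<Q. ?U l \<omega>) = (\<Sum>l<Q. E2 (?U l))"
  proof (rule integral_norm_square_sum_orthogonal)
    show "expectation (\<lambda>\<omega>. ?U j \<omega> \<bullet> ?U k \<omega>) = 0" if "j \<in> {..<Q}" "k \<in> {..<Q}" "j \<noteq> k" for j k
      using that zero[of j k] zero[of k j] by (cases "j < k") (auto simp: inner_commute)
  qed (use sqU in auto)
  also have "\<dots> = (\<Sum>l<Q. \<Sum>i=1..n. E2 (noise i t l))"
    by (intro sum.cong refl integral_norm_square_sum_orthogonal noise_orthogonal_agents) auto
  also have "\<dots> = (\<Sum>l<Q. real n * avg n (\<lambda>i. E2 (noise i t l)))"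
    using n by (simp add: avg_def)
  also have "\<dots> \<le> (\<Sum>l<Q. real n * noise_level t)"
    by (intro sum_mono mult_left_mono avg_noise_le) auto
  finally have "E2 (\<lambda>\<omega>. \<Sum>l<Q. ?U l \<omega>) \<le> real n * real Q * noise_level t"
    by (simp add: mult_ac)
  then have "(1 / (real n * real Q))\<^sup>2 * E2 (\<lambda>\<omega>. \<Sum>l<Q. ?U l \<omega>)
      \<le> (1 / (real n * real Q))\<^sup>2 * (real n * real Q * noise_level t)"
    by (intro mult_left_mono) auto
  also have "\<dots> = noise_level t / (real n * real Q)"
    using n Q by (simp add: power2_eq_square)
  also have "(1 / (real n * real Q))\<^sup>2 * E2 (\<lambda>\<omega>. \<Sum>l<Q. ?U l \<omega>) = E2 (mean_noise t)"
    unfolding mean_noise_def norm_scaleR power_mult_distrib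
    by (subst Bochner_Integration.integral_mult_right_zero[symmetric]) (simp add: power2_eq_square)
  finally show ?thesis .
qed

definition grad_sq where "grad_sq t = E2 (\<lambda>\<omega>. gradient f_mean (X t \<omega>))"

definition mean_grad where
  "mean_grad t \<omega> = mean_vec n (\<lambda>i. (1 / real Q) *\<^sub>R (\<Sum>l<Q. local_grad i t l \<omega>))"

lemma sq_mean_grad [intro, simp]: "square_integrable M (mean_grad t)"
  unfolding mean_grad_def[abs_def]
  by (intro square_integrable_mean_vec square_integrable_scaleR square_integrable_sum) auto

lemma X_Suc_noise: "X (Suc t) \<omega> = X t \<omega> - \<eta> *\<^sub>R (mean_grad t \<omega> + mean_noise t \<omega>)"
proof -
  have "mean_vec n (\<lambda>i. control i (Suc t) \<omega>) = mean_grad t \<omega> + mean_noise t \<omega>"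
  proof -
    have "mean_noise t \<omega> = mean_vec n (\<lambda>i. (1 / real Q) *\<^sub>R (\<Sum>l<Q. noise i t l \<omega>))"
      unfolding mean_noise_def mean_vec_def by (subst sum.swap) (simp add: scaleR_sum_right[symmetric])
    moreover have "mean_vec n u + mean_vec n v = mean_vec n (\<lambda>i. u i + v i)" for u v :: "nat \<Rightarrow> real ^ 'p"
      by (simp add: mean_vec_def sum.distrib scaleR_add_right)
    ultimately show ?thesis
      by (simp add: mean_grad_def control_Suc noise_def sum_subtractf flip: scaleR_add_right)
  qed
  then show ?thesis by (simp add: X_Suc)
qed

lemma sq_grad_gap [intro, simp]:
  "i \<in> {1..n} \<Longrightarrow> l < Q \<Longrightarrow> square_integrable M (\<lambda>\<omega>. local_grad i t l \<omega> - gradient (f i) (X t \<omega>))"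
  by (intro square_integrable_diff) auto

lemma grad_drift_le:
  assumes "i \<in> {1..n}" "l < Q"
  shows "E2 (\<lambda>\<omega>. local_grad i t l \<omega> - gradient (f i) (X t \<omega>)) \<le> L\<^sup>2 * E2 (\<lambda>\<omega>. Y i t l \<omega> - X t \<omega>)"
proof -
  have "E2 (\<lambda>\<omega>. local_grad i t l \<omega> - gradient (f i) (X t \<omega>)) \<le> expectation (\<lambda>\<omega>. L\<^sup>2 * (norm (Y i t l \<omega> - X t \<omega>))\<^sup>2)"
  proof (intro integral_mono)
    show "(norm (local_grad i t l \<omega> - gradient (f i) (X t \<omega>)))\<^sup>2 \<le> L\<^sup>2 * (norm (Y i t l \<omega> - X t \<omega>))\<^sup>2" for \<omega>
      using smooth_with_lipschitz[OF smooth[OF assms(1)], of "Y i t l \<omega>" "X t \<omega>"]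
      unfolding local_grad_def power_mult_distrib[symmetric] by (intro power_mono) auto
  qed (use assms in auto)
  then show ?thesis by simp
qed

lemma grad_drift_sum_le:
  assumes "m \<le> Q"
  shows "avg n (\<lambda>i. E2 (\<lambda>\<omega>. \<Sum>l<m. local_grad i t l \<omega> - gradient (f i) (X t \<omega>))) \<le> (real m)\<^sup>2 * (L\<^sup>2 * drift t)"
proof -
  have "E2 (\<lambda>\<omega>. \<Sum>l<m. local_grad i t l \<omega> - gradient (f i) (X t \<omega>))
      \<le> real m * (\<Sum>l<m. L\<^sup>2 * E2 (\<lambda>\<omega>. Y i t l \<omega> - X t \<omega>))" if i: "i \<in> {1..n}" for i
  proof -
    have "E2 (\<lambda>\<omega>. \<Sum>l<m. local_grad i t l \<omega> - gradient (f i) (X t \<omega>))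
        \<le> expectation (\<lambda>\<omega>. real m * (\<Sum>l<m. (norm (local_grad i t l \<omega> - gradient (f i) (X t \<omega>)))\<^sup>2))"
    proof (intro integral_mono)
      show "(norm (\<Sum>l<m. local_grad i t l \<omega> - gradient (f i) (X t \<omega>)))\<^sup>2
          \<le> real m * (\<Sum>l<m. (norm (local_grad i t l \<omega> - gradient (f i) (X t \<omega>)))\<^sup>2)" for \<omega>
        using norm_sum_square_le[of "\<lambda>l. local_grad i t l \<omega> - gradient (f i) (X t \<omega>)" "{..<m}"] by simp
    qed (use assms i in \<open>auto intro!: int_norm square_integrable_sum\<close>)
    also have "\<dots> = real m * (\<Sum>l<m. E2 (\<lambda>\<omega>. local_grad i t l \<omega> - gradient (f i) (X t \<omega>)))"
      using assms i by (simp add: Bochner_Integration.integral_sum)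
    also have "\<dots> \<le> real m * (\<Sum>l<m. L\<^sup>2 * E2 (\<lambda>\<omega>. Y i t l \<omega> - X t \<omega>))"
      using assms i by (intro mult_left_mono sum_mono grad_drift_le) auto
    finally show ?thesis .
  qed
  then have "avg n (\<lambda>i. E2 (\<lambda>\<omega>. \<Sum>l<m. local_grad i t l \<omega> - gradient (f i) (X t \<omega>)))
      \<le> avg n (\<lambda>i. real m * (\<Sum>l<m. L\<^sup>2 * E2 (\<lambda>\<omega>. Y i t l \<omega> - X t \<omega>)))"
    by (rule avg_mono)
  also have "\<dots> = real m * (\<Sum>l<m. L\<^sup>2 * avg n (\<lambda>i. E2 (\<lambda>\<omega>. Y i t l \<omega> - X t \<omega>)))"
    by (simp only: avg_cmult avg_sum)
  also have "\<dots> \<le> real m * (\<Sum>l<m. L\<^sup>2 * drift t)"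
    using assms by (intro mult_left_mono sum_mono avg_drift_le) auto
  finally show ?thesis by (simp add: power2_eq_square)
qed

lemma mean_grad_error_le: "E2 (\<lambda>\<omega>. gradient f_mean (X t \<omega>) - mean_grad t \<omega>) \<le> L\<^sup>2 * drift t"
proof -
  let ?U = "\<lambda>i \<omega>. \<Sum>l<Q. local_grad i t l \<omega> - gradient (f i) (X t \<omega>)"
  have eq: "gradient f_mean (X t \<omega>) - mean_grad t \<omega> = mean_vec n (\<lambda>i. - ((1 / real Q) *\<^sub>R ?U i \<omega>))" for \<omega>
    using Q by (simp add: gradient_f_mean mean_grad_def mean_vec_diff sum_subtractf sum_constant_scaleR
        scaleR_diff_right del: sum_constant)
  have sqU: "square_integrable M (?U i)" if "i \<in> {1..n}" for i
    using that by (intro square_integrable_sum) auto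
  have "E2 (\<lambda>\<omega>. gradient f_mean (X t \<omega>) - mean_grad t \<omega>)
      \<le> expectation (\<lambda>\<omega>. avg n (\<lambda>i. (1 / real Q)\<^sup>2 * (norm (?U i \<omega>))\<^sup>2))"
  proof (intro integral_mono integrable_avg)
    show "(norm (gradient f_mean (X t \<omega>) - mean_grad t \<omega>))\<^sup>2
        \<le> avg n (\<lambda>i. (1 / real Q)\<^sup>2 * (norm (?U i \<omega>))\<^sup>2)" for \<omega>
      using norm_mean_vec_square_le[of n "\<lambda>i. - ((1 / real Q) *\<^sub>R ?U i \<omega>)"]
      by (simp add: eq power_mult_distrib power_divide)
    show "integrable M (\<lambda>\<omega>. (norm (gradient f_mean (X t \<omega>) - mean_grad t \<omega>))\<^sup>2)"
      by (intro int_norm square_integrable_diff) auto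
  qed (use sqU in auto)
  also have "\<dots> = (1 / real Q)\<^sup>2 * avg n (\<lambda>i. E2 (?U i))"
    using sqU by (subst integral_avg) (auto simp: avg_cmult)
  also have "\<dots> \<le> (1 / real Q)\<^sup>2 * ((real Q)\<^sup>2 * (L\<^sup>2 * drift t))"
    by (intro mult_left_mono grad_drift_sum_le) auto
  also have "\<dots> = L\<^sup>2 * drift t"
    using Q by (simp add: power_divide)
  finally show ?thesis .
qed

text \<open>The mean local gradient depends on earlier noise of the same round, so it is not orthogonal to the averaged noise in the
  quadratic term. The weights \<open>9\<close> and \<open>9/8\<close> keep the coefficient of the noise close to its optimal
  value \<open>1\<close>; the large coefficient of the mean gradient is harmless because \<open>12 L \<eta> \<le> 1\<close>.\<close>

lemma descent:
  "gap (Suc t) \<le> gap t + (\<eta> / 2) * (L\<^sup>2 * drift t - grad_sq t - E2 (mean_grad t))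
    + (L / 2) * \<eta>\<^sup>2 * (9 * E2 (mean_grad t) + 9 / 8 * (noise_level t / (real n * real Q)))"
proof -
  let ?g = "\<lambda>\<omega>. gradient f_mean (X t \<omega>)"
  have sqd: "square_integrable M (\<lambda>\<omega>. ?g \<omega> - mean_grad t \<omega>)"
    by (intro square_integrable_diff) auto
  have int_gn: "integrable M (\<lambda>\<omega>. ?g \<omega> \<bullet> mean_noise t \<omega>)"
    by (intro square_integrable_inner_integrable) auto
  have g_meas: "?g \<in> borel_measurable (F t 0)"
    by (intro borel_measurable_continuous_on[OF smooth_with_continuous_gradient[OF smooth_f_mean] X_meas_F])
  have gn: "expectation (\<lambda>\<omega>. ?g \<omega> \<bullet> mean_noise t \<omega>) = 0"
  proof -
    have "expectation (\<lambda>\<omega>. ?g \<omega> \<bullet> noise i t l \<omega>) = 0" if "i \<in> {1..n}" "l < Q" for i l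
      by (rule noise_orthogonal_past[OF that _ sq_grad_f_mean], rule measurable_F_mono[OF _ _ _ g_meas])
        (use that in auto)
    then have "(\<Sum>l<Q. \<Sum>i=1..n. expectation (\<lambda>\<omega>. ?g \<omega> \<bullet> noise i t l \<omega>)) = 0"
      by (intro sum.neutral ballI) auto
    moreover have "expectation (\<lambda>\<omega>. \<Sum>l<Q. \<Sum>i=1..n. ?g \<omega> \<bullet> noise i t l \<omega>)
        = (\<Sum>l<Q. \<Sum>i=1..n. expectation (\<lambda>\<omega>. ?g \<omega> \<bullet> noise i t l \<omega>))"
      by (subst Bochner_Integration.integral_sum)
        (auto intro!: sum.cong Bochner_Integration.integral_sum Bochner_Integration.integrable_sum
          square_integrable_inner_integrable)
    ultimately show ?thesis
      by (simp add: mean_noise_def inner_sum_right)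
  qed
  have step: "f_mean (X (Suc t) \<omega>) \<le> f_mean (X t \<omega>)
      + (\<eta> / 2) * ((norm (?g \<omega> - mean_grad t \<omega>))\<^sup>2 - (norm (?g \<omega>))\<^sup>2 - (norm (mean_grad t \<omega>))\<^sup>2)
      - \<eta> * (?g \<omega> \<bullet> mean_noise t \<omega>)
      + (L / 2) * \<eta>\<^sup>2 * (9 * (norm (mean_grad t \<omega>))\<^sup>2 + 9 / 8 * (norm (mean_noise t \<omega>))\<^sup>2)" for \<omega>
  proof -
    let ?G = "mean_grad t \<omega>" and ?N = "mean_noise t \<omega>"
    have "f_mean (X (Suc t) \<omega>) \<le> f_mean (X t \<omega>) + ?g \<omega> \<bullet> (X (Suc t) \<omega> - X t \<omega>)
        + L / 2 * (norm (X (Suc t) \<omega> - X t \<omega>))\<^sup>2"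
      by (rule smooth_with_upper_bound[OF smooth_f_mean])
    also have "X (Suc t) \<omega> - X t \<omega> = - (\<eta> *\<^sub>R (?G + ?N))"
      by (simp add: X_Suc_noise)
    also have "?g \<omega> \<bullet> - (\<eta> *\<^sub>R (?G + ?N)) = - (\<eta> * (?g \<omega> \<bullet> ?G)) - \<eta> * (?g \<omega> \<bullet> ?N)"
      by (simp add: inner_add_right algebra_simps)
    also have "?g \<omega> \<bullet> ?G = ((norm (?g \<omega>))\<^sup>2 + (norm ?G)\<^sup>2 - (norm (?g \<omega> - ?G))\<^sup>2) / 2"
      by (simp add: power2_norm_eq_inner inner_diff_left inner_diff_right inner_commute)
    also have "(norm (- (\<eta> *\<^sub>R (?G + ?N))))\<^sup>2 = \<eta>\<^sup>2 * (norm (?G + ?N))\<^sup>2"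
      by (simp add: power_mult_distrib)
    also have "L / 2 * (\<eta>\<^sup>2 * (norm (?G + ?N))\<^sup>2)
        \<le> L / 2 * (\<eta>\<^sup>2 * (9 * (norm ?G)\<^sup>2 + 9 / 8 * (norm ?N)\<^sup>2))"
      using norm_add_square_weighted_le[of "1 / 8" ?G ?N] L by (intro mult_left_mono) auto
    finally show ?thesis
      by (simp add: algebra_simps add_divide_distrib diff_divide_distrib)
  qed
  have "expectation (\<lambda>\<omega>. f_mean (X (Suc t) \<omega>)) \<le> expectation (\<lambda>\<omega>. f_mean (X t \<omega>)
      + (\<eta> / 2) * ((norm (?g \<omega> - mean_grad t \<omega>))\<^sup>2 - (norm (?g \<omega>))\<^sup>2 - (norm (mean_grad t \<omega>))\<^sup>2)
      - \<eta> * (?g \<omega> \<bullet> mean_noise t \<omega>)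
      + (L / 2) * \<eta>\<^sup>2 * (9 * (norm (mean_grad t \<omega>))\<^sup>2 + 9 / 8 * (norm (mean_noise t \<omega>))\<^sup>2))"
    using sqd int_gn
    by (intro integral_mono step Bochner_Integration.integrable_add Bochner_Integration.integrable_diff
        Bochner_Integration.integrable_mult_right int_norm) auto
  also have "\<dots> = expectation (\<lambda>\<omega>. f_mean (X t \<omega>))
      + (\<eta> / 2) * (E2 (\<lambda>\<omega>. ?g \<omega> - mean_grad t \<omega>) - grad_sq t - E2 (mean_grad t))
      + (L / 2) * \<eta>\<^sup>2 * (9 * E2 (mean_grad t) + 9 / 8 * E2 (mean_noise t))"
    using sqd int_gn gn by (simp add: grad_sq_def)
  also have "\<dots> \<le> expectation (\<lambda>\<omega>. f_mean (X t \<omega>))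
      + (\<eta> / 2) * (L\<^sup>2 * drift t - grad_sq t - E2 (mean_grad t))
      + (L / 2) * \<eta>\<^sup>2 * (9 * E2 (mean_grad t) + 9 / 8 * (noise_level t / (real n * real Q)))"
    using mean_grad_error_le[of t] mean_noise_le[of t] \<eta>_pos L
    by (intro add_mono mult_left_mono diff_mono) auto
  finally show ?thesis by (simp add: gap_def)
qed

definition control_dev where "control_dev i t \<omega> = gradient (f i) (X t \<omega>) - control i t \<omega>"

lemma sq_control_dev [intro, simp]: "i \<in> {1..n} \<Longrightarrow> square_integrable M (control_dev i t)"
  unfolding control_dev_def[abs_def] by (intro square_integrable_diff) auto

text \<open>Centred, because the local updates use the control variates only through their deviations from the mean.\<close>

definition control_error where
  "control_error t = avg n (\<lambda>i. E2 (\<lambda>\<omega>. control_dev i t \<omega> - mean_vec n (\<lambda>j. control_dev j t \<omega>)))"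

lemma sq_control_dev_centered [intro, simp]:
  "i \<in> {1..n} \<Longrightarrow> square_integrable M (\<lambda>\<omega>. control_dev i t \<omega> - mean_vec n (\<lambda>j. control_dev j t \<omega>))"
  by (intro square_integrable_diff square_integrable_mean_vec) auto

lemma control_error_nonneg: "0 \<le> control_error t"
  unfolding control_error_def by (intro avg_nonneg) simp

lemma control_error_0:
  "control_error 0 \<le> 2 * (avg n (\<lambda>i. (norm (c0 i - mean_vec n c0))\<^sup>2) + avg n (\<lambda>i. (norm (gradient (f i) x0))\<^sup>2))"
proof -
  let ?u = "\<lambda>i. gradient (f i) x0"
  have "control_error 0 = avg n (\<lambda>i. (norm ((?u i - mean_vec n ?u) + - (c0 i - mean_vec n c0)))\<^sup>2)"
    by (simp add: control_error_def control_dev_def X_0 control_0 prob_space mean_vec_diff[symmetric] algebra_simps)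
  also have "\<dots> \<le> avg n (\<lambda>i. 2 * (norm (?u i - mean_vec n ?u))\<^sup>2 + 2 * (norm (c0 i - mean_vec n c0))\<^sup>2)"
  proof (rule avg_mono)
    fix i
    show "(norm ((?u i - mean_vec n ?u) + - (c0 i - mean_vec n c0)))\<^sup>2
        \<le> 2 * (norm (?u i - mean_vec n ?u))\<^sup>2 + 2 * (norm (c0 i - mean_vec n c0))\<^sup>2"
      using norm_add_square_le[of "?u i - mean_vec n ?u" "- (c0 i - mean_vec n c0)"]
      by (simp only: norm_minus_cancel)
  qed
  also have "\<dots> = 2 * avg n (\<lambda>i. (norm (?u i - mean_vec n ?u))\<^sup>2) + 2 * avg n (\<lambda>i. (norm (c0 i - mean_vec n c0))\<^sup>2)"
    by (simp only: avg_add avg_cmult)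
  also have "\<dots> \<le> 2 * avg n (\<lambda>i. (norm (?u i))\<^sup>2) + 2 * avg n (\<lambda>i. (norm (c0 i - mean_vec n c0))\<^sup>2)"
    using avg_norm_deviation_le[OF n, of ?u] by simp
  finally show ?thesis by simp
qed

lemma step_le: "E2 (\<lambda>\<omega>. X (Suc t) \<omega> - X t \<omega>)
    \<le> \<eta>\<^sup>2 * (2 * E2 (mean_grad t) + 2 * (noise_level t / (real n * real Q)))"
proof -
  have "E2 (\<lambda>\<omega>. X (Suc t) \<omega> - X t \<omega>)
      \<le> expectation (\<lambda>\<omega>. \<eta>\<^sup>2 * (2 * (norm (mean_grad t \<omega>))\<^sup>2 + 2 * (norm (mean_noise t \<omega>))\<^sup>2))"
  proof (intro integral_mono)
    show "integrable M (\<lambda>\<omega>. (norm (X (Suc t) \<omega> - X t \<omega>))\<^sup>2)"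
      by (intro int_norm square_integrable_diff) auto
    show "(norm (X (Suc t) \<omega> - X t \<omega>))\<^sup>2
        \<le> \<eta>\<^sup>2 * (2 * (norm (mean_grad t \<omega>))\<^sup>2 + 2 * (norm (mean_noise t \<omega>))\<^sup>2)" for \<omega>
      using norm_add_square_le[of "mean_grad t \<omega>" "mean_noise t \<omega>"] \<eta>_pos
      by (simp add: X_Suc_noise power_mult_distrib mult_left_mono)
  qed auto
  also have "\<dots> = \<eta>\<^sup>2 * (2 * E2 (mean_grad t) + 2 * E2 (mean_noise t))"
    by simp
  also have "\<dots> \<le> \<eta>\<^sup>2 * (2 * E2 (mean_grad t) + 2 * (noise_level t / (real n * real Q)))"
    using mean_noise_le by (intro mult_left_mono add_left_mono) auto
  finally show ?thesis .
qed

text \<open>The new control variate is the mean of the sampled gradients, so its distance to the new local gradient splits into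
  the movement of the server, the drift and the noise.\<close>

lemma control_error_Suc:
  "control_error (Suc t) \<le> 3 * (L\<^sup>2 * \<eta>\<^sup>2 * (2 * E2 (mean_grad t) + 2 * (noise_level t / (real n * real Q)))
    + L\<^sup>2 * drift t + (2 * noise_level t + prev_noise_level t) / real Q)"
proof -
  let ?U = "\<lambda>i \<omega>. \<Sum>l<Q. local_grad i t l \<omega> - gradient (f i) (X t \<omega>)" and ?V = "\<lambda>i \<omega>. \<Sum>l<Q. noise i t l \<omega>"
  let ?d = "\<lambda>\<omega>. X (Suc t) \<omega> - X t \<omega>"
  have sqU: "square_integrable M (?U i)" and sqV: "square_integrable M (?V i)" if "i \<in> {1..n}" for i
    using that by (auto intro!: square_integrable_sum)
  have sqd: "square_integrable M ?d"
    by (intro square_integrable_diff) auto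
  have "control_error (Suc t) = expectation (\<lambda>\<omega>. avg n (\<lambda>i. (norm (control_dev i (Suc t) \<omega> - mean_vec n (\<lambda>j. control_dev j (Suc t) \<omega>)))\<^sup>2))"
    unfolding control_error_def by (rule integral_avg[symmetric]) auto
  also have "\<dots> \<le> expectation (\<lambda>\<omega>. avg n (\<lambda>i. (norm (control_dev i (Suc t) \<omega>))\<^sup>2))"
    by (intro integral_mono integrable_avg avg_norm_deviation_le[OF n]) auto
  also have "\<dots> = avg n (\<lambda>i. E2 (control_dev i (Suc t)))"
    by (rule integral_avg) auto
  also have "\<dots> \<le> avg n (\<lambda>i. 3 * (L\<^sup>2 * E2 ?d + ((1 / real Q)\<^sup>2 * E2 (?U i) + (1 / real Q)\<^sup>2 * E2 (?V i))))"
  proof (rule avg_mono)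
    fix i assume i: "i \<in> {1..n}"
    have "E2 (control_dev i (Suc t)) \<le> expectation (\<lambda>\<omega>. 3 * (L\<^sup>2 * (norm (?d \<omega>))\<^sup>2
        + ((1 / real Q)\<^sup>2 * (norm (?U i \<omega>))\<^sup>2 + (1 / real Q)\<^sup>2 * (norm (?V i \<omega>))\<^sup>2)))"
    proof (intro integral_mono)
      fix \<omega>
      have "control_dev i (Suc t) \<omega> = (gradient (f i) (X (Suc t) \<omega>) - gradient (f i) (X t \<omega>))
          + - ((1 / real Q) *\<^sub>R ?U i \<omega>) + - ((1 / real Q) *\<^sub>R ?V i \<omega>)"
        using Q by (simp add: control_dev_def control_Suc noise_def sum_subtractf sum_constant_scaleR scaleR_diff_right
            del: sum_constant)
      then have "(norm (control_dev i (Suc t) \<omega>))\<^sup>2 \<le> 3 * ((norm (gradient (f i) (X (Suc t) \<omega>) - gradient (f i) (X t \<omega>)))\<^sup>2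
          + (norm (- ((1 / real Q) *\<^sub>R ?U i \<omega>)))\<^sup>2 + (norm (- ((1 / real Q) *\<^sub>R ?V i \<omega>)))\<^sup>2)"
        by (simp only: norm_add3_square_le)
      moreover have "(norm (gradient (f i) (X (Suc t) \<omega>) - gradient (f i) (X t \<omega>)))\<^sup>2 \<le> L\<^sup>2 * (norm (?d \<omega>))\<^sup>2"
        unfolding power_mult_distrib[symmetric]
        by (intro power_mono smooth_with_lipschitz[OF smooth[OF i]]) auto
      ultimately show "(norm (control_dev i (Suc t) \<omega>))\<^sup>2 \<le> 3 * (L\<^sup>2 * (norm (?d \<omega>))\<^sup>2
          + ((1 / real Q)\<^sup>2 * (norm (?U i \<omega>))\<^sup>2 + (1 / real Q)\<^sup>2 * (norm (?V i \<omega>))\<^sup>2))"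
        by (simp add: power_mult_distrib power_divide)
    next
      show "integrable M (\<lambda>\<omega>. 3 * (L\<^sup>2 * (norm (?d \<omega>))\<^sup>2
        + ((1 / real Q)\<^sup>2 * (norm (?U i \<omega>))\<^sup>2 + (1 / real Q)\<^sup>2 * (norm (?V i \<omega>))\<^sup>2)))"
        by (intro Bochner_Integration.integrable_add Bochner_Integration.integrable_mult_right int_norm
            sqd sqU[OF i] sqV[OF i])
    qed (use i in auto)
    also have "\<dots> = 3 * (L\<^sup>2 * E2 ?d + ((1 / real Q)\<^sup>2 * E2 (?U i) + (1 / real Q)\<^sup>2 * E2 (?V i)))"
      using int_norm[OF sqd] int_norm[OF sqU[OF i]] int_norm[OF sqV[OF i]] by simp
    finally show "E2 (control_dev i (Suc t)) \<le> 3 * (L\<^sup>2 * E2 ?d + ((1 / real Q)\<^sup>2 * E2 (?U i) + (1 / real Q)\<^sup>2 * E2 (?V i)))" .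
  qed
  also have "\<dots> = 3 * (L\<^sup>2 * E2 ?d + ((1 / real Q)\<^sup>2 * avg n (\<lambda>i. E2 (?U i)) + (1 / real Q)\<^sup>2 * avg n (\<lambda>i. E2 (?V i))))"
    using n by (simp only: avg_add avg_cmult avg_const)
  also have "\<dots> \<le> 3 * (L\<^sup>2 * (\<eta>\<^sup>2 * (2 * E2 (mean_grad t) + 2 * (noise_level t / (real n * real Q))))
      + ((1 / real Q)\<^sup>2 * ((real Q)\<^sup>2 * (L\<^sup>2 * drift t))
        + (1 / real Q)\<^sup>2 * (real Q * (2 * noise_level t + prev_noise_level t))))"
    using grad_drift_sum_le[of Q t] avg_local_noise_sum_le[of Q t] step_le[of t]
    by (intro mult_left_mono add_mono) auto
  also have "\<dots> = 3 * (L\<^sup>2 * \<eta>\<^sup>2 * (2 * E2 (mean_grad t) + 2 * (noise_level t / (real n * real Q)))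
    + L\<^sup>2 * drift t + (2 * noise_level t + prev_noise_level t) / real Q)"
    using Q by (simp add: power2_eq_square)
  finally show ?thesis .
qed

text \<open>Each local update is a sum of noise, the change of the local gradient, and the gradient of the
  mean corrupted by the control error. With the stepsize \<open>\<eta>\<^sub>a = \<eta> / (\<eta>\<^sub>s Q)\<close> the \<open>Q\<close> nearly orthogonal noises gain
  a factor \<open>1/Q\<close> over the other two.\<close>

lemma drift_le:
  "drift t \<le> 3 * (\<eta> / \<eta>\<^sub>s)\<^sup>2 * ((2 * noise_level t + prev_noise_level t) / real Q + L\<^sup>2 * drift t
    + control_error t + grad_sq t)"
proof (rule drift_leI)
  fix l assume l: "l < Q"
  let ?U = "\<lambda>i \<omega>. \<Sum>j<l. local_grad i t j \<omega> - gradient (f i) (X t \<omega>)" and ?V = "\<lambda>i \<omega>. \<Sum>j<l. noise i t j \<omega>"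
  let ?h = "\<lambda>i \<omega>. control_dev i t \<omega> - mean_vec n (\<lambda>j. control_dev j t \<omega>) + gradient f_mean (X t \<omega>)"
  have sqU: "square_integrable M (?U i)" and sqV: "square_integrable M (?V i)" and sqh: "square_integrable M (?h i)"
    if "i \<in> {1..n}" for i
    using that l by (auto intro!: square_integrable_sum square_integrable_add)
  have "E2 (\<lambda>\<omega>. Y i t l \<omega> - X t \<omega>) \<le> 3 * \<eta>\<^sub>a\<^sup>2 * (E2 (?V i) + E2 (?U i) + (real l)\<^sup>2 * E2 (?h i))"
    if i: "i \<in> {1..n}" for i
  proof -
    have "E2 (\<lambda>\<omega>. Y i t l \<omega> - X t \<omega>) \<le> expectation (\<lambda>\<omega>. 3 * \<eta>\<^sub>a\<^sup>2 * ((norm (?V i \<omega>))\<^sup>2 + (norm (?U i \<omega>))\<^sup>2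
        + (real l)\<^sup>2 * (norm (?h i \<omega>))\<^sup>2))"
    proof (intro integral_mono)
      fix \<omega>
      have "sample i t j \<omega> - control i t \<omega> + mean_vec n (\<lambda>i. control i t \<omega>)
          = noise i t j \<omega> + (local_grad i t j \<omega> - gradient (f i) (X t \<omega>)) + ?h i \<omega>" for j
        by (simp add: noise_def control_dev_def gradient_f_mean mean_vec_diff[symmetric])
      then have "Y i t l \<omega> - X t \<omega> = - (\<eta>\<^sub>a *\<^sub>R (?V i \<omega> + ?U i \<omega> + real l *\<^sub>R ?h i \<omega>))"
        by (simp only: Y_eq sum.distrib sum_constant_scaleR) (simp add: scaleR_add_right)
      then have "(norm (Y i t l \<omega> - X t \<omega>))\<^sup>2 = \<eta>\<^sub>a\<^sup>2 * (norm (?V i \<omega> + ?U i \<omega> + real l *\<^sub>R ?h i \<omega>))\<^sup>2"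
        by (simp only: norm_minus_cancel norm_scaleR power_mult_distrib power2_abs)
      also have "\<dots> \<le> \<eta>\<^sub>a\<^sup>2 * (3 * ((norm (?V i \<omega>))\<^sup>2 + (norm (?U i \<omega>))\<^sup>2 + (norm (real l *\<^sub>R ?h i \<omega>))\<^sup>2))"
        by (intro mult_left_mono norm_add3_square_le) simp
      finally show "(norm (Y i t l \<omega> - X t \<omega>))\<^sup>2 \<le> 3 * \<eta>\<^sub>a\<^sup>2 * ((norm (?V i \<omega>))\<^sup>2 + (norm (?U i \<omega>))\<^sup>2
        + (real l)\<^sup>2 * (norm (?h i \<omega>))\<^sup>2)"
        by (simp add: power_mult_distrib distrib_left mult_ac)
    next
      show "integrable M (\<lambda>\<omega>. 3 * \<eta>\<^sub>a\<^sup>2 * ((norm (?V i \<omega>))\<^sup>2 + (norm (?U i \<omega>))\<^sup>2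
        + (real l)\<^sup>2 * (norm (?h i \<omega>))\<^sup>2))"
        by (intro Bochner_Integration.integrable_add Bochner_Integration.integrable_mult_right int_norm
            sqU[OF i] sqV[OF i] sqh[OF i])
    qed (use i l in auto)
    also have "\<dots> = 3 * \<eta>\<^sub>a\<^sup>2 * (E2 (?V i) + E2 (?U i) + (real l)\<^sup>2 * E2 (?h i))"
      using int_norm[OF sqh[OF i]] int_norm[OF sqU[OF i]] int_norm[OF sqV[OF i]] by simp
    finally show ?thesis .
  qed
  then have "avg n (\<lambda>i. E2 (\<lambda>\<omega>. Y i t l \<omega> - X t \<omega>))
      \<le> avg n (\<lambda>i. 3 * \<eta>\<^sub>a\<^sup>2 * (E2 (?V i) + E2 (?U i) + (real l)\<^sup>2 * E2 (?h i)))"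
    by (rule avg_mono)
  also have "\<dots> = 3 * \<eta>\<^sub>a\<^sup>2 * (avg n (\<lambda>i. E2 (?V i)) + avg n (\<lambda>i. E2 (?U i)) + (real l)\<^sup>2 * avg n (\<lambda>i. E2 (?h i)))"
    by (simp only: avg_add avg_cmult)
  also have "avg n (\<lambda>i. E2 (?h i)) = control_error t + grad_sq t"
  proof -
    have "avg n (\<lambda>i. E2 (?h i)) = expectation (\<lambda>\<omega>. avg n (\<lambda>i. (norm (?h i \<omega>))\<^sup>2))"
      using sqh by (intro integral_avg[symmetric]) auto
    also have "\<dots> = expectation (\<lambda>\<omega>. avg n (\<lambda>i. (norm (control_dev i t \<omega> - mean_vec n (\<lambda>j. control_dev j t \<omega>)))\<^sup>2)
        + (norm (gradient f_mean (X t \<omega>)))\<^sup>2)"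
      by (simp only: avg_norm_deviation_add[OF n])
    also have "\<dots> = expectation (\<lambda>\<omega>. avg n (\<lambda>i. (norm (control_dev i t \<omega> - mean_vec n (\<lambda>j. control_dev j t \<omega>)))\<^sup>2)) + grad_sq t"
      unfolding grad_sq_def by (intro Bochner_Integration.integral_add integrable_avg) auto
    also have "expectation (\<lambda>\<omega>. avg n (\<lambda>i. (norm (control_dev i t \<omega> - mean_vec n (\<lambda>j. control_dev j t \<omega>)))\<^sup>2)) = control_error t"
      unfolding control_error_def by (rule integral_avg) auto
    finally show ?thesis .
  qed
  also have "3 * \<eta>\<^sub>a\<^sup>2 * (avg n (\<lambda>i. E2 (?V i)) + avg n (\<lambda>i. E2 (?U i)) + (real l)\<^sup>2 * (control_error t + grad_sq t))
    \<le> 3 * \<eta>\<^sub>a\<^sup>2 * (real Q * (2 * noise_level t + prev_noise_level t) + (real Q)\<^sup>2 * (L\<^sup>2 * drift t)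
      + (real Q)\<^sup>2 * (control_error t + grad_sq t))"
  proof (intro mult_left_mono add_mono mult_right_mono)
    have "avg n (\<lambda>i. E2 (?V i)) \<le> real l * (2 * noise_level t + prev_noise_level t)"
      using l by (intro avg_local_noise_sum_le) simp
    also have "\<dots> \<le> real Q * (2 * noise_level t + prev_noise_level t)"
      using l noise_level_nonneg[of t] prev_noise_level_nonneg[of t] by (intro mult_right_mono) auto
    finally show "avg n (\<lambda>i. E2 (?V i)) \<le> real Q * (2 * noise_level t + prev_noise_level t)" .
    have "avg n (\<lambda>i. E2 (?U i)) \<le> (real l)\<^sup>2 * (L\<^sup>2 * drift t)"
      using l by (intro grad_drift_sum_le) simp
    also have "\<dots> \<le> (real Q)\<^sup>2 * (L\<^sup>2 * drift t)"
      using l drift_nonneg by (intro mult_right_mono power_mono) auto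
    finally show "avg n (\<lambda>i. E2 (?U i)) \<le> (real Q)\<^sup>2 * (L\<^sup>2 * drift t)" .
    show "(real l)\<^sup>2 \<le> (real Q)\<^sup>2"
      using l by (intro power_mono) auto
    show "0 \<le> control_error t + grad_sq t"
      using control_error_nonneg by (simp add: grad_sq_def)
  qed auto
  also have "\<dots> = 3 * (\<eta> / \<eta>\<^sub>s)\<^sup>2 * ((2 * noise_level t + prev_noise_level t) / real Q + L\<^sup>2 * drift t
    + control_error t + grad_sq t)"
    using \<eta>\<^sub>s Q by (simp add: \<eta>_def field_simps power2_eq_square)
  finally show "avg n (\<lambda>i. E2 (\<lambda>\<omega>. Y i t l \<omega> - X t \<omega>)) \<le> \<dots>" .
qed

end

section \<open>Lyapunov recursion\<close>

text \<open>One round in real numbers: \<open>F\<close> is the gap, \<open>A\<close> the squared gradient, \<open>\<Gamma>\<close> the squared mean local gradient,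
  \<open>\<epsilon>\<close> the drift, \<open>Z\<close> the control error, \<open>\<nu>\<close> and \<open>\<nu>'\<close> the present and preceding noise levels, and primes on \<open>F\<close> and \<open>Z\<close>
  mark the next round. The drift inequality is first solved for \<open>\<epsilon>\<close>, giving \<open>\<epsilon> \<le> 4 \<delta> R\<close>. Every contribution of the drift
  is then a fraction of \<open>p R\<close>, and the weight \<open>p\<close> is chosen such that the fractions sum to less than one. Hence \<open>p R\<close>
  is paid by the old control error, the old noise level, \<open>1/14\<close> of \<open>\<eta> A\<close>, and the part \<open>V + 2 C F\<close> of the noise
  level, which feeds the growth factor and the additive term.\<close>

lemma lyapunov_step:
  fixes F A \<Gamma> \<epsilon> Z \<nu> \<nu>' F' Z' V L C \<eta> \<delta> m q :: real
  assumes pos: "L > 0" "C \<ge> 0" "\<eta> > 0" "\<delta> \<ge> 0" "q \<ge> 1" "m \<ge> 1"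
    and nonneg: "F \<ge> 0" "A \<ge> 0" "\<Gamma> \<ge> 0" "\<epsilon> \<ge> 0" "Z \<ge> 0" "\<nu>' \<ge> 0" "V \<ge> 0"
    and \<delta>: "84 * L * (L + C) * \<delta> \<le> 1" and \<eta>: "12 * (L + C) * \<eta> \<le> 1"
    and \<nu>: "\<nu> = V + 2 * C * F + C * L * \<epsilon>"
    and \<epsilon>: "\<epsilon> \<le> 3 * \<delta> * ((2 * \<nu> + \<nu>') / q + L\<^sup>2 * \<epsilon> + Z + A)"
    and F': "F' \<le> F + (\<eta> / 2) * (L\<^sup>2 * \<epsilon> - A - \<Gamma>) + (L / 2) * \<eta>\<^sup>2 * (9 * \<Gamma> + 9 / 8 * (\<nu> / (m * q)))"
    and Z': "Z' \<le> 3 * (L\<^sup>2 * \<eta>\<^sup>2 * (2 * \<Gamma> + 2 * (\<nu> / (m * q))) + L\<^sup>2 * \<epsilon> + (2 * \<nu> + \<nu>') / q)"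
    and p: "p = 6 * \<eta> * L\<^sup>2 * \<delta>"
    and \<kappa>: "\<kappa> = 9 / 16 * L * \<eta>\<^sup>2 / (m * q) + 78 * \<eta> * L\<^sup>2 * \<delta> / q"
  shows "F' + p * Z' + (4 * p / q) * \<nu>
    \<le> (1 + 2 * C * \<kappa>) * F + p * Z + (4 * p / q) * \<nu>' - (3 / 7) * \<eta> * A + \<kappa> * V"
proof -
  define W where "W = V + 2 * C * F"
  define R where "R = (2 * W + \<nu>') / q + Z + A"
  have W0: "0 \<le> W" using pos nonneg by (simp add: W_def)
  have R0: "0 \<le> R" using pos nonneg W0 by (simp add: R_def)
  have p0: "0 \<le> p" using pos by (simp add: p)
  have L\<delta>: "L\<^sup>2 * \<delta> \<le> 1 / 84" and CL\<delta>: "C * L * \<delta> \<le> 1 / 84"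
  proof -
    have "84 * (L\<^sup>2 * \<delta>) + 84 * (C * L * \<delta>) \<le> 1"
      using \<delta> by (simp add: algebra_simps power2_eq_square)
    moreover have "0 \<le> L\<^sup>2 * \<delta>" "0 \<le> C * L * \<delta>" using pos by auto
    ultimately show "L\<^sup>2 * \<delta> \<le> 1 / 84" "C * L * \<delta> \<le> 1 / 84" by linarith+
  qed
  have L\<eta>: "L * \<eta> \<le> 1 / 12" and C\<eta>: "C * \<eta> \<le> 1 / 12"
  proof -
    have "12 * (L * \<eta>) + 12 * (C * \<eta>) \<le> 1" using \<eta> by (simp add: algebra_simps)
    moreover have "0 \<le> L * \<eta>" "0 \<le> C * \<eta>" using pos by auto
    ultimately show "L * \<eta> \<le> 1 / 12" "C * \<eta> \<le> 1 / 12" by linarith+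
  qed
  have q1: "x / q \<le> x" if "0 \<le> x" for x
    using that pos by (simp add: divide_le_eq mult_left_le_one_le mult_left_mono[of 1 q x, simplified])
  have mq: "x / (m * q) \<le> x / q" if "0 \<le> x" for x
    using that pos by (intro divide_left_mono) auto
  have \<epsilon>R: "\<epsilon> \<le> 4 * (\<delta> * R)"
  proof -
    have "(2 * \<nu> + \<nu>') / q = (2 * W + \<nu>') / q + 2 * (C * L * \<epsilon>) / q"
      by (simp add: \<nu> W_def add_divide_distrib algebra_simps)
    then have "\<epsilon> \<le> 3 * (\<delta> * R) + 3 * (L\<^sup>2 * \<delta> * \<epsilon>) + 3 * \<delta> * (2 * (C * L * \<epsilon>) / q)"
      using \<epsilon> by (simp add: R_def algebra_simps)
    moreover have "L\<^sup>2 * \<delta> * \<epsilon> \<le> 1 / 84 * \<epsilon>"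
      using L\<delta> nonneg by (intro mult_right_mono)
    moreover have "3 * \<delta> * (2 * (C * L * \<epsilon>) / q) \<le> 6 * (1 / 84 * \<epsilon>)"
    proof -
      have "3 * \<delta> * (2 * (C * L * \<epsilon>) / q) \<le> 3 * \<delta> * (2 * (C * L * \<epsilon>))"
        using pos nonneg by (intro mult_left_mono q1) auto
      also have "\<dots> = 6 * (C * L * \<delta> * \<epsilon>)" by simp
      also have "\<dots> \<le> 6 * (1 / 84 * \<epsilon>)"
        using CL\<delta> nonneg by (intro mult_left_mono mult_right_mono) auto
      finally show ?thesis .
    qed
    moreover have "0 \<le> \<delta> * R" using pos R0 by simp
    ultimately show ?thesis by linarith
  qed
  have L\<epsilon>: "L\<^sup>2 * \<epsilon> \<le> 4 * (L\<^sup>2 * \<delta>) * R"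
    using mult_left_mono[OF \<epsilon>R, of "L\<^sup>2"] by (simp add: mult_ac)
  have L\<epsilon>': "L\<^sup>2 * \<epsilon> \<le> R / 21"
    using L\<epsilon> mult_right_mono[OF L\<delta> R0] by linarith
  have CL\<epsilon>: "C * L * \<epsilon> \<le> R / 21"
  proof -
    have "C * L * \<epsilon> \<le> 4 * ((C * L * \<delta>) * R)"
      using mult_left_mono[OF \<epsilon>R, of "C * L"] pos by (simp add: mult_ac)
    also have "\<dots> \<le> 4 * (1 / 84 * R)"
      using CL\<delta> R0 by (intro mult_left_mono mult_right_mono) auto
    finally show ?thesis by simp
  qed
  \<comment> \<open>the drift in the descent inequality\<close>
  have T1: "(\<eta> / 2) * (L\<^sup>2 * \<epsilon>) \<le> p * R / 3"
    using mult_left_mono[OF L\<epsilon>, of "\<eta> / 2"] pos by (simp add: p mult_ac)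
  have T2: "9 / 16 * L * \<eta>\<^sup>2 * (C * L * \<epsilon> / (m * q)) \<le> p * R / 32"
  proof -
    have "C * L * \<epsilon> / (m * q) \<le> C * L * \<epsilon>"
      using order_trans[OF mq q1] pos nonneg by auto
    then have "9 / 16 * L * \<eta>\<^sup>2 * (C * L * \<epsilon> / (m * q)) \<le> 9 / 16 * L * \<eta>\<^sup>2 * (C * L * \<epsilon>)"
      using pos by (intro mult_left_mono) auto
    also have "\<dots> = 9 / 16 * (C * \<eta>) * (\<eta> * (L\<^sup>2 * \<epsilon>))"
      by (simp add: power2_eq_square)
    also have "\<dots> \<le> 9 / 16 * (1 / 12) * (\<eta> * (L\<^sup>2 * \<epsilon>))"
      using C\<eta> pos nonneg by (intro mult_right_mono mult_left_mono) auto
    also have "\<dots> \<le> p * R / 32"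
      using T1 by (simp add: algebra_simps)
    finally show ?thesis .
  qed
  have T3: "3 * (p * (L\<^sup>2 * \<epsilon>)) \<le> p * R / 7"
    using mult_left_mono[OF L\<epsilon>' p0] by simp
  have T4: "6 * (p * (L\<^sup>2 * \<eta>\<^sup>2)) * x \<le> p * x / 24" if "0 \<le> x" for x
  proof -
    have "L\<^sup>2 * \<eta>\<^sup>2 \<le> (1 / 12)\<^sup>2"
      unfolding power_mult_distrib[symmetric] using L\<eta> pos by (intro power_mono) auto
    then have "p * (L\<^sup>2 * \<eta>\<^sup>2) * x \<le> p * (1 / 144) * x"
      using p0 that by (intro mult_right_mono mult_left_mono) (auto simp: power2_eq_square)
    then show ?thesis by simp
  qed
  have T5: "p * \<nu> / q \<le> p * W / q + p * R / 21"
  proof -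
    have "p * (C * L * \<epsilon>) / q \<le> p * (C * L * \<epsilon>)"
      using p0 pos nonneg by (intro q1) auto
    also have "\<dots> \<le> p * (R / 21)"
      using CL\<epsilon> p0 by (rule mult_left_mono)
    finally show ?thesis
      by (simp add: \<nu> W_def algebra_simps add_divide_distrib)
  qed
  have \<nu>0: "0 \<le> \<nu>" using pos nonneg by (simp add: \<nu>)
  have T6: "6 * (p * (L\<^sup>2 * \<eta>\<^sup>2)) * (\<nu> / (m * q)) \<le> (p * \<nu> / q) / 24"
  proof -
    have "6 * (p * (L\<^sup>2 * \<eta>\<^sup>2)) * (\<nu> / (m * q)) \<le> p * (\<nu> / (m * q)) / 24"
      using \<nu>0 pos by (intro T4) auto
    also have "\<dots> \<le> p * (\<nu> / q) / 24"
      using mq[OF \<nu>0] p0 by (intro divide_right_mono mult_left_mono) auto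
    finally show ?thesis by simp
  qed
  have p\<eta>: "p \<le> \<eta> / 14"
    using mult_left_mono[OF L\<delta>, of "6 * \<eta>"] pos by (simp add: p mult_ac)
  \<comment> \<open>the share of the squared gradient that pays for the drift: \<open>1/2 - 1/14 = 3/7\<close>\<close>
  have TA: "p * A \<le> \<eta> / 14 * A"
    using p\<eta> nonneg by (intro mult_right_mono) auto
  have T\<Gamma>: "6 * (p * (L\<^sup>2 * \<eta>\<^sup>2)) * \<Gamma> + 9 / 2 * L * \<eta>\<^sup>2 * \<Gamma> \<le> \<eta> / 2 * \<Gamma>"
  proof -
    have "6 * (p * (L\<^sup>2 * \<eta>\<^sup>2)) * \<Gamma> \<le> p * \<Gamma> / 24"
      by (rule T4) (rule nonneg)
    moreover have "p * \<Gamma> \<le> \<eta> / 14 * \<Gamma>"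
      using p\<eta> nonneg by (intro mult_right_mono) auto
    moreover have "9 / 2 * L * \<eta>\<^sup>2 * \<Gamma> \<le> 9 / 2 * (1 / 12) * (\<eta> * \<Gamma>)"
    proof -
      have "(L * \<eta>) * (\<eta> * \<Gamma>) \<le> 1 / 12 * (\<eta> * \<Gamma>)"
        using L\<eta> pos nonneg by (intro mult_right_mono) auto
      then show ?thesis by (simp add: power2_eq_square mult_ac)
    qed
    moreover have "0 \<le> \<eta> * \<Gamma>" using pos nonneg by simp
    ultimately show ?thesis by (simp add: mult_ac)
  qed
  have pZ': "p * Z' \<le> 6 * (p * (L\<^sup>2 * \<eta>\<^sup>2)) * \<Gamma> + 6 * (p * (L\<^sup>2 * \<eta>\<^sup>2)) * (\<nu> / (m * q))
      + 3 * (p * (L\<^sup>2 * \<epsilon>)) + 6 * (p * \<nu> / q) + 3 * (p * \<nu>' / q)"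
    using mult_left_mono[OF Z' p0] by (simp add: algebra_simps add_divide_distrib)
  have noise: "9 / 16 * L * \<eta>\<^sup>2 * (\<nu> / (m * q))
      = 9 / 16 * L * \<eta>\<^sup>2 / (m * q) * W + 9 / 16 * L * \<eta>\<^sup>2 * (C * L * \<epsilon> / (m * q))"
    by (simp add: \<nu> W_def algebra_simps add_divide_distrib)
  have pR: "p * R = 2 * (p * W / q) + p * \<nu>' / q + p * Z + p * A"
    by (simp add: R_def algebra_simps add_divide_distrib)
  have pW0: "0 \<le> p * W / q" using p0 W0 pos by simp
  have pR0: "0 \<le> p * R" using p0 R0 by simp
  have F'': "F' \<le> F + (\<eta> / 2) * (L\<^sup>2 * \<epsilon>) - \<eta> / 2 * A - \<eta> / 2 * \<Gamma> + 9 / 2 * L * \<eta>\<^sup>2 * \<Gamma>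
      + 9 / 16 * L * \<eta>\<^sup>2 * (\<nu> / (m * q))"
    using F' by (simp add: algebra_simps add_divide_distrib)
  have "F' + p * Z' + 4 * (p * \<nu> / q) \<le> F + p * Z + 4 * (p * \<nu>' / q) - 3 / 7 * (\<eta> * A)
      + 9 / 16 * L * \<eta>\<^sup>2 / (m * q) * W + 13 * (p * W / q)"
  proof -
    \<comment> \<open>the drift uses the fraction \<open>1/3 + 1/32 + 1/7 + (6 + 1/24 + 4)/21 < 1\<close> of \<open>pR\<close>\<close>
    have linear: "F' + pZ' + 4 * pn \<le> F + pZ + 4 * pn' - 3 / 7 * hA + nW + 13 * pW"
      if "F' \<le> F + h\<epsilon> - hA / 2 - h\<Gamma> + s\<Gamma> + sn" "pZ' \<le> d\<Gamma> + dn + 3 * p\<epsilon> + 6 * pn + 3 * pn'"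
        "sn = nW + s\<epsilon>" "h\<epsilon> \<le> pR / 3" "s\<epsilon> \<le> pR / 32" "3 * p\<epsilon> \<le> pR / 7" "pn \<le> pW + pR / 21"
        "dn \<le> pn / 24" "pA \<le> hA / 14" "d\<Gamma> + s\<Gamma> \<le> h\<Gamma>" "pR = 2 * pW + pn' + pZ + pA" "0 \<le> pW" "0 \<le> pR"
      for pZ' pn pZ pn' hA nW pW h\<epsilon> h\<Gamma> s\<Gamma> sn d\<Gamma> dn p\<epsilon> s\<epsilon> pR pA :: real
      using that by linarith
    have "F' \<le> F + (\<eta> / 2) * (L\<^sup>2 * \<epsilon>) - (\<eta> * A) / 2 - \<eta> / 2 * \<Gamma> + 9 / 2 * L * \<eta>\<^sup>2 * \<Gamma>
      + 9 / 16 * L * \<eta>\<^sup>2 * (\<nu> / (m * q))" "p * A \<le> (\<eta> * A) / 14"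
      using F'' TA by simp_all
    then show ?thesis
      by (rule linear[OF _ pZ' noise T1 T2 T3 T5 T6 _ T\<Gamma> pR pW0 pR0])
  qed
  also have "\<dots> = F + p * Z + 4 * (p * \<nu>' / q) - 3 / 7 * (\<eta> * A) + \<kappa> * W"
    by (simp add: \<kappa> p distrib_right)
  finally show ?thesis
    by (simp add: W_def algebra_simps)
qed

text \<open>If \<open>u\<close> is the amount by which \<open>k\<close> times the minimum exceeds \<open>s\<close>, then apart from the growth factor the potential loses
  \<open>u\<close> in every round, and it can lose no more than it has.\<close>

lemma min_le_of_recursion:
  fixes \<Phi> A :: "nat \<Rightarrow> real"
  assumes T: "T \<ge> 1" and k: "k > 0" and \<rho>: "\<rho> \<ge> 0" and s: "s \<ge> 0"
    and \<Phi>: "\<And>t. \<Phi> t \<ge> 0"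
    and step: "\<And>t. \<Phi> (Suc t) \<le> (1 + \<rho>) * \<Phi> t - k * A t + s"
    and B: "(1 + \<rho>) ^ T \<le> B"
  shows "(MIN t\<in>{0..<T}. A t) \<le> B * \<Phi> 0 / (k * real T) + s / k"
proof -
  define a where "a = (MIN t\<in>{0..<T}. A t)"
  have a: "a \<le> A t" if "t < T" for t
    unfolding a_def using that by (intro Min_le) auto
  have B0: "0 \<le> B"
    using B \<rho> by (intro order_trans[OF _ B]) simp
  define u where "u = k * a - s"
  have "u \<le> B * \<Phi> 0 / real T"
  proof (cases "u \<le> 0")
    case True
    moreover have "0 \<le> B * \<Phi> 0 / real T" using B0 \<Phi> by simp
    ultimately show ?thesis by linarith
  next
    case False
    have "\<Phi> t \<le> (1 + \<rho>) ^ t * \<Phi> 0 - real t * u" if "t \<le> T" for t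
      using that
    proof (induction t)
      case (Suc t)
      have "k * a \<le> k * A t"
        using a[of t] Suc.prems k by (intro mult_left_mono) auto
      then have "\<Phi> (Suc t) \<le> (1 + \<rho>) * \<Phi> t - u"
        using step[of t] by (simp add: u_def)
      also have "(1 + \<rho>) * \<Phi> t \<le> (1 + \<rho>) * ((1 + \<rho>) ^ t * \<Phi> 0 - real t * u)"
        using Suc \<rho> by (intro mult_left_mono) auto
      also have "\<dots> \<le> (1 + \<rho>) ^ Suc t * \<Phi> 0 - real t * u"
        using False \<rho> by (simp add: algebra_simps)
      finally show ?case by (simp add: algebra_simps)
    qed simp
    from this[of T] have "real T * u \<le> (1 + \<rho>) ^ T * \<Phi> 0"
      using \<Phi>[of T] by simp
    also have "\<dots> \<le> B * \<Phi> 0"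
      using B \<Phi> by (rule mult_right_mono)
    finally show ?thesis
      using T by (simp add: field_simps)
  qed
  then have "k * a \<le> B * \<Phi> 0 / real T + s"
    by (simp add: u_def)
  then have "a \<le> (B * \<Phi> 0 / real T + s) / k"
    using k by (simp add: pos_le_divide_eq mult.commute)
  then show ?thesis
    by (simp add: a_def add_divide_distrib mult.commute)
qed

context scaffold_run
begin

lemma min_grad_sq_le:
  fixes T :: nat
  assumes T: "T \<ge> 1" and \<delta>: "84 * L * (L + C) * (\<eta> / \<eta>\<^sub>s)\<^sup>2 \<le> 1" and \<eta>: "12 * (L + C) * \<eta> \<le> 1"
    and \<kappa>: "\<kappa> = 9 / 16 * L * \<eta>\<^sup>2 / (real n * real Q) + 78 * \<eta> * L\<^sup>2 * (\<eta> / \<eta>\<^sub>s)\<^sup>2 / real Q"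
    and B: "(1 + 2 * C * \<kappa>) ^ T \<le> B"
  shows "(MIN t\<in>{0..<T}. grad_sq t) \<le> 7 / 3 * B
      * ((f_mean x0 - (INF x. f_mean x)) / (\<eta> * real T)
        + 12 * L\<^sup>2 * (\<eta> / \<eta>\<^sub>s)\<^sup>2
          * (avg n (\<lambda>i. (norm (c0 i - mean_vec n c0))\<^sup>2) + avg n (\<lambda>i. (norm (gradient (f i) x0))\<^sup>2)) / real T)
    + 7 / 3 * (\<kappa> / \<eta>) * noise_floor"
proof -
  define p where "p = 6 * \<eta> * L\<^sup>2 * (\<eta> / \<eta>\<^sub>s)\<^sup>2"
  define \<Delta> where "\<Delta> = avg n (\<lambda>i. (norm (c0 i - mean_vec n c0))\<^sup>2) + avg n (\<lambda>i. (norm (gradient (f i) x0))\<^sup>2)"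
  define \<Phi> where "\<Phi> t = gap t + p * control_error t + (4 * p / real Q) * prev_noise_level t" for t
  have p0: "0 \<le> p" using \<eta>_pos by (simp add: p_def)
  have \<kappa>0: "0 \<le> \<kappa>" using \<eta>_pos L by (simp add: \<kappa>)
  have \<Phi>0: "0 \<le> \<Phi> t" for t
    using gap_nonneg[of t] control_error_nonneg[of t] prev_noise_level_nonneg[of t] p0 by (simp add: \<Phi>_def)
  have step: "\<Phi> (Suc t) \<le> (1 + 2 * C * \<kappa>) * \<Phi> t - (3 / 7 * \<eta>) * grad_sq t + \<kappa> * noise_floor" for t
  proof -
    have "gap (Suc t) + p * control_error (Suc t) + (4 * p / real Q) * noise_level t
        \<le> (1 + 2 * C * \<kappa>) * gap t + p * control_error t + (4 * p / real Q) * prev_noise_level t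
          - (3 / 7) * \<eta> * grad_sq t + \<kappa> * noise_floor"
      by (rule lyapunov_step[OF L C \<eta>_pos _ _ _ gap_nonneg _ _ drift_nonneg control_error_nonneg
            prev_noise_level_nonneg noise_floor_nonneg \<delta> \<eta> noise_level_def drift_le descent
            control_error_Suc p_def \<kappa>])
        (use n Q in \<open>auto simp: grad_sq_def\<close>)
    also have "\<dots> \<le> (1 + 2 * C * \<kappa>) * \<Phi> t - (3 / 7 * \<eta>) * grad_sq t + \<kappa> * noise_floor"
    proof -
      \<comment> \<open>the growth factor is needed for the gap only; enlarging it on the other two terms gives a closed recursion\<close>
      define w where "w = p * control_error t + (4 * p / real Q) * prev_noise_level t"
      have "0 \<le> 2 * C * \<kappa> * w"
        using C \<kappa>0 p0 control_error_nonneg[of t] prev_noise_level_nonneg[of t] by (simp add: w_def)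
      moreover have "(1 + 2 * C * \<kappa>) * \<Phi> t = (1 + 2 * C * \<kappa>) * gap t + w + 2 * C * \<kappa> * w"
      proof -
        have "\<Phi> t = gap t + w" by (simp add: \<Phi>_def w_def)
        then show ?thesis by (simp add: algebra_simps)
      qed
      ultimately show ?thesis
        unfolding w_def by linarith
    qed
    finally show ?thesis
      by (simp add: \<Phi>_def prev_noise_level_def)
  qed
  have B0: "0 \<le> B"
    using C \<kappa>0 by (intro order_trans[OF _ B]) simp
  have gap0: "gap 0 = f_mean x0 - (INF x. f_mean x)"
    by (simp add: gap_def X_0 prob_space)
  have "(MIN t\<in>{0..<T}. grad_sq t) \<le> B * \<Phi> 0 / (3 / 7 * \<eta> * real T) + \<kappa> * noise_floor / (3 / 7 * \<eta>)"
    by (rule min_le_of_recursion[where \<Phi> = \<Phi> and A = grad_sq, OF T _ _ _ \<Phi>0 step B]) (use \<eta>_pos C \<kappa>0 noise_floor_nonneg in auto)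
  also have "\<dots> \<le> B * (gap 0 + p * (2 * \<Delta>)) / (3 / 7 * \<eta> * real T) + \<kappa> * noise_floor / (3 / 7 * \<eta>)"
  proof -
    have "\<Phi> 0 \<le> gap 0 + p * (2 * \<Delta>)"
      using mult_left_mono[OF control_error_0 p0] by (simp add: \<Phi>_def prev_noise_level_def \<Delta>_def)
    then show ?thesis
      using B0 \<eta>_pos by (intro add_right_mono divide_right_mono mult_left_mono) auto
  qed
  also have "\<dots> = 7 / 3 * B * (gap 0 / (\<eta> * real T) + 12 * L\<^sup>2 * (\<eta> / \<eta>\<^sub>s)\<^sup>2 * \<Delta> / real T)
      + 7 / 3 * (\<kappa> / \<eta>) * noise_floor"
    using \<eta>_pos T by (simp add: p_def add_divide_distrib distrib_left)
  finally show ?thesis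
    by (simp add: gap0 \<Delta>_def)
qed

end

section \<open>Stepsizes\<close>

text \<open>The four caps without roots; the last one also holds for \<open>C = 0\<close>, where the cap is infinite.\<close>

lemma stepsize_cap_conditions:
  fixes L C \<eta> \<eta>\<^sub>s :: real
  assumes L: "L > 0" and C: "C \<ge> 0" and \<eta>\<^sub>s: "\<eta>\<^sub>s > 0" and n: "n \<ge> 1" and Q: "Q \<ge> 1" and T: "T \<ge> 1"
    and \<eta>: "\<eta> > 0" and cap: "ereal \<eta> \<le> stepsize_cap n Q L C \<eta>\<^sub>s T"
  shows "84 * L * (L + C) * (\<eta> / \<eta>\<^sub>s)\<^sup>2 \<le> 1"
    and "12 * (L + C) * \<eta> \<le> 1"
    and "(L\<^sup>2 + C\<^sup>2) * real T * \<eta>\<^sup>2 \<le> 2 * real n * real Q"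
    and "560 * L * C * (L + C) * real T * \<eta> ^ 3 \<le> \<eta>\<^sub>s\<^sup>2 * real Q"
proof -
  have caps: "\<eta> \<le> \<eta>\<^sub>s / sqrt (84 * L * (L + C))" "\<eta> \<le> 1 / (12 * (L + C))"
    "\<eta> \<le> sqrt (2 * real n * real Q / ((L\<^sup>2 + C\<^sup>2) * real T))"
    "C \<noteq> 0 \<Longrightarrow> \<eta> \<le> (\<eta>\<^sub>s\<^sup>2 * real Q / (560 * L * C * (L + C) * real T)) powr (1/3)"
    using cap unfolding stepsize_cap_def by (auto split: if_splits)
  have pos: "0 < 84 * L * (L + C)" "0 < L + C" "0 < (L\<^sup>2 + C\<^sup>2) * real T"
    using L C T by (auto intro!: mult_pos_pos add_pos_nonneg)
  have "\<eta> * sqrt (84 * L * (L + C)) \<le> \<eta>\<^sub>s"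
    using caps(1) pos(1) by (simp add: pos_le_divide_eq)
  then have "(\<eta> * sqrt (84 * L * (L + C)))\<^sup>2 \<le> \<eta>\<^sub>s\<^sup>2"
    using \<eta> pos by (intro power_mono) auto
  then have "\<eta>\<^sup>2 * (84 * L * (L + C)) \<le> \<eta>\<^sub>s\<^sup>2"
    using pos(1) by (simp add: power_mult_distrib)
  then show "84 * L * (L + C) * (\<eta> / \<eta>\<^sub>s)\<^sup>2 \<le> 1"
    using \<eta>\<^sub>s by (simp add: power_divide divide_le_eq mult.commute)
  show "12 * (L + C) * \<eta> \<le> 1"
    using caps(2) pos(2) by (simp add: pos_le_divide_eq mult.commute)
  have "\<eta>\<^sup>2 \<le> (sqrt (2 * real n * real Q / ((L\<^sup>2 + C\<^sup>2) * real T)))\<^sup>2"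
    using caps(3) \<eta> by (intro power_mono) auto
  also have "\<dots> = 2 * real n * real Q / ((L\<^sup>2 + C\<^sup>2) * real T)"
    using pos by (intro real_sqrt_pow2) auto
  finally show "(L\<^sup>2 + C\<^sup>2) * real T * \<eta>\<^sup>2 \<le> 2 * real n * real Q"
    using pos(3) by (simp add: pos_le_divide_eq mult.commute)
  show "560 * L * C * (L + C) * real T * \<eta> ^ 3 \<le> \<eta>\<^sub>s\<^sup>2 * real Q"
  proof (cases "C = 0")
    case False
    then have den: "0 < 560 * L * C * (L + C) * real T"
      using L C T by (intro mult_pos_pos) auto
    let ?a = "\<eta>\<^sub>s\<^sup>2 * real Q / (560 * L * C * (L + C) * real T)"
    have a: "0 < ?a" using den \<eta>\<^sub>s Q by (intro divide_pos_pos) auto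
    have "\<eta> ^ 3 \<le> (?a powr (1/3)) ^ 3"
      using caps(4)[OF False] \<eta> by (intro power_mono) auto
    also have "\<dots> = ?a"
    proof -
      have "(y powr (1/3)) ^ 3 = y" if "0 < y" for y :: real
        using that by (simp add: powr_power)
      then show ?thesis using a .
    qed
    finally show ?thesis
      using den by (simp add: pos_le_divide_eq mult.commute)
  qed (use \<eta>\<^sub>s in simp)
qed

lemma exp_three_halves_le: "exp (3 / 2 :: real) \<le> 11 / 2"
proof -
  have "exp (3 / 2 :: real) = exp 1 * exp (1 / 2)"
    by (simp flip: exp_add)
  also have "\<dots> \<le> 272 / 100 * 2"
    using e_less_272 exp_half_le2 by (intro mult_mono) auto
  finally show ?thesis by simp
qed

lemma power_one_plus_le_exp:
  fixes \<rho> :: real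
  assumes "\<rho> \<ge> 0" and "\<rho> * real T \<le> K"
  shows "(1 + \<rho>) ^ T \<le> exp K"
proof -
  have "(1 + \<rho>) ^ T \<le> exp \<rho> ^ T"
    using assms by (intro power_mono) auto
  also have "\<dots> = exp (\<rho> * real T)"
    by (rule exp_of_nat2_mult[symmetric])
  also have "\<dots> \<le> exp K"
    using assms(2) by simp
  finally show ?thesis .
qed

text \<open>The part of the growth exponent that stems from the averaged noise; the third cap suffices for it because
  \<open>2LC \<le> L\<^sup>2 + C\<^sup>2\<close>.\<close>

lemma growth_exponent_le:
  fixes L C \<eta> :: real
  assumes L: "L > 0" and C: "C \<ge> 0" and n: "n \<ge> 1" and Q: "Q \<ge> 1"
    and cap: "(L\<^sup>2 + C\<^sup>2) * real T * \<eta>\<^sup>2 \<le> 2 * real n * real Q"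
  shows "2 * C * (9 / 16 * L * \<eta>\<^sup>2 / (real n * real Q)) * real T \<le> 9 / 8"
proof -
  have "2 * (C * L) \<le> L\<^sup>2 + C\<^sup>2"
    using sum_squares_bound[of L C] by (simp add: mult_ac)
  then have "9 / 16 * (2 * (C * L)) * (real T * \<eta>\<^sup>2) \<le> 9 / 16 * (L\<^sup>2 + C\<^sup>2) * (real T * \<eta>\<^sup>2)"
    by (intro mult_right_mono mult_left_mono) auto
  also have "\<dots> = 9 / 16 * ((L\<^sup>2 + C\<^sup>2) * real T * \<eta>\<^sup>2)"
    by simp
  also have "\<dots> \<le> 9 / 16 * (2 * real n * real Q)"
    using cap by (rule mult_left_mono) simp
  finally show ?thesis
    using n Q by (simp add: divide_le_eq mult_ac)
qed

section \<open>The convergence theorem\<close>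

theorem theorem3:
  fixes n Q :: nat
    and f :: "nat \<Rightarrow> real ^ 'p::finite \<Rightarrow> real"
    and L C D \<eta>\<^sub>s :: real
    and x0 :: "real ^ 'p"
    and c0 :: "nat \<Rightarrow> real ^ 'p"
    and g :: "nat \<Rightarrow> real ^ 'p \<Rightarrow> 's \<Rightarrow> real ^ 'p"
  assumes "n \<ge> 1" and "Q \<ge> 1"
    and "L > 0" and "\<And>i. i \<in> {1..n} \<Longrightarrow> smooth_with L (f i)"
    and "\<And>i. i \<in> {1..n} \<Longrightarrow> bdd_below (range (f i))"
    and "C \<ge> 0" and "D \<ge> 0" and "\<eta>\<^sub>s > 0"
  shows
    "(\<forall>(M :: 'w measure) F \<xi> \<eta>\<^sub>a T \<eta> \<Delta>\<^sub>1 \<Delta>\<^sub>2.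
        \<eta>\<^sub>a > 0 \<and> T \<ge> 1 \<and>
        abc_condition n Q f C D M F g \<xi> (scaffold_local n Q \<eta>\<^sub>s \<eta>\<^sub>a x0 c0 g \<xi>) \<and>
        \<eta> = \<eta>\<^sub>a * \<eta>\<^sub>s * real Q \<and>
        ereal \<eta> \<le> stepsize_cap n Q L C \<eta>\<^sub>s T \<and>
        \<Delta>\<^sub>1 = (1 / real n) * (\<Sum>i=1..n. (norm (c0 i - mean_vec n c0))\<^sup>2) \<and>
        \<Delta>\<^sub>2 = (1 / real n) * (\<Sum>i=1..n. (norm (gradient (f i) x0))\<^sup>2) \<longrightarrow>
        (\<forall>t<T. integrable M
           (\<lambda>\<omega>. (norm (gradient (mean_fun n f) (scaffold_x n Q \<eta>\<^sub>s \<eta>\<^sub>a x0 c0 g \<xi> t \<omega>)))\<^sup>2)) \<and>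
        (MIN t\<in>{0..<T}. prob_space.expectation M
           (\<lambda>\<omega>. (norm (gradient (mean_fun n f) (scaffold_x n Q \<eta>\<^sub>s \<eta>\<^sub>a x0 c0 g \<xi> t \<omega>)))\<^sup>2))
        \<le> 36 * (mean_fun n f x0 - (INF x. mean_fun n f x)) / (\<eta> * real T)
          + 192 * \<eta>\<^sup>2 * L\<^sup>2 * (\<Delta>\<^sub>1 + \<Delta>\<^sub>2) / (\<eta>\<^sub>s\<^sup>2 * real T)
          + 2 * \<eta> * L * (2 * C * sigma_star n f + D) / (real n * real Q)
          + (3 * L / real T + 14 * (L + C)) * 64 * \<eta>\<^sup>2 * L * (2 * C * sigma_star n f + D)
            / (\<eta>\<^sub>s\<^sup>2 * real Q))
     \<and>
     (\<forall>(M :: nat \<Rightarrow> 'w measure) F \<xi> \<eta>\<^sub>a \<gamma>\<^sub>s.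
        0 < D + C * sigma_star n f \<and>
        (\<forall>T\<ge>1. \<eta>\<^sub>a T > 0 \<and>
           abc_condition n Q f C D (M T) (F T) g (\<xi> T)
             (scaffold_local n Q \<eta>\<^sub>s (\<eta>\<^sub>a T) x0 c0 g (\<xi> T)) \<and>
           \<gamma>\<^sub>s T = sqrt (84 * L * (L + C)) / \<eta>\<^sub>s
                  + (560 * L * C * (L + C) * real T / (\<eta>\<^sub>s * real Q)) powr (1/3) \<and>
           \<eta>\<^sub>a T * \<eta>\<^sub>s * real Q =
             1 / (sqrt ((L\<^sup>2 + C\<^sup>2) * real T / (2 * real n * real Q)) + 12 * (L + C) + \<gamma>\<^sub>s T)) \<longrightarrow>
        (\<forall>T\<ge>1. \<forall>t<T. integrable (M T)
           (\<lambda>\<omega>. (norm (gradient (mean_fun n f)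
                    (scaffold_x n Q \<eta>\<^sub>s (\<eta>\<^sub>a T) x0 c0 g (\<xi> T) t \<omega>)))\<^sup>2)) \<and>
        (\<lambda>T. MIN t\<in>{0..<T}. prob_space.expectation (M T)
           (\<lambda>\<omega>. (norm (gradient (mean_fun n f)
                    (scaffold_x n Q \<eta>\<^sub>s (\<eta>\<^sub>a T) x0 c0 g (\<xi> T) t \<omega>)))\<^sup>2))
        \<in> O(\<lambda>T. (D + C * sigma_star n f) / sqrt (real n * real Q * real T)
               + C / ((\<eta>\<^sub>s * real Q) powr (1/3) * real T powr (2/3))
               + (real n * D + real n * C * sigma_star n f) / (\<eta>\<^sub>s\<^sup>2 * real T)))"
    (is "?finite \<and> ?asymptotic")
proof
  define \<sigma> where "\<sigma> = sigma_star n f"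
  define gap0 where "gap0 = mean_fun n f x0 - (INF x. mean_fun n f x)"
  define \<Delta> where "\<Delta> = avg n (\<lambda>i. (norm (c0 i - mean_vec n c0))\<^sup>2) + avg n (\<lambda>i. (norm (gradient (f i) x0))\<^sup>2)"
  have \<sigma>0: "0 \<le> \<sigma>"
    unfolding \<sigma>_def using assms(5) by (rule sigma_star_nonneg)
  have V0: "0 \<le> 2 * C * \<sigma> + D"
    using \<sigma>0 \<open>C \<ge> 0\<close> \<open>D \<ge> 0\<close> by simp
  have gap00: "0 \<le> gap0"
    unfolding gap0_def using bdd_below_mean_fun[of n f] assms(5) by (simp add: cINF_lower)
  have \<Delta>0: "0 \<le> \<Delta>"
    unfolding \<Delta>_def by (intro add_nonneg_nonneg avg_nonneg) auto
  have run: "scaffold_run n Q f L C D \<eta>\<^sub>s \<eta>\<^sub>a x0 c0 g M F \<xi>"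
    if "\<eta>\<^sub>a > 0" "abc_condition n Q f C D M F g \<xi> (scaffold_local n Q \<eta>\<^sub>s \<eta>\<^sub>a x0 c0 g \<xi>)"
    for M :: "'w measure" and F \<xi> \<eta>\<^sub>a
    using assms that by unfold_locales auto
  show ?finite
  proof (intro allI impI, elim conjE, rule conjI)
    fix M :: "'w measure" and F \<xi> and \<eta>\<^sub>a :: real and T :: nat and \<eta> \<Delta>\<^sub>1 \<Delta>\<^sub>2 :: real
    assume \<eta>\<^sub>a: "\<eta>\<^sub>a > 0" and T: "T \<ge> 1"
      and abc: "abc_condition n Q f C D M F g \<xi> (scaffold_local n Q \<eta>\<^sub>s \<eta>\<^sub>a x0 c0 g \<xi>)"
      and \<eta>_eq: "\<eta> = \<eta>\<^sub>a * \<eta>\<^sub>s * real Q" and cap: "ereal \<eta> \<le> stepsize_cap n Q L C \<eta>\<^sub>s T"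
      and \<Delta>\<^sub>1: "\<Delta>\<^sub>1 = (1 / real n) * (\<Sum>i=1..n. (norm (c0 i - mean_vec n c0))\<^sup>2)"
      and \<Delta>\<^sub>2: "\<Delta>\<^sub>2 = (1 / real n) * (\<Sum>i=1..n. (norm (gradient (f i) x0))\<^sup>2)"
    interpret r: scaffold_run n Q f L C D \<eta>\<^sub>s \<eta>\<^sub>a x0 c0 g M F \<xi>
      using \<eta>\<^sub>a abc by (rule run)
    show "\<forall>t<T. integrable M
           (\<lambda>\<omega>. (norm (gradient (mean_fun n f) (scaffold_x n Q \<eta>\<^sub>s \<eta>\<^sub>a x0 c0 g \<xi> t \<omega>)))\<^sup>2)"
      unfolding r.X_def[symmetric] by simp
    have r\<eta>: "r.\<eta> = \<eta>" by (simp add: r.\<eta>_def \<eta>_eq)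
    have \<eta>: "\<eta> > 0" using r.\<eta>_pos by (simp add: r\<eta>)
    note caps = stepsize_cap_conditions[OF \<open>L > 0\<close> \<open>C \<ge> 0\<close> \<open>\<eta>\<^sub>s > 0\<close> \<open>n \<ge> 1\<close> \<open>Q \<ge> 1\<close> T \<eta> cap]
    define \<kappa> where "\<kappa> = 9 / 16 * L * \<eta>\<^sup>2 / (real n * real Q) + 78 * \<eta> * L\<^sup>2 * (\<eta> / \<eta>\<^sub>s)\<^sup>2 / real Q"
    have "2 * C * (78 * \<eta> * L\<^sup>2 * (\<eta> / \<eta>\<^sub>s)\<^sup>2 / real Q) * real T \<le> 156 / 560"
    proof -
      have "560 * (C * L\<^sup>2 * real T * \<eta> ^ 3) \<le> 560 * L * C * (L + C) * real T * \<eta> ^ 3"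
        using \<open>L > 0\<close> \<open>C \<ge> 0\<close> \<eta> by (simp add: algebra_simps power2_eq_square)
      also note caps(4)
      finally have "560 * (C * L\<^sup>2 * real T * \<eta> ^ 3) \<le> \<eta>\<^sub>s\<^sup>2 * real Q" .
      then show ?thesis
        using \<open>\<eta>\<^sub>s > 0\<close> \<open>Q \<ge> 1\<close>
        by (simp add: power_divide divide_le_eq power2_eq_square power3_eq_cube mult_ac)
    qed
    moreover have "2 * C * \<kappa> * real T = 2 * C * (9 / 16 * L * \<eta>\<^sup>2 / (real n * real Q)) * real T
        + 2 * C * (78 * \<eta> * L\<^sup>2 * (\<eta> / \<eta>\<^sub>s)\<^sup>2 / real Q) * real T"
      by (simp add: \<kappa>_def distrib_left distrib_right)
    ultimately have "2 * C * \<kappa> * real T \<le> 3 / 2"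
      using growth_exponent_le[OF \<open>L > 0\<close> \<open>C \<ge> 0\<close> \<open>n \<ge> 1\<close> \<open>Q \<ge> 1\<close> caps(3)] by linarith
    then have "(1 + 2 * C * \<kappa>) ^ T \<le> exp (3 / 2)"
      using \<open>L > 0\<close> \<open>C \<ge> 0\<close> \<eta> by (intro power_one_plus_le_exp) (auto simp: \<kappa>_def)
    \<comment> \<open>\<open>7/3 * 11/2 < 36\<close> and \<open>12 * 7/3 * 11/2 = 154 < 192\<close>\<close>
    then have B: "(1 + 2 * C * \<kappa>) ^ T \<le> 11 / 2"
      using exp_three_halves_le by simp
    have "(MIN t\<in>{0..<T}. r.grad_sq t) \<le> 7 / 3 * (11 / 2)
        * (gap0 / (\<eta> * real T) + 12 * L\<^sup>2 * (\<eta> / \<eta>\<^sub>s)\<^sup>2 * \<Delta> / real T) + 7 / 3 * (\<kappa> / \<eta>) * (2 * C * \<sigma> + D)"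
      using r.min_grad_sq_le[OF T _ _ _ B] caps(1,2)
      by (simp add: r\<eta> \<kappa>_def gap0_def \<Delta>_def \<sigma>_def r.noise_floor_def)
    also have "\<dots> \<le> 36 * gap0 / (\<eta> * real T)
          + 192 * \<eta>\<^sup>2 * L\<^sup>2 * \<Delta> / (\<eta>\<^sub>s\<^sup>2 * real T)
          + 2 * \<eta> * L * (2 * C * \<sigma> + D) / (real n * real Q)
          + (3 * L / real T + 14 * (L + C)) * 64 * \<eta>\<^sup>2 * L * (2 * C * \<sigma> + D) / (\<eta>\<^sub>s\<^sup>2 * real Q)"
    proof -
      define u where "u = gap0 / (\<eta> * real T)"
      define v where "v = L\<^sup>2 * (\<eta> / \<eta>\<^sub>s)\<^sup>2 * \<Delta> / real T"
      define w where "w = L * \<eta> * (2 * C * \<sigma> + D) / (real n * real Q)"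
      define x where "x = L\<^sup>2 * \<eta>\<^sup>2 * (2 * C * \<sigma> + D) / (\<eta>\<^sub>s\<^sup>2 * real Q)"
      have nonneg: "0 \<le> u" "0 \<le> v" "0 \<le> w" "0 \<le> x"
        using gap00 \<Delta>0 V0 \<eta> \<open>L > 0\<close> by (auto simp: u_def v_def w_def x_def)
      have "7 / 3 * (\<kappa> / \<eta>) * N = 21 / 16 * (L * \<eta> * N / (real n * real Q))
          + 182 * (L\<^sup>2 * \<eta>\<^sup>2 * N / (\<eta>\<^sub>s\<^sup>2 * real Q))" for N
        using \<eta> by (simp add: \<kappa>_def power_divide power2_eq_square add_divide_distrib
            distrib_left distrib_right mult_ac)
      then have "7 / 3 * (\<kappa> / \<eta>) * (2 * C * \<sigma> + D) = 21 / 16 * w + 182 * x"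
        by (simp only: w_def x_def)
      moreover have "192 * \<eta>\<^sup>2 * L\<^sup>2 * \<Delta> / (\<eta>\<^sub>s\<^sup>2 * real T) = 192 * v"
        by (simp add: v_def power_divide)
      \<comment> \<open>\<open>896 = 14 * 64\<close> leaves ample room for \<open>182 = 78 * 7/3\<close>\<close>
      moreover have "896 * x \<le> (3 * L / real T + 14 * (L + C)) * 64 * \<eta>\<^sup>2 * L * (2 * C * \<sigma> + D) / (\<eta>\<^sub>s\<^sup>2 * real Q)"
      proof -
        define y where "y = \<eta>\<^sup>2 * L * (2 * C * \<sigma> + D) / (\<eta>\<^sub>s\<^sup>2 * real Q)"
        have "0 \<le> y" using V0 \<open>L > 0\<close> by (simp add: y_def)
        moreover have "14 * L \<le> 3 * L / real T + 14 * (L + C)"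
          using \<open>L > 0\<close> \<open>C \<ge> 0\<close> by simp
        ultimately have "(14 * L) * 64 * y \<le> (3 * L / real T + 14 * (L + C)) * 64 * y"
          by (intro mult_right_mono) auto
        then show ?thesis
          by (simp add: x_def y_def power2_eq_square mult_ac)
      qed
      moreover have "36 * gap0 / (\<eta> * real T) = 36 * u"
        by (simp add: u_def)
      moreover have "2 * \<eta> * L * (2 * C * \<sigma> + D) / (real n * real Q) = 2 * w"
        by (simp add: w_def)
      moreover have "7 / 3 * (11 / 2) * (gap0 / (\<eta> * real T) + 12 * L\<^sup>2 * (\<eta> / \<eta>\<^sub>s)\<^sup>2 * \<Delta> / real T)
          = 77 / 6 * u + 154 * v"
        by (simp add: u_def v_def)
      ultimately show ?thesis
        using nonneg by linarith
    qed
    finally show "(MIN t\<in>{0..<T}. prob_space.expectation M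
           (\<lambda>\<omega>. (norm (gradient (mean_fun n f) (scaffold_x n Q \<eta>\<^sub>s \<eta>\<^sub>a x0 c0 g \<xi> t \<omega>)))\<^sup>2))
        \<le> 36 * (mean_fun n f x0 - (INF x. mean_fun n f x)) / (\<eta> * real T)
          + 192 * \<eta>\<^sup>2 * L\<^sup>2 * (\<Delta>\<^sub>1 + \<Delta>\<^sub>2) / (\<eta>\<^sub>s\<^sup>2 * real T)
          + 2 * \<eta> * L * (2 * C * sigma_star n f + D) / (real n * real Q)
          + (3 * L / real T + 14 * (L + C)) * 64 * \<eta>\<^sup>2 * L * (2 * C * sigma_star n f + D)
            / (\<eta>\<^sub>s\<^sup>2 * real Q)"
      unfolding r.grad_sq_def r.X_def gap0_def \<Delta>_def \<sigma>_def \<Delta>\<^sub>1 \<Delta>\<^sub>2 avg_def .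
  qed
  show ?asymptotic
  proof (intro allI impI, elim conjE, rule conjI)
    fix M :: "nat \<Rightarrow> 'w measure" and F \<xi> and \<eta>\<^sub>a \<gamma>\<^sub>s :: "nat \<Rightarrow> real"
    assume V: "0 < D + C * sigma_star n f"
      and "\<forall>T\<ge>1. \<eta>\<^sub>a T > 0 \<and>
           abc_condition n Q f C D (M T) (F T) g (\<xi> T)
             (scaffold_local n Q \<eta>\<^sub>s (\<eta>\<^sub>a T) x0 c0 g (\<xi> T)) \<and>
           \<gamma>\<^sub>s T = sqrt (84 * L * (L + C)) / \<eta>\<^sub>s
                  + (560 * L * C * (L + C) * real T / (\<eta>\<^sub>s * real Q)) powr (1/3) \<and>
           \<eta>\<^sub>a T * \<eta>\<^sub>s * real Q =
             1 / (sqrt ((L\<^sup>2 + C\<^sup>2) * real T / (2 * real n * real Q)) + 12 * (L + C) + \<gamma>\<^sub>s T)"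
    then have \<eta>\<^sub>a: "\<eta>\<^sub>a T > 0"
      and abc: "abc_condition n Q f C D (M T) (F T) g (\<xi> T) (scaffold_local n Q \<eta>\<^sub>s (\<eta>\<^sub>a T) x0 c0 g (\<xi> T))"
      and \<gamma>: "\<gamma>\<^sub>s T = sqrt (84 * L * (L + C)) / \<eta>\<^sub>s
                  + (560 * L * C * (L + C) * real T / (\<eta>\<^sub>s * real Q)) powr (1/3)"
      and \<eta>_eq: "\<eta>\<^sub>a T * \<eta>\<^sub>s * real Q =
             1 / (sqrt ((L\<^sup>2 + C\<^sup>2) * real T / (2 * real n * real Q)) + 12 * (L + C) + \<gamma>\<^sub>s T)"
      if "T \<ge> 1" for T
      using that by blast+
    have run_T: "scaffold_run n Q f L C D \<eta>\<^sub>s (\<eta>\<^sub>a T) x0 c0 g (M T) (F T) (\<xi> T)" if "T \<ge> 1" for T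
      using \<eta>\<^sub>a[OF that] abc[OF that] by (rule run)
    show "\<forall>T\<ge>1. \<forall>t<T. integrable (M T)
           (\<lambda>\<omega>. (norm (gradient (mean_fun n f)
                    (scaffold_x n Q \<eta>\<^sub>s (\<eta>\<^sub>a T) x0 c0 g (\<xi> T) t \<omega>)))\<^sup>2)"
    proof (intro allI impI)
      fix T t :: nat assume T: "T \<ge> 1" "t < T"
      interpret r: scaffold_run n Q f L C D \<eta>\<^sub>s "\<eta>\<^sub>a T" x0 c0 g "M T" "F T" "\<xi> T"
        using T by (intro run_T)
      show "integrable (M T) (\<lambda>\<omega>. (norm (gradient (mean_fun n f)
                    (scaffold_x n Q \<eta>\<^sub>s (\<eta>\<^sub>a T) x0 c0 g (\<xi> T) t \<omega>)))\<^sup>2)"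
        unfolding r.X_def[symmetric] by simp
    qed
    define m where "m T = (MIN t\<in>{0..<T}. prob_space.expectation (M T)
           (\<lambda>\<omega>. (norm (gradient (mean_fun n f) (scaffold_x n Q \<eta>\<^sub>s (\<eta>\<^sub>a T) x0 c0 g (\<xi> T) t \<omega>)))\<^sup>2))" for T
    \<comment> \<open>\<open>1/\<eta>\<close> lies between \<open>sqrt a * sqrt T\<close> and \<open>(sqrt a + b) * sqrt T\<close>\<close>
    define a where "a = (L\<^sup>2 + C\<^sup>2) / (2 * real n * real Q)"
    define b where "b = 12 * (L + C) + sqrt (84 * L * (L + C)) / \<eta>\<^sub>s
        + (560 * L * C * (L + C) / (\<eta>\<^sub>s * real Q)) powr (1/3)"
    have a0: "0 < a"
      using assms by (auto simp: a_def intro!: divide_pos_pos add_pos_nonneg)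
    \<comment> \<open>a bound on the total growth over \<open>T\<close> rounds that does not depend on \<open>T\<close>\<close>
    define B where "B = exp (9 / 8 + 2 * C * (78 * L\<^sup>2 / (real Q * \<eta>\<^sub>s\<^sup>2 * a * (12 * (L + C)))))"
    define E where "E = 7 / 3 * B * (gap0 * (sqrt a + b) + 12 * L\<^sup>2 / (a * \<eta>\<^sub>s\<^sup>2) * \<Delta>)
        + 7 / 3 * (9 / 16 * L / (real n * real Q) / sqrt a + 78 * L\<^sup>2 / (a * \<eta>\<^sub>s\<^sup>2 * real Q)) * (2 * C * \<sigma> + D)"
    have bound: "0 \<le> m T \<and> m T \<le> E / sqrt (real T)" if T: "T \<ge> 1" for T
    proof -
      interpret r: scaffold_run n Q f L C D \<eta>\<^sub>s "\<eta>\<^sub>a T" x0 c0 g "M T" "F T" "\<xi> T"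
        using T by (rule run_T)
      define \<eta> where "\<eta> = r.\<eta>"
      have m_eq: "m T = (MIN t\<in>{0..<T}. r.grad_sq t)"
        by (simp add: m_def r.grad_sq_def r.X_def)
      have "0 \<le> m T"
        unfolding m_eq using T by (subst Min_ge_iff) (auto simp: r.grad_sq_def)
      define s where "s = sqrt (real T)"
      have s1: "1 \<le> s" using T by (simp add: s_def)
      have s2: "s\<^sup>2 = real T" by (simp add: s_def)
      have \<eta>: "0 < \<eta>" by (simp add: \<eta>_def r.\<eta>_pos)
      define e where "e = sqrt a * s + 12 * (L + C) + \<gamma>\<^sub>s T"
      have "\<eta> = 1 / e"
        using \<eta>_eq[OF T] by (simp add: \<eta>_def r.\<eta>_def e_def a_def s_def flip: real_sqrt_mult)
      then have e0: "0 < e" and inv: "1 / \<eta> = e" and \<eta>e: "\<eta> * e = 1"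
        using \<eta> by (auto simp: zero_less_divide_iff)
      have parts: "0 \<le> sqrt a * s" "0 \<le> 12 * (L + C)" "0 \<le> sqrt (84 * L * (L + C)) / \<eta>\<^sub>s"
        "0 \<le> (560 * L * C * (L + C) * real T / (\<eta>\<^sub>s * real Q)) powr (1/3)"
        using assms a0 s1 by auto
      have \<eta>_le: "\<eta> * x \<le> 1" if "x \<le> e" for x
        using mult_left_mono[OF that, of \<eta>] \<eta> \<eta>e by simp
      have c1: "84 * L * (L + C) * (\<eta> / \<eta>\<^sub>s)\<^sup>2 \<le> 1"
      proof -
        have "\<eta> * (sqrt (84 * L * (L + C)) / \<eta>\<^sub>s) \<le> 1"
          using parts by (intro \<eta>_le) (unfold e_def \<gamma>[OF T], linarith)
        then have "(\<eta> * (sqrt (84 * L * (L + C)) / \<eta>\<^sub>s))\<^sup>2 \<le> 1"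
          using \<eta> parts by (intro power_le_one mult_nonneg_nonneg) simp_all
        then show ?thesis
          using assms by (simp add: power_mult_distrib power_divide mult.commute)
      qed
      have c2: "12 * (L + C) * \<eta> \<le> 1"
      proof -
        have "\<eta> * (12 * (L + C)) \<le> 1"
          using parts by (intro \<eta>_le) (unfold e_def \<gamma>[OF T], linarith)
        then show ?thesis by (simp add: mult.commute)
      qed
      have \<eta>s: "\<eta> * (sqrt a * s) \<le> 1"
        using parts by (intro \<eta>_le) (unfold e_def \<gamma>[OF T], linarith)
      have \<eta>2: "\<eta>\<^sup>2 * a * real T \<le> 1"
      proof -
        have "(\<eta> * (sqrt a * s))\<^sup>2 \<le> 1"
          using \<eta> a0 s1 \<eta>s by (intro power_le_one mult_nonneg_nonneg) simp_all
        then show ?thesis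
          using a0 by (simp add: power_mult_distrib s2 mult_ac)
      qed
      then have c3: "(L\<^sup>2 + C\<^sup>2) * real T * \<eta>\<^sup>2 \<le> 2 * real n * real Q"
        using assms(1,2) by (simp add: a_def divide_le_eq mult_ac)
      define \<kappa> where "\<kappa> = 9 / 16 * L * \<eta>\<^sup>2 / (real n * real Q) + 78 * \<eta> * L\<^sup>2 * (\<eta> / \<eta>\<^sub>s)\<^sup>2 / real Q"
      have \<kappa>0: "0 \<le> \<kappa>" using \<eta> assms by (simp add: \<kappa>_def)
      have "78 * \<eta> * L\<^sup>2 * (\<eta> / \<eta>\<^sub>s)\<^sup>2 / real Q * real T
          \<le> 78 * L\<^sup>2 / (real Q * \<eta>\<^sub>s\<^sup>2 * a * (12 * (L + C)))"
      proof -
        \<comment> \<open>\<open>\<eta> ^ 3 T\<close> is bounded by the second and third caps together\<close>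
        have "(12 * (L + C) * \<eta>) * (\<eta>\<^sup>2 * a * real T) \<le> 1 * 1"
          using c2 \<eta>2 \<eta> a0 by (intro mult_mono) auto
        then have "78 * L\<^sup>2 * ((12 * (L + C) * \<eta>) * (\<eta>\<^sup>2 * a * real T)) \<le> 78 * L\<^sup>2 * 1"
          by (intro mult_left_mono) auto
        moreover have "0 < 12 * (L + C)"
          using assms by simp
        moreover have "78 * \<eta> * L\<^sup>2 * (\<eta> / \<eta>\<^sub>s)\<^sup>2 / real Q * real T
            = 78 * L\<^sup>2 * ((k * \<eta>) * (\<eta>\<^sup>2 * a * real T)) / (real Q * \<eta>\<^sub>s\<^sup>2 * a * k)" if "0 < k" for k
          using that a0 by (simp add: power_divide mult_ac)
        ultimately show ?thesis
          using a0 by (simp only: mult_1_right) (intro divide_right_mono, simp_all)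
      qed
      then have "2 * C * (78 * \<eta> * L\<^sup>2 * (\<eta> / \<eta>\<^sub>s)\<^sup>2 / real Q * real T)
          \<le> 2 * C * (78 * L\<^sup>2 / (real Q * \<eta>\<^sub>s\<^sup>2 * a * (12 * (L + C))))"
        using assms by (intro mult_left_mono) auto
      moreover have "2 * C * \<kappa> * real T = 2 * C * (9 / 16 * L * \<eta>\<^sup>2 / (real n * real Q)) * real T
          + 2 * C * (78 * \<eta> * L\<^sup>2 * (\<eta> / \<eta>\<^sub>s)\<^sup>2 / real Q * real T)"
        by (simp add: \<kappa>_def distrib_left distrib_right)
      ultimately have "2 * C * \<kappa> * real T
          \<le> 9 / 8 + 2 * C * (78 * L\<^sup>2 / (real Q * \<eta>\<^sub>s\<^sup>2 * a * (12 * (L + C))))"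
        using growth_exponent_le[OF assms(3,6,1,2) c3] by linarith
      then have B: "(1 + 2 * C * \<kappa>) ^ T \<le> B"
        unfolding B_def using \<kappa>0 assms by (intro power_one_plus_le_exp) auto
      have \<delta>: "\<eta>\<^sup>2 \<le> 1 / a / s"
      proof -
        have "\<eta>\<^sup>2 * a * s \<le> \<eta>\<^sup>2 * a * real T"
          using s1 a0 \<eta> by (intro mult_left_mono) (auto simp: s2[symmetric] power2_eq_square)
        then have "\<eta>\<^sup>2 * a * s \<le> 1"
          using \<eta>2 by linarith
        then show ?thesis
          using a0 s1 by (simp add: pos_le_divide_eq mult_ac)
      qed
      have "m T \<le> 7 / 3 * B * (gap0 / (\<eta> * real T) + 12 * L\<^sup>2 * (\<eta> / \<eta>\<^sub>s)\<^sup>2 * \<Delta> / real T)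
          + 7 / 3 * (\<kappa> / \<eta>) * (2 * C * \<sigma> + D)"
        unfolding m_eq using r.min_grad_sq_le[OF T _ _ _ B] c1 c2
        by (simp add: \<eta>_def[symmetric] \<kappa>_def gap0_def \<Delta>_def \<sigma>_def r.noise_floor_def)
      also have "\<dots> \<le> 7 / 3 * B * (gap0 * (sqrt a + b) / s + 12 * L\<^sup>2 / (a * \<eta>\<^sub>s\<^sup>2) * \<Delta> / s)
          + 7 / 3 * ((9 / 16 * L / (real n * real Q) / sqrt a + 78 * L\<^sup>2 / (a * \<eta>\<^sub>s\<^sup>2 * real Q)) / s) * (2 * C * \<sigma> + D)"
      proof (intro add_mono mult_left_mono mult_right_mono V0)
        have "e \<le> (sqrt a + b) * s"
        proof -
          have "real T powr (1/3) \<le> real T powr (1/2)"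
            using T by (intro powr_mono) auto
          also have "\<dots> = s"
            by (simp add: s_def powr_half_sqrt)
          finally have "(560 * L * C * (L + C) * real T / (\<eta>\<^sub>s * real Q)) powr (1/3)
              \<le> (560 * L * C * (L + C) / (\<eta>\<^sub>s * real Q)) powr (1/3) * s"
            using assms powr_mult[of "560 * L * C * (L + C) / (\<eta>\<^sub>s * real Q)" "real T" "1/3"]
            by (simp add: mult_left_mono)
          moreover have "12 * (L + C) \<le> 12 * (L + C) * s"
            "sqrt (84 * L * (L + C)) / \<eta>\<^sub>s \<le> sqrt (84 * L * (L + C)) / \<eta>\<^sub>s * s"
            using mult_left_mono[OF s1 parts(2)] mult_left_mono[OF s1 parts(3)] by simp_all
          ultimately show ?thesis
            by (simp add: e_def b_def \<gamma>[OF T] distrib_right)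
        qed
        then have "gap0 * e / real T \<le> gap0 * ((sqrt a + b) * s) / real T"
          using gap00 by (intro divide_right_mono mult_left_mono) auto
        also have "\<dots> = gap0 * (sqrt a + b) / s"
          using s1 by (simp add: s2[symmetric] power2_eq_square)
        finally show "gap0 / (\<eta> * real T) \<le> gap0 * (sqrt a + b) / s"
          by (simp add: inv[symmetric])
        have "12 * L\<^sup>2 * (\<eta> / \<eta>\<^sub>s)\<^sup>2 * \<Delta> / real T \<le> 12 * L\<^sup>2 * (\<eta> / \<eta>\<^sub>s)\<^sup>2 * \<Delta> / 1"
          using T \<Delta>0 by (intro divide_left_mono) auto
        also have "\<dots> = 12 * L\<^sup>2 / \<eta>\<^sub>s\<^sup>2 * \<Delta> * \<eta>\<^sup>2"
          by (simp add: power_divide)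
        also have "\<dots> \<le> 12 * L\<^sup>2 / \<eta>\<^sub>s\<^sup>2 * \<Delta> * (1 / a / s)"
          using \<delta> \<Delta>0 by (intro mult_left_mono) auto
        finally show "12 * L\<^sup>2 * (\<eta> / \<eta>\<^sub>s)\<^sup>2 * \<Delta> / real T \<le> 12 * L\<^sup>2 / (a * \<eta>\<^sub>s\<^sup>2) * \<Delta> / s"
          by (simp add: mult_ac)
        have "\<kappa> / \<eta> = 9 / 16 * L / (real n * real Q) * \<eta> + 78 * L\<^sup>2 / (\<eta>\<^sub>s\<^sup>2 * real Q) * \<eta>\<^sup>2"
          using \<eta> by (simp add: \<kappa>_def add_divide_distrib power2_eq_square power_divide)
        also have "\<dots> \<le> 9 / 16 * L / (real n * real Q) * (1 / sqrt a / s) + 78 * L\<^sup>2 / (\<eta>\<^sub>s\<^sup>2 * real Q) * (1 / a / s)"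
        proof (intro add_mono mult_left_mono \<delta>)
          show "\<eta> \<le> 1 / sqrt a / s"
            using \<eta>s a0 s1 by (simp add: pos_le_divide_eq mult_ac)
        qed (use assms in auto)
        finally show "\<kappa> / \<eta> \<le> (9 / 16 * L / (real n * real Q) / sqrt a + 78 * L\<^sup>2 / (a * \<eta>\<^sub>s\<^sup>2 * real Q)) / s"
          by (simp add: add_divide_distrib mult_ac)
      qed (auto simp: B_def)
      also have "\<dots> = E / s"
      proof -
        have "7 / 3 * B * (x / s + y / s) + 7 / 3 * (z / s) * v = (7 / 3 * B * (x + y) + 7 / 3 * z * v) / s"
          for x y z v
          by (simp add: add_divide_distrib distrib_left)
        then show ?thesis by (simp only: E_def)
      qed
      finally show ?thesis
        using \<open>0 \<le> m T\<close> by (simp add: s_def)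
    qed
    have "m \<in> O(\<lambda>T. (D + C * sigma_star n f) / sqrt (real n * real Q * real T)
               + C / ((\<eta>\<^sub>s * real Q) powr (1/3) * real T powr (2/3))
               + (real n * D + real n * C * sigma_star n f) / (\<eta>\<^sub>s\<^sup>2 * real T))"
      (is "_ \<in> O(?rate)")
    proof (rule bigoI[where c = "E * sqrt (real n * real Q) / (D + C * sigma_star n f)"],
        rule eventually_at_top_linorderI)
      fix T :: nat assume T: "T \<ge> 1"
      let ?main = "(D + C * sigma_star n f) / sqrt (real n * real Q * real T)"
      have pos: "0 < sqrt (real n * real Q)" "0 < sqrt (real T)"
        using T assms(1,2) by auto
      have "0 \<le> E / sqrt (real T)"
        using bound[OF T] by linarith
      then have E0: "0 \<le> E"
        using pos(2) by (simp add: zero_le_divide_iff)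
      have "real n * D + real n * C * sigma_star n f = real n * (D + C * sigma_star n f)"
        by (simp add: distrib_left)
      then have "?main \<le> ?rate T"
        using V assms(6) by simp
      moreover have "0 \<le> ?main"
        using V by simp
      ultimately have le: "?main \<le> norm (?rate T)"
        by simp
      have "norm (m T) \<le> E / sqrt (real T)"
        using bound[OF T] by simp
      also have "\<dots> = E * sqrt (real n * real Q) / (D + C * sigma_star n f) * ?main"
        using V pos assms(1,2) by (simp add: real_sqrt_mult)
      also have "\<dots> \<le> E * sqrt (real n * real Q) / (D + C * sigma_star n f) * norm (?rate T)"
        using le E0 V by (intro mult_left_mono) auto
      finally show "norm (m T) \<le> E * sqrt (real n * real Q) / (D + C * sigma_star n f) * norm (?rate T)" .
    qed
    then show "(\<lambda>T. MIN t\<in>{0..<T}. prob_space.expectation (M T)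
           (\<lambda>\<omega>. (norm (gradient (mean_fun n f)
                    (scaffold_x n Q \<eta>\<^sub>s (\<eta>\<^sub>a T) x0 c0 g (\<xi> T) t \<omega>)))\<^sup>2))
        \<in> O(?rate)"
      unfolding m_def .
  qed
qed

end
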